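(* Let $N\in\mathbb N$, and for $i=1,\dots,N$ let $U^i:[0,\infty]^N\times\Omega\to\mathbb R$ be such that $U^i(t_1,\dots,t_N)$ is $\mathcal F_{t_1\vee\dots\vee t_N}$-measurable for all $(t_1,\dots,t_N)\in[0,\infty]^N$. Assume there is a bounded nondecreasing function $\eta:\mathbb R_+\to\mathbb R_+$ with $\lim_{\delta\searrow0}\eta(\delta)=\eta(0)=0$ such that for all $i=1,\dots,N$ and all $(t_1,\dots,t_N),(t_1',\dots,t_N')\in[0,\infty]^N$, $$|U^i(t_1,\dots,t_N)-U^i(t_1',\dots,t_N')|\le\eta(|t_1-t_1'|+\dots+|t_N-t_N'|).$$ Let $\theta\in\mathcal T$ be a stopping time, and for $\boldsymbol\rho^1,\dots,\boldsymbol\rho^N\in\mathbb T^N_\theta$ ($\boldsymbol\rho^i$ being the strategy of player $i$) set $$u^i(\boldsymbol\rho^1,\dots,\boldsymbol\rho^N):=\mathbb E_\theta\big[U^i(\boldsymbol\rho^1[\boldsymbol\rho^{-1}],\dots,\boldsymbol\rho^N[\boldsymbol\rho^{-N}])\big],\qquad i=1,\dots,N.$$ Then for every $\varepsilon>0$ there exists an $\varepsilon$-Nash equilibrium in pure stopping strategies, i.e. an $N$-tuple $(\hat{\boldsymbol\rho}^1,\dots,\hat{\boldsymbol\rho}^N)\in(\mathbb T^N_\theta)^N$ such that for all $\boldsymbol\rho^1,\dots,\boldsymbol\rho^N\in\mathbb T^N_\theta$ and all $i=1,\dots,N$, $$u^i(\hat{\boldsymbol\rho}^1,\dots,\hat{\boldsymbol\rho}^{i-1},\boldsymbol\rho^i,\hat{\boldsymbol\rho}^{i+1},\dots,\hat{\boldsymbol\rho}^N)\le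 u^i(\hat{\boldsymbol\rho}^1,\dots,\hat{\boldsymbol\rho}^N)+\varepsilon .$$
   Context: Setting: $(\Omega,\mathcal F,(\mathcal F_t)_{t\in[0,\infty]},\mathbb P)$ is a filtered probability space with $\mathcal F=\mathcal F_\infty$ and filtration satisfying the usual conditions; $\Omega$ is at most countable and $\mathbb P$ is supported on $\Omega$ (every nonempty event has positive probability). $\mathcal T$ is the set of stopping times with values in $[0,\infty]$; $\mathbb E_\theta[\cdot]:=\mathbb E[\cdot\mid\mathcal F_\theta]$. For $t\in[0,\infty]$, $\mathcal T_{t+}$ is the set of stopping times that are strictly greater than $t$ if $t<\infty$ (no restriction if $t=\infty$). Convention for times: $|\infty-\infty|=0$, $|\infty-t|=\infty$ for $t<\infty$, and $\eta(\infty):=\sup\eta$. Stopping strategies of order $N$: a strategy $\boldsymbol\rho\in\mathbb T^N$ of player $i\in\{1,\dots,N\}$ is a family $(\rho_\alpha)_\alpha$ indexed by the $2^{N-1}$ subsets $\alpha$ of $\{1,\dots,N\}\setminus\{i\}$ (the opponents), such that $\rho:=\rho_\emptyset\in\mathcal T$ and, for every nonempty $\alpha=\{i_1<\dots<i_n\}$, the map $\rho_{i_1,\dots,i_n}:[0,\infty]^n\times\Omega\to[0,\infty]$ is $\mathcal B([0,\infty]^n)\otimes\mathcal F$-measurable and $\rho_{i_1,\dots,i_n}(t_1,\dots,t_n,\cdot)\in\mathcal T_{(t_1\vee\dots\vee t_n)+}$ for all $t_1,\dots,t_n$. For $\sigma\in\mathcal T$, $\mathbb T^N_\sigma:=\{\boldsymbol\rho\in\mathbb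 T^N:\rho\ge\sigma\}$. Interpretation: $\rho$ is the initial stopping time, and $\rho_{i_1,\dots,i_n}(t_1,\dots,t_n,\cdot)$ is the time the player plans to stop at if she has not stopped by $t_1\vee\dots\vee t_n$ and has observed that exactly players $i_1,\dots,i_n$ stopped, at times $t_1,\dots,t_n$. Actual stopping times: $\boldsymbol\rho^i[\boldsymbol\rho^{-i}]$, where $\boldsymbol\rho^{-i}$ denotes the strategies of the players other than $i$, is the time at which player $i$ actually stops. It is determined for each $\omega$ recursively. Start with $S=\emptyset$. If $S\ne\{1,\dots,N\}$ is the set of players who have already stopped, at times $(r_j)_{j\in S}$, let $c_i:=\rho^i_S((r_j)_{j\in S},\omega)$ for $i\notin S$ (with $c_i=\rho^i(\omega)$ if $S=\emptyset$), let $m:=\min_{i\notin S}c_i$, set $r_i:=m$ for all $i\notin S$ with $c_i=m$, add these players to $S$, and repeat until all players have stopped. Then $\boldsymbol\rho^i[\boldsymbol\rho^{-i}](\omega):=r_i$. For $N=2$ and $\boldsymbol\rho=(\rho,\rho_1),\boldsymbol\tau=(\tau,\tau_1)$ this gives $\boldsymbol\rho[\boldsymbol\tau]=\rho1_{\{\rho\le\tau\}}+\rho_1(\tau)1_{\{\rho>\tau\}}$, where $\rho_1(\tau):=\rho_1(\tau(\cdot),\cdot)$ and $\rho_1$ is the response to the single opponent. *)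

theory Defs
  imports "HOL-Probability.Probability"
begin

text \<open>Times are extended nonnegative reals, so the filtration is indexed by the whole of
  $[0,\infty]$, and \<^const>\<open>filtration.pre_sigma\<close> is the sigma-algebra of a stopping time that
  may take the value \<^term>\<open>\<top> :: ennreal\<close>.\<close>

definition usual_conditions :: "'a measure \<Rightarrow> (ennreal \<Rightarrow> 'a measure) \<Rightarrow> bool" where
  "usual_conditions M F \<longleftrightarrow>
     (\<forall>t<\<top>. sets (F t) = (\<Inter>s\<in>{t<..}. sets (F s))) \<and>
     (\<forall>A\<in>null_sets M. \<forall>B\<subseteq>A. B \<in> sets (F 0))"

locale countable_filtered_prob_space = prob_space M + filtration "space M" F
  for M :: "'a measure" and F :: "ennreal \<Rightarrow> 'a measure" +
  assumes F_top: "sets (F \<top>) = sets M"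
    and usual: "usual_conditions M F"
    and countable_space: "countable (space M)"
    and full_support: "\<And>A. A \<in> sets M \<Longrightarrow> A \<noteq> {} \<Longrightarrow> measure M A > 0"

text \<open>On \<^typ>\<open>ennreal\<close> one has \<open>\<top> - \<top> = \<top>\<close>, whereas the distance from infinity to itself
  is zero here.\<close>

definition time_dist :: "ennreal \<Rightarrow> ennreal \<Rightarrow> ennreal" where
  "time_dist s t = (if s = \<top> \<and> t = \<top> then 0 else max s t - min s t)"

definition extend_top :: "(real \<Rightarrow> real) \<Rightarrow> ennreal \<Rightarrow> real" where
  "extend_top \<eta> x = (if x = \<top> then (SUP y\<in>{0..}. \<eta> y) else \<eta> (enn2real x))"

definition stopping_times_after ::
  "'a measure \<Rightarrow> (ennreal \<Rightarrow> 'a measure) \<Rightarrow> ennreal \<Rightarrow> ('a \<Rightarrow> ennreal) set" where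
  "stopping_times_after M F t =
     {\<tau>. stopping_time F \<tau> \<and> (t < \<top> \<longrightarrow> (\<forall>\<omega>\<in>space M. t < \<tau> \<omega>))}"

text \<open>The players are \<open>1, \<dots>, N\<close>. In a strategy \<open>\<rho>\<close>, the value \<open>\<rho> \<alpha> t \<omega>\<close> is the planned stopping
  time once exactly the opponents in \<open>\<alpha>\<close> have stopped, opponent \<open>j\<close> at time \<open>t j\<close>. The tuple \<open>t\<close>
  is a point of the product space over \<open>\<alpha>\<close>, that is, it is undefined outside \<open>\<alpha>\<close>; for empty \<open>\<alpha>\<close>
  the only such point is \<^term>\<open>\<lambda>_. undefined\<close>.\<close>

type_synonym 'a strategy = "nat set \<Rightarrow> (nat \<Rightarrow> ennreal) \<Rightarrow> 'a \<Rightarrow> ennreal"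

definition initial_time :: "'a strategy \<Rightarrow> 'a \<Rightarrow> ennreal" where
  "initial_time \<rho> = \<rho> {} (\<lambda>_. undefined)"

definition strategies ::
  "'a measure \<Rightarrow> (ennreal \<Rightarrow> 'a measure) \<Rightarrow> nat \<Rightarrow> nat \<Rightarrow> 'a strategy set" where
  "strategies M F N i =
     {\<rho>. stopping_time F (initial_time \<rho>) \<and>
         (\<forall>\<alpha>. \<alpha> \<subseteq> {1..N} - {i} \<and> \<alpha> \<noteq> {} \<longrightarrow>
            (\<lambda>(t, \<omega>). \<rho> \<alpha> t \<omega>) \<in> borel_measurable ((\<Pi>\<^sub>M j\<in>\<alpha>. borel) \<Otimes>\<^sub>M M) \<and>
            (\<forall>t\<in>\<alpha> \<rightarrow>\<^sub>E UNIV. \<rho> \<alpha> t \<in> stopping_times_after M F (Max (t ` \<alpha>))))}"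

definition strategies_from ::
  "'a measure \<Rightarrow> (ennreal \<Rightarrow> 'a measure) \<Rightarrow> nat \<Rightarrow> ('a \<Rightarrow> ennreal) \<Rightarrow> nat \<Rightarrow> 'a strategy set" where
  "strategies_from M F N \<sigma> i =
     {\<rho> \<in> strategies M F N i. \<forall>\<omega>\<in>space M. \<sigma> \<omega> \<le> initial_time \<rho> \<omega>}"

text \<open>\<open>run_game N \<rho> \<omega> S r\<close> continues the game in which \<open>S\<close> is the set of players who have already
  stopped, player \<open>j \<in> S\<close> at time \<open>r j\<close>, until everybody has stopped.\<close>

function run_game ::
  "nat \<Rightarrow> (nat \<Rightarrow> 'a strategy) \<Rightarrow> 'a \<Rightarrow> nat set \<Rightarrow> (nat \<Rightarrow> ennreal) \<Rightarrow> (nat \<Rightarrow> ennreal)" where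
  "run_game N \<rho> \<omega> S r =
     (if {1..N} \<subseteq> S then r
      else let c = (\<lambda>i. \<rho> i S (restrict r S) \<omega>);
               m = Min (c ` ({1..N} - S));
               J = {i \<in> {1..N} - S. c i = m}
           in run_game N \<rho> \<omega> (S \<union> J) (\<lambda>j. if j \<in> J then m else r j))"
  by pat_completeness auto
termination
proof (relation "Wellfounded.measure (\<lambda>(N, \<rho>, \<omega>, S, r). card ({1..N} - S))")
  fix N :: nat and \<rho> :: "nat \<Rightarrow> 'a strategy" and \<omega> S r c m J
  assume "\<not> {1..N} \<subseteq> S" and m: "m = Min (c ` ({1..N} - S))"
    and J: "J = {i \<in> {1..N} - S. c i = m}"
  then have "m \<in> c ` ({1..N} - S)"
    unfolding m by (intro Min_in) auto
  then have "{1..N} - (S \<union> J) \<subset> {1..N} - S"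
    using J by auto
  then have "card ({1..N} - (S \<union> J)) < card ({1..N} - S)"
    by (intro psubset_card_mono) auto
  then show "((N, \<rho>, \<omega>, S \<union> J, \<lambda>j. if j \<in> J then m else r j), (N, \<rho>, \<omega>, S, r))
      \<in> Wellfounded.measure (\<lambda>(N, \<rho>, \<omega>, S, r). card ({1..N} - S))"
    by simp
qed simp

declare run_game.simps [simp del]

definition actual_time :: "nat \<Rightarrow> (nat \<Rightarrow> 'a strategy) \<Rightarrow> nat \<Rightarrow> 'a \<Rightarrow> ennreal" where
  "actual_time N \<rho> i \<omega> = run_game N \<rho> \<omega> {} (\<lambda>_. undefined) i"

text \<open>\<^const>\<open>real_cond_exp\<close> is the difference of the conditional expectations of the positive and
  negative parts, hence meaningful here although the payoff at time zero need not be integrable: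
  by the modulus of continuity, the payoff is a bounded perturbation of a random variable that is
  measurable at time zero.\<close>

definition cond_payoff ::
  "'a measure \<Rightarrow> (ennreal \<Rightarrow> 'a measure) \<Rightarrow> nat \<Rightarrow> (nat \<Rightarrow> (nat \<Rightarrow> ennreal) \<Rightarrow> 'a \<Rightarrow> real) \<Rightarrow>
     ('a \<Rightarrow> ennreal) \<Rightarrow> nat \<Rightarrow> (nat \<Rightarrow> 'a strategy) \<Rightarrow> 'a \<Rightarrow> real" where
  "cond_payoff M F N U \<theta> i \<rho> =
     real_cond_exp M (filtration.pre_sigma (space M) F \<theta>)
       (\<lambda>\<omega>. U i (\<lambda>j\<in>{1..N}. actual_time N \<rho> j \<omega>) \<omega>)"

text \<open>Every nonempty event has positive probability, so conditional expectations have a unique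
  version and can be compared at every point.\<close>

definition eps_Nash_equilibrium ::
  "'a measure \<Rightarrow> (ennreal \<Rightarrow> 'a measure) \<Rightarrow> nat \<Rightarrow> (nat \<Rightarrow> (nat \<Rightarrow> ennreal) \<Rightarrow> 'a \<Rightarrow> real) \<Rightarrow>
     ('a \<Rightarrow> ennreal) \<Rightarrow> real \<Rightarrow> (nat \<Rightarrow> 'a strategy) \<Rightarrow> bool" where
  "eps_Nash_equilibrium M F N U \<theta> \<epsilon> \<rho>' \<longleftrightarrow>
     \<rho>' \<in> (\<Pi> i\<in>{1..N}. strategies_from M F N \<theta> i) \<and>
     (\<forall>\<rho> \<in> (\<Pi> i\<in>{1..N}. strategies_from M F N \<theta> i). \<forall>i\<in>{1..N}. \<forall>\<omega>\<in>space M.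
        cond_payoff M F N U \<theta> i (\<rho>'(i := \<rho> i)) \<omega> \<le> cond_payoff M F N U \<theta> i \<rho>' \<omega> + \<epsilon>)"

end

theory Submission
  imports Defs
begin

text \<open>The continuous-time game is replaced by a game of perfect information. Time is cut into turns
  \<open>0, 1, 2, \<dots>\<close>, turn \<open>k\<close> taking place at time \<open>k h\<close> and belonging to a single player, the players
  taking turns cyclically. Having to wait for the next own turn costs at most \<open>\<eta> (N h)\<close>, and in the
  discrete game no two players stop at the same finite time, so that pure strategies can suffice.

  The discrete game is solved by recursion on the number of players who are still active
  (\<open>discrete_equilibrium\<close>). Once the continuations after one more stop have near-equilibria, their
  conditional payoffs form an adapted process \<open>X\<close>, and what is left is a game that ends with the first
  stop and then pays \<open>X\<close> (\<open>stage_equilibrium\<close>). For each player \<open>i\<close> let \<open>v\<close> be the upper value of the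
  zero-sum game of \<open>i\<close> against all others, with the payoff of \<open>i\<close>. Stopping at the first own turn at
  which \<open>X \<ge> v - \<epsilon>\<close> guarantees \<open>v - \<epsilon>\<close> at every earlier turn (\<open>val_guaranteed\<close>). In the equilibrium
  every player uses this rule for the own zero-sum game. A player who stops before the first of these
  times gets \<open>X \<le> v\<close>, which is at most \<open>\<epsilon>\<close> above what waiting would have given. If a player lets the
  own time pass, the others recognize the deviator and switch to a joint plan that attains the
  infimum in \<open>v\<close> up to \<open>\<epsilon>\<close>; since \<open>v \<le> X + \<epsilon>\<close> at that time, this does not help either.

  The horizon is infinite and payoffs jump at infinity, so a guarantee also needs that \<open>v\<close> does
  not exceed the payoff of never stopping in the long run if the rule never applies
  (\<open>val_tail\<close>). Here countability enters: the set of states that cannot be distinguished from \<open>w\<close>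
  decreases to a set of positive probability, and on that set every stopping rule is constant.

  In the original game the equilibrium strategies treat a stop off the grid as if it took place at
  the next turn of the stopper, and until then act as if it had not happened. Hence, whatever a single
  deviator does, the others stop exactly as they do in the discrete game in which the deviator stops
  at the rounded time (\<open>run_game_grid\<close>), and this rounded time is a legitimate discrete plan
  (\<open>rounded_times_plan\<close>). Finally, conditional expectations given \<open>\<F>\<^sub>\<theta>\<close> are averages over atoms; each
  atom splits into the information classes at the first turn after \<open>\<theta>\<close>, and the discrete estimate
  holds in every one of them (\<open>deviation_gain\<close>).\<close>

section \<open>Averages over information classes\<close>

text \<open>Information is modelled by classes instead of sigma-algebras: \<open>cls k w\<close> consists of the states that
  cannot be distinguished from \<open>w\<close> at turn \<open>k\<close>. Level \<open>\<infinity>\<close> is what is learnt in the course of all turns,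
  which may be less than the state itself.\<close>

locale info_tree =
  fixes p :: "'a pmf" and cls :: "enat \<Rightarrow> 'a \<Rightarrow> 'a set"
  assumes cls_self: "w \<in> cls k w"
    and cls_eq: "w' \<in> cls k w \<Longrightarrow> cls k w' = cls k w"
    and cls_mono: "k \<le> l \<Longrightarrow> cls l w \<subseteq> cls k w"
    and cls_infinity: "cls \<infinity> w = (\<Inter>k. cls (enat k) w)"
begin

definition bdd :: "('a \<Rightarrow> real) \<Rightarrow> bool" where
  "bdd f \<longleftrightarrow> (\<exists>B. \<forall>w. \<bar>f w\<bar> \<le> B)"

text \<open>The conditional expectation at level \<open>k\<close>. It is only meaningful on classes of positive probability,
  in particular at the points of the support; on null classes it is zero.\<close>

definition avg :: "enat \<Rightarrow> ('a \<Rightarrow> real) \<Rightarrow> 'a \<Rightarrow> real" where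
  "avg k f w = (\<integral>x. indicator (cls k w) x * f x \<partial>p) / measure p (cls k w)"

text \<open>Stopping times with respect to the classes: for values in the natural numbers this says that the
  event \<open>\<sigma> = k\<close> is known at turn \<open>k\<close>.\<close>

definition stop_rule :: "('a \<Rightarrow> enat) \<Rightarrow> bool" where
  "stop_rule \<sigma> \<longleftrightarrow> (\<forall>w. \<forall>w'\<in>cls (\<sigma> w) w. \<sigma> w' = \<sigma> w)"

lemma bddI: "(\<And>w. \<bar>f w\<bar> \<le> B) \<Longrightarrow> bdd f"
  by (auto simp: bdd_def)

lemma bdd_add [intro]: "bdd f \<Longrightarrow> bdd g \<Longrightarrow> bdd (\<lambda>x. f x + g x)"
proof -
  assume "bdd f" "bdd g"
  then obtain B C where "\<And>w. \<bar>f w\<bar> \<le> B" "\<And>w. \<bar>g w\<bar> \<le> C"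
    by (auto simp: bdd_def)
  then show ?thesis
    by (intro bddI[of _ "B + C"] order_trans[OF abs_triangle_ineq add_mono])
qed

lemma bdd_uminus: "bdd f \<Longrightarrow> bdd (\<lambda>x. - f x)"
  by (auto simp: bdd_def)

lemma bdd_diff [intro]: "bdd f \<Longrightarrow> bdd g \<Longrightarrow> bdd (\<lambda>x. f x - g x)"
  using bdd_add[OF _ bdd_uminus, of f g] by simp

lemma bdd_const [intro, simp]: "bdd (\<lambda>x. c)"
  by (auto simp: bdd_def)

lemma bdd_indicator [intro]: "bdd f \<Longrightarrow> bdd (\<lambda>x. indicator C x * f x)"
  unfolding bdd_def by (auto simp: indicator_def intro: order_trans[OF abs_ge_zero])

lemma bdd_if [intro]: "bdd f \<Longrightarrow> bdd g \<Longrightarrow> bdd (\<lambda>x. if b x then f x else g x)"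
proof -
  assume "bdd f" "bdd g"
  then obtain B C where "\<And>w. \<bar>f w\<bar> \<le> B" "\<And>w. \<bar>g w\<bar> \<le> C"
    by (auto simp: bdd_def)
  then show ?thesis
    by (intro bddI[of _ "max B C"]) (auto intro: max.coboundedI1 max.coboundedI2)
qed

lemma integrable_bdd: "bdd f \<Longrightarrow> integrable (measure_pmf p) f"
proof -
  assume "bdd f"
  then obtain B where "\<And>w. \<bar>f w\<bar> \<le> B" by (auto simp: bdd_def)
  then show ?thesis
    by (intro measure_pmf.integrable_const_bound[of _ B]) auto
qed

lemma cls_sym: "w' \<in> cls k w \<Longrightarrow> w \<in> cls k w'"
  using cls_eq cls_self by blast

lemma prob_cls_pos: "w \<in> set_pmf p \<Longrightarrow> 0 < measure p (cls k w)"
  using cls_self[of w k] by (meson emeasure_pmf measure_pmf_posI)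

lemma stop_ruleD: "stop_rule \<sigma> \<Longrightarrow> w' \<in> cls k w \<Longrightarrow> \<sigma> w \<le> k \<Longrightarrow> \<sigma> w' = \<sigma> w"
  unfolding stop_rule_def using cls_mono by blast

lemma stop_rule_le_iff: "stop_rule \<sigma> \<Longrightarrow> w' \<in> cls k w \<Longrightarrow> \<sigma> w' \<le> k \<longleftrightarrow> \<sigma> w \<le> k"
  using stop_ruleD cls_sym by metis

lemma stop_rule_less_iff: "stop_rule \<sigma> \<Longrightarrow> w' \<in> cls k w \<Longrightarrow> \<sigma> w' < k \<longleftrightarrow> \<sigma> w < k"
  using stop_ruleD cls_sym by (metis less_imp_le)

lemma stop_rule_const: "stop_rule (\<lambda>_. k)"
  by (simp add: stop_rule_def)

lemma stop_rule_min: "stop_rule \<sigma> \<Longrightarrow> stop_rule \<tau> \<Longrightarrow> stop_rule (\<lambda>w. min (\<sigma> w) (\<tau> w))"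
  unfolding stop_rule_def[of "\<lambda>w. min (\<sigma> w) (\<tau> w)"]
proof (intro allI ballI)
  fix w w' assume s: "stop_rule \<sigma>" "stop_rule \<tau>" and c: "w' \<in> cls (min (\<sigma> w) (\<tau> w)) w"
  show "min (\<sigma> w') (\<tau> w') = min (\<sigma> w) (\<tau> w)"
    using stop_ruleD[OF s(1) c] stop_ruleD[OF s(2) c] stop_rule_less_iff[OF s(1) c] stop_rule_less_iff[OF s(2) c]
    by (auto simp: min_def not_le split: if_splits)
qed

text \<open>Only countably many cells meet the support, and the integral over \<open>C\<close> is the sum of the integrals over
  them.\<close>

lemma integral_cells_nonneg:
  assumes f: "bdd f"
    and Q: "\<And>w. w \<in> Q w" "\<And>w w'. w' \<in> Q w \<Longrightarrow> Q w' = Q w" "\<And>w. w \<in> C \<Longrightarrow> Q w \<subseteq> C"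
    and nn: "\<And>w. w \<in> set_pmf p \<Longrightarrow> w \<in> C \<Longrightarrow> 0 \<le> (\<integral>x. indicator (Q w) x * f x \<partial>p)"
  shows "0 \<le> (\<integral>x. indicator C x * f x \<partial>p)"
proof -
  define S where "S = C \<inter> set_pmf p"
  define e where "e = to_nat_on (Q ` S)"
  define A where "A n = {w\<in>S. e (Q w) = n}" for n
  have "countable (Q ` S)"
    by (auto simp: S_def)
  then have inj: "inj_on e (Q ` S)"
    unfolding e_def by (rule inj_on_to_nat_on)
  have AE: "AE x in measure_pmf p. indicator D x * f x = indicator (D \<inter> set_pmf p) x * f x" for D
    by (auto simp: AE_measure_pmf_iff indicator_def)
  have nonneg: "0 \<le> (\<integral>x. indicator (A n) x * f x \<partial>p)" for n
  proof (cases "A n = {}")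
    case False
    then obtain w where w: "w \<in> S" "e (Q w) = n" by (auto simp: A_def)
    have "A n = Q w \<inter> set_pmf p"
    proof (intro set_eqI iffI)
      fix x assume "x \<in> A n"
      then have "Q x = Q w" "x \<in> set_pmf p"
        using w inj by (auto simp: A_def S_def inj_on_def)
      then show "x \<in> Q w \<inter> set_pmf p" using Q(1)[of x] by simp
    next
      fix x assume "x \<in> Q w \<inter> set_pmf p"
      then show "x \<in> A n"
        using w Q(2)[of x w] Q(3)[of w] by (auto simp: A_def S_def)
    qed
    moreover have "0 \<le> (\<integral>x. indicator (Q w) x * f x \<partial>p)"
      using nn w by (auto simp: S_def)
    ultimately show ?thesis
      using integral_cong_AE[OF _ _ AE[of "Q w"]] by simp
  qed simp
  have sums: "(\<lambda>n. \<integral>x. indicator (A n) x * f x \<partial>p) sums (\<integral>x. (\<Sum>n. indicator (A n) x * f x) \<partial>p)"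
  proof (rule sums_integral)
    show "integrable (measure_pmf p) (\<lambda>x. indicator (A n) x * f x)" for n
      using f by (intro integrable_bdd) auto
    have ind: "indicator (A n) x = (if x \<in> S \<and> n = e (Q x) then 1 else 0 :: real)" for n x
      by (auto simp: A_def)
    have fin: "summable (\<lambda>n. norm (indicator (A n) x * f x))" for x
      by (rule summable_finite[of "{e (Q x)}"]) (auto simp: ind)
    then show "AE x in measure_pmf p. summable (\<lambda>n. norm (indicator (A n) x * f x))"
      by simp
    obtain B where B: "\<And>w. \<bar>f w\<bar> \<le> B" using f by (auto simp: bdd_def)
    have *: "(\<integral>x. norm (indicator (A n) x * f x) \<partial>p) \<le> B * measure p (A n)" for n
    proof -
      have "(\<integral>x. norm (indicator (A n) x * f x) \<partial>p) \<le> (\<integral>x. indicator (A n) x * B \<partial>p)"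
        using B f by (intro integral_mono integrable_norm integrable_bdd bdd_indicator bdd_const)
          (auto simp: indicator_def)
      then show ?thesis by (simp add: mult.commute)
    qed
    have "summable (\<lambda>n. measure p (A n))"
      by (rule sums_summable[OF measure_pmf.finite_measure_UNION])
        (auto simp: disjoint_family_on_def A_def)
    then have "summable (\<lambda>n. B * measure p (A n))"
      by (rule summable_mult)
    then show "summable (\<lambda>n. \<integral>x. norm (indicator (A n) x * f x) \<partial>p)"
    proof (rule summable_comparison_test')
      show "norm (\<integral>x. norm (indicator (A n) x * f x) \<partial>p) \<le> B * measure p (A n)" for n
        using *[of n] by (subst real_norm_def, subst abs_of_nonneg) simp_all
    qed
  qed
  have "(\<Sum>n. indicator (A n) x * f x) = indicator S x * f x" for x
    by (subst suminf_finite[of "{e (Q x)}"]) (auto simp: A_def indicator_def)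
  then have "0 \<le> (\<integral>x. indicator S x * f x \<partial>p)"
    using sums_le[OF nonneg sums_zero sums] by simp
  then show ?thesis
    using integral_cong_AE[OF _ _ AE[of C]] by (simp add: S_def)
qed

lemma avg_le_iff:
  assumes "bdd f" "bdd g" "w \<in> set_pmf p"
  shows "avg k f w \<le> avg k g w + c \<longleftrightarrow> 0 \<le> (\<integral>x. indicator (cls k w) x * (g x + c - f x) \<partial>p)"
proof -
  let ?i = "indicator (cls k w) :: 'a \<Rightarrow> real"
  have "(\<integral>x. ?i x * (g x + c - f x) \<partial>p) = (\<integral>x. ?i x * g x + ?i x * c - ?i x * f x \<partial>p)"
    by (simp only: distrib_left right_diff_distrib)
  also have "\<dots> = (\<integral>x. ?i x * g x \<partial>p) + measure p (cls k w) * c - (\<integral>x. ?i x * f x \<partial>p)"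
    using assms by (subst Bochner_Integration.integral_diff Bochner_Integration.integral_add;
        (intro integrable_bdd bdd_add bdd_indicator bdd_const)?; simp)+
  finally have eq: "(\<integral>x. ?i x * (g x + c - f x) \<partial>p) =
      (\<integral>x. ?i x * g x \<partial>p) + measure p (cls k w) * c - (\<integral>x. ?i x * f x \<partial>p)" .
  have "a / m \<le> b / m + c \<longleftrightarrow> 0 \<le> b + m * c - a" if "0 < m" for a b m :: real
    using that by (simp add: field_simps)
  from this[OF prob_cls_pos[OF assms(3), of k]] show ?thesis
    unfolding avg_def eq .
qed

text \<open>The tower property at a stopping time: the cells \<open>cls (\<kappa> w) w\<close> partition every class of an earlier level,
  so an inequality between averages over them carries over to that level.\<close>

lemma avg_le_by_cells:
  assumes "bdd f" "bdd g" "stop_rule \<kappa>" "w \<in> set_pmf p"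
    and ge: "\<And>w'. w' \<in> cls k w \<Longrightarrow> k \<le> \<kappa> w'"
    and le: "\<And>w'. w' \<in> set_pmf p \<Longrightarrow> w' \<in> cls k w \<Longrightarrow>
      avg (\<kappa> w') f w' \<le> avg (\<kappa> w') g w' + c"
  shows "avg k f w \<le> avg k g w + c"
  unfolding avg_le_iff[OF assms(1,2,4)]
proof (rule integral_cells_nonneg[where Q = "\<lambda>w. cls (\<kappa> w) w"])
  show "bdd (\<lambda>x. g x + c - f x)" by (intro bdd_diff bdd_add bdd_const assms)
  show "\<And>w. w \<in> cls (\<kappa> w) w" by (rule cls_self)
  show "\<And>w w'. w' \<in> cls (\<kappa> w) w \<Longrightarrow> cls (\<kappa> w') w' = cls (\<kappa> w) w"
    using \<open>stop_rule \<kappa>\<close> cls_eq by (metis stop_rule_def)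
  show "\<And>w'. w' \<in> cls k w \<Longrightarrow> cls (\<kappa> w') w' \<subseteq> cls k w"
    using ge cls_mono cls_eq by metis
  show "0 \<le> (\<integral>x. indicator (cls (\<kappa> w') w') x * (g x + c - f x) \<partial>p)"
    if "w' \<in> set_pmf p" "w' \<in> cls k w" for w'
    using le[OF that] avg_le_iff[OF assms(1,2) that(1)] by blast
qed

lemma avg_cong: "(\<And>w'. w' \<in> cls k w \<Longrightarrow> f w' = g w') \<Longrightarrow> avg k f w = avg k g w"
  unfolding avg_def by (intro arg_cong2[where f = "(/)"] Bochner_Integration.integral_cong)
    (auto simp: indicator_def)

lemma avg_adapted: "w' \<in> cls k w \<Longrightarrow> avg k f w' = avg k f w"
  unfolding avg_def using cls_eq by simp

lemma avg_const: "w \<in> set_pmf p \<Longrightarrow> avg k (\<lambda>_. c) w = c"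
  unfolding avg_def using prob_cls_pos[of w k] by simp

lemma avg_const_on:
  "w \<in> set_pmf p \<Longrightarrow> (\<And>w'. w' \<in> cls k w \<Longrightarrow> f w' = c) \<Longrightarrow> avg k f w = c"
  using avg_cong[of k w f "\<lambda>_. c"] avg_const by simp

lemma avg_mono:
  assumes "bdd f" "bdd g" "w \<in> set_pmf p"
    and "\<And>w'. w' \<in> set_pmf p \<Longrightarrow> w' \<in> cls k w \<Longrightarrow> f w' \<le> g w' + c"
  shows "avg k f w \<le> avg k g w + c"
  unfolding avg_le_iff[OF assms(1-3)]
  by (rule integral_nonneg_AE) (use assms(4) in \<open>auto simp: AE_measure_pmf_iff indicator_def algebra_simps\<close>)

lemma avg_bound:
  assumes "\<And>w. \<bar>f w\<bar> \<le> B"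
  shows "\<bar>avg k f w\<bar> \<le> B"
proof -
  have B: "0 \<le> B" using assms[of w] by simp
  have "\<bar>\<integral>x. indicator (cls k w) x * f x \<partial>p\<bar> \<le> (\<integral>x. \<bar>indicator (cls k w) x * f x\<bar> \<partial>p)"
    by (rule integral_abs_bound)
  also have "\<dots> \<le> (\<integral>x. indicator (cls k w) x * B \<partial>p)"
    using assms B by (intro integral_mono integrable_bdd bdd_indicator bdd_const)
      (auto simp: indicator_def intro!: bddI[of _ B])
  finally have "\<bar>\<integral>x. indicator (cls k w) x * f x \<partial>p\<bar> \<le> measure p (cls k w) * B"
    by simp
  then show ?thesis
    using B unfolding avg_def by (cases "measure p (cls k w) = 0")
      (auto simp: divide_le_eq abs_div mult.commute zero_less_measure_iff)
qed

end

section \<open>Zero-sum stopping with alternating turns\<close>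

context info_tree
begin

lemma avg_add:
  assumes "bdd f" "bdd g"
  shows "avg k (\<lambda>x. f x + g x) w = avg k f w + avg k g w"
  using assms unfolding avg_def distrib_left add_divide_distrib[symmetric]
  by (subst Bochner_Integration.integral_add) (auto intro!: integrable_bdd)

lemma avg_tendsto_0:
  assumes "\<And>m w. \<bar>h m w\<bar> \<le> B" "\<And>w. w \<in> set_pmf p \<Longrightarrow> (\<lambda>m. h m w) \<longlonglongrightarrow> 0"
  shows "(\<lambda>m. avg k (h m) w) \<longlonglongrightarrow> 0"
proof -
  have "(\<lambda>m. \<integral>x. indicator (cls k w) x * h m x \<partial>p) \<longlonglongrightarrow> (\<integral>x. 0 \<partial>p)"
  proof (rule integral_dominated_convergence[where w = "\<lambda>_. \<bar>B\<bar>"])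
    show "AE x in measure_pmf p. (\<lambda>m. indicator (cls k w) x * h m x) \<longlonglongrightarrow> 0"
      unfolding AE_measure_pmf_iff using assms(2) by (auto intro: tendsto_mult_right_zero)
    show "AE x in measure_pmf p. norm (indicator (cls k w) x * h m x) \<le> \<bar>B\<bar>" for m
      using assms(1)[of m] by (intro AE_I2) (auto simp: indicator_def intro: order_trans[OF _ abs_ge_self])
  qed auto
  then have "(\<lambda>m. avg k (h m) w) \<longlonglongrightarrow> (\<integral>x. 0 \<partial>p) / measure p (cls k w)"
    unfolding avg_def divide_inverse by (rule tendsto_mult_right)
  then show ?thesis by simp
qed

definition plans :: "nat set \<Rightarrow> nat \<Rightarrow> ('a \<Rightarrow> enat) set" where
  "plans T n = {\<sigma>. stop_rule \<sigma> \<and> (\<forall>w. \<sigma> w = \<infinity> \<or> (\<exists>k\<in>T. n \<le> k \<and> \<sigma> w = enat k))}"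

lemma plansD: "\<sigma> \<in> plans T n \<Longrightarrow> stop_rule \<sigma>" "\<sigma> \<in> plans T n \<Longrightarrow> enat n \<le> \<sigma> w"
  "\<sigma> \<in> plans T n \<Longrightarrow> \<sigma> w = enat k \<Longrightarrow> k \<in> T"
  unfolding plans_def
  by (auto, metis enat_ord_simps(1) enat_ord_code(3), metis enat.distinct(2) enat.inject)

lemma plans_infinity: "(\<lambda>_. \<infinity>) \<in> plans T n"
  by (auto simp: plans_def stop_rule_const)

lemma plans_const: "k \<in> T \<Longrightarrow> n \<le> k \<Longrightarrow> (\<lambda>_. enat k) \<in> plans T n"
  by (auto simp: plans_def stop_rule_const)

lemma plans_antimono: "m \<le> n \<Longrightarrow> plans T n \<subseteq> plans T m"
  unfolding plans_def by fastforce

lemma plans_from: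
  assumes "\<tau> \<in> plans T n"
  shows "(\<lambda>w. if \<tau> w < enat m then \<infinity> else \<tau> w) \<in> plans T m"
proof -
  have "\<exists>k\<in>T. m \<le> k \<and> \<tau> w = enat k" if "\<not> \<tau> w < enat m" "\<tau> w \<noteq> \<infinity>" for w
  proof -
    have "\<tau> w = \<infinity> \<or> (\<exists>k\<in>T. n \<le> k \<and> \<tau> w = enat k)"
      using assms by (simp add: plans_def)
    then show ?thesis using that by auto
  qed
  moreover have "stop_rule (\<lambda>w. if \<tau> w < enat m then \<infinity> else \<tau> w)"
    unfolding stop_rule_def[of "\<lambda>w. if \<tau> w < enat m then \<infinity> else \<tau> w"]
  proof (intro allI ballI)
    fix w w' assume "w' \<in> cls (if \<tau> w < enat m then \<infinity> else \<tau> w) w"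
    then have "\<tau> w' = \<tau> w"
      by (rule stop_ruleD[OF plansD(1)[OF assms]]) simp
    then show "(if \<tau> w' < enat m then \<infinity> else \<tau> w') = (if \<tau> w < enat m then \<infinity> else \<tau> w)"
      by simp
  qed
  ultimately show ?thesis
    unfolding plans_def by (auto simp del: not_infinity_eq)
qed

end

text \<open>Two sides may stop the game, the maximizer at the turns in \<open>K\<close> and the minimizer at the turns in \<open>L\<close>; a
  stop at turn \<open>k\<close> pays \<open>x k\<close> to the maximizer, and \<open>x \<infinity>\<close> is paid if nobody stops.\<close>

locale zero_sum = info_tree p cls for p :: "'a pmf" and cls +
  fixes x :: "enat \<Rightarrow> 'a \<Rightarrow> real" and K :: "nat set" and L :: "nat set" and B :: real
  assumes x_adapted: "w' \<in> cls k w \<Longrightarrow> x k w' = x k w"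
    and x_bound: "\<bar>x k w\<bar> \<le> B"
    and turns_disjoint: "K \<inter> L = {}"
begin

definition pay :: "('a \<Rightarrow> enat) \<Rightarrow> ('a \<Rightarrow> enat) \<Rightarrow> 'a \<Rightarrow> real" where
  "pay \<tau> \<sigma> = (\<lambda>w. x (min (\<tau> w) (\<sigma> w)) w)"

text \<open>The Snell envelope: the best reply of the maximizer to a fixed plan of the minimizer.\<close>

definition snell :: "nat \<Rightarrow> ('a \<Rightarrow> enat) \<Rightarrow> 'a \<Rightarrow> real" where
  "snell n \<sigma> w = (SUP \<tau>\<in>plans K n. avg n (pay \<tau> \<sigma>) w)"

text \<open>The upper value. With this order of quantifiers, good plans of the minimizer exist by definition, so only
  the maximizer has to be provided with a strategy; that the lower value is the same is a consequence of
  \<open>val_guaranteed\<close>.\<close>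

definition val :: "nat \<Rightarrow> 'a \<Rightarrow> real" where
  "val n w = (INF \<sigma>\<in>plans L n. snell n \<sigma> w)"

lemma pay_bound: "\<bar>pay \<tau> \<sigma> w\<bar> \<le> B"
  by (simp add: pay_def x_bound)

lemma bdd_pay [intro, simp]: "bdd (pay \<tau> \<sigma>)"
  using pay_bound by (rule bddI)

lemma avg_le_snell: "\<tau> \<in> plans K n \<Longrightarrow> avg n (pay \<tau> \<sigma>) w \<le> snell n \<sigma> w"
  unfolding snell_def using avg_bound[OF pay_bound]
  by (intro cSUP_upper bdd_aboveI[of _ B]) (auto simp: abs_le_iff)

lemma snell_least: "(\<And>\<tau>. \<tau> \<in> plans K n \<Longrightarrow> avg n (pay \<tau> \<sigma>) w \<le> c) \<Longrightarrow> snell n \<sigma> w \<le> c"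
  unfolding snell_def using plans_infinity by (intro cSUP_least) auto

lemma snell_bound: "\<bar>snell n \<sigma> w\<bar> \<le> B"
proof -
  have "\<bar>avg n (pay \<tau> \<sigma>) w\<bar> \<le> B" for \<tau>
    by (rule avg_bound) (rule pay_bound)
  then show ?thesis
    using snell_least[of n \<sigma> w B] avg_le_snell[OF plans_infinity, of n \<sigma> w]
    by (smt (verit, best))
qed

lemma val_le: "\<sigma> \<in> plans L n \<Longrightarrow> val n w \<le> snell n \<sigma> w"
  unfolding val_def using snell_bound
  by (intro cINF_lower bdd_belowI[of _ "- B"]) (auto simp: abs_le_iff minus_le_iff)

lemma val_greatest: "(\<And>\<sigma>. \<sigma> \<in> plans L n \<Longrightarrow> c \<le> snell n \<sigma> w) \<Longrightarrow> c \<le> val n w"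
  unfolding val_def using plans_infinity by (intro cINF_greatest) auto

lemma val_bound: "\<bar>val n w\<bar> \<le> B"
  using val_greatest[of n "-B" w] val_le[OF plans_infinity, of n w] snell_bound[of n _ w]
  by (smt (verit, best))

lemma bdd_val [intro, simp]: "bdd (val n)"
  using val_bound by (rule bddI)

lemma snell_adapted: "w' \<in> cls (enat n) w \<Longrightarrow> snell n \<sigma> w' = snell n \<sigma> w"
  unfolding snell_def by (simp add: avg_adapted)

lemma val_adapted: "w' \<in> cls (enat n) w \<Longrightarrow> val n w' = val n w"
  unfolding val_def by (simp add: snell_adapted)

lemma snell_cong:
  assumes "\<And>w'. w' \<in> cls (enat n) w \<Longrightarrow> \<sigma> w' = \<sigma>' w'"
  shows "snell n \<sigma> w = snell n \<sigma>' w"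
proof -
  have "avg n (pay \<tau> \<sigma>) w = avg n (pay \<tau> \<sigma>') w" for \<tau>
    using assms by (intro avg_cong) (simp add: pay_def)
  then show ?thesis
    unfolding snell_def by simp
qed

text \<open>Near-optimal plans may depend on the class of \<open>w\<close>. Pasting one plan per class keeps a stopping time,
  because plans in \<open>plans L n\<close> do not stop before the class at level \<open>n\<close> is known.\<close>

lemma val_attained:
  assumes "0 < \<delta>"
  obtains \<sigma> where "\<sigma> \<in> plans L n" "\<And>w. snell n \<sigma> w \<le> val n w + \<delta>"
proof -
  have "\<exists>\<sigma>. \<sigma> \<in> plans L n \<and> snell n \<sigma> w \<le> val n w + \<delta>" for w
    using val_greatest[of n "val n w + \<delta>" w] assms by (meson less_add_same_cancel1 linorder_not_less nle_le)
  then obtain f where f: "\<And>w. f w \<in> plans L n" "\<And>w. snell n (f w) w \<le> val n w + \<delta>"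
    by metis
  define c where "c w = (SOME w'. w' \<in> cls (enat n) w)" for w
  have c: "c w \<in> cls (enat n) w" for w
    unfolding c_def using cls_self by (rule someI)
  have c_eq: "c w' = c w" if "w' \<in> cls (enat n) w" for w w'
    unfolding c_def using cls_eq[OF that] by simp
  define \<sigma> where "\<sigma> w = f (c w) w" for w
  show ?thesis
  proof
    show "snell n \<sigma> w \<le> val n w + \<delta>" for w
    proof -
      have "snell n \<sigma> w = snell n (f (c w)) w"
        by (intro snell_cong) (simp add: \<sigma>_def c_eq)
      also have "\<dots> = snell n (f (c w)) (c w)"
        using snell_adapted[OF c] by simp
      also have "\<dots> \<le> val n (c w) + \<delta>"
        by (rule f)
      finally show ?thesis
        using val_adapted[OF c] by simp
    qed
    have "\<sigma> w' = \<sigma> w" if "w' \<in> cls (\<sigma> w) w" for w w'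
    proof -
      have "w' \<in> cls (enat n) w"
        using that cls_mono[of "enat n" "\<sigma> w" w] plansD(2)[OF f(1)] by (auto simp: \<sigma>_def)
      then show ?thesis
        using that plansD(1)[OF f(1), of "c w"] c_eq by (auto simp: \<sigma>_def stop_rule_def)
    qed
    then show "\<sigma> \<in> plans L n"
      using f(1) unfolding plans_def by (auto simp: stop_rule_def \<sigma>_def)
  qed
qed

lemma x_le_val:
  assumes "k \<in> K" "w \<in> set_pmf p"
  shows "x k w \<le> val k w"
proof (rule val_greatest)
  fix \<sigma> assume \<sigma>: "\<sigma> \<in> plans L k"
  have "avg k (pay (\<lambda>_. k) \<sigma>) w = x k w"
    using plansD(2)[OF \<sigma>] assms(2) by (intro avg_const_on) (auto simp: pay_def min_def x_adapted)
  then show "x k w \<le> snell k \<sigma> w"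
    using avg_le_snell[OF plans_const[OF \<open>k \<in> K\<close> order_refl], of \<sigma> w] by simp
qed

lemma val_le_x:
  assumes "k \<in> L" "w \<in> set_pmf p"
  shows "val k w \<le> x k w"
proof -
  have "snell k (\<lambda>_. k) w \<le> x k w"
  proof (rule snell_least)
    fix \<tau> assume \<tau>: "\<tau> \<in> plans K k"
    have "avg k (pay \<tau> (\<lambda>_. k)) w = x k w"
      using plansD(2)[OF \<tau>] assms(2) by (intro avg_const_on)
        (auto simp: pay_def min_def x_adapted dest: antisym)
    then show "avg k (pay \<tau> (\<lambda>_. k)) w \<le> x k w" by simp
  qed
  then show ?thesis
    using val_le[OF plans_const[OF \<open>k \<in> L\<close> order_refl], of w] by simp
qed

text \<open>The half of the dynamic programming equation that the maximizer needs: against a near-optimal plan of the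
  minimizer from the next turn on, every plan of the maximizer either stops at turn \<open>k\<close> on the whole class
  or is a plan for the next turn.\<close>

lemma val_le_step:
  assumes "w \<in> set_pmf p"
  shows "val k w \<le> avg k (val (Suc k)) w \<or> k \<in> K \<and> val k w \<le> x k w"
proof -
  define c where "c = (if k \<in> K then max (x k w) (avg k (val (Suc k)) w) else avg k (val (Suc k)) w)"
  have "val k w \<le> c"
  proof (rule field_le_epsilon)
    fix \<delta> :: real assume "0 < \<delta>"
    then obtain \<sigma> where \<sigma>: "\<sigma> \<in> plans L (Suc k)"
      and le: "\<And>w. snell (Suc k) \<sigma> w \<le> val (Suc k) w + \<delta>"
      by (rule val_attained) blast
    have "val k w \<le> snell k \<sigma> w"
      using \<sigma> plans_antimono[of k "Suc k" L] by (intro val_le) auto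
    also have "\<dots> \<le> c + \<delta>"
    proof (rule snell_least)
      fix \<tau> assume \<tau>: "\<tau> \<in> plans K k"
      show "avg k (pay \<tau> \<sigma>) w \<le> c + \<delta>"
      proof (cases "\<tau> w = enat k")
        case True
        have "pay \<tau> \<sigma> w' = x k w" if "w' \<in> cls (enat k) w" for w'
        proof -
          have "\<tau> w' = enat k" using stop_ruleD[OF plansD(1)[OF \<tau>] that] True by simp
          moreover have "enat k \<le> \<sigma> w'"
            using plansD(2)[OF \<sigma>, of w'] by (metis enat_ord_simps(1) le_SucI le_refl order_trans)
          ultimately show ?thesis using x_adapted[OF that] by (simp add: pay_def)
        qed
        then have "avg k (pay \<tau> \<sigma>) w = x k w"
          using assms by (intro avg_const_on)
        moreover have "k \<in> K" using plansD(3)[OF \<tau> True] .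
        ultimately show ?thesis using \<open>0 < \<delta>\<close> by (auto simp: c_def)
      next
        case False
        define \<tau>' where "\<tau>' = (\<lambda>w. if \<tau> w < enat (Suc k) then \<infinity> else \<tau> w)"
        have \<tau>': "\<tau>' \<in> plans K (Suc k)"
          unfolding \<tau>'_def by (rule plans_from[OF \<tau>])
        have "\<tau>' w' = \<tau> w'" if "w' \<in> cls (enat k) w" for w'
        proof -
          have "\<not> \<tau> w \<le> enat k" using plansD(2)[OF \<tau>, of w] False by auto
          then have "\<not> \<tau> w' \<le> enat k" using stop_rule_le_iff[OF plansD(1)[OF \<tau>] that] by simp
          then show ?thesis by (cases "\<tau> w'") (auto simp: \<tau>'_def)
        qed
        then have "avg k (pay \<tau> \<sigma>) w = avg k (pay \<tau>' \<sigma>) w"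
          by (intro avg_cong) (simp add: pay_def)
        also have "\<dots> \<le> avg k (val (Suc k)) w + \<delta>"
        proof (rule avg_le_by_cells[OF _ _ stop_rule_const assms])
          fix w' assume w': "w' \<in> set_pmf p"
          have "avg (Suc k) (pay \<tau>' \<sigma>) w' \<le> val (Suc k) w' + \<delta>"
            using avg_le_snell[OF \<tau>'] le order_trans by blast
          also have "val (Suc k) w' = avg (Suc k) (val (Suc k)) w'"
            using w' by (intro avg_const_on[symmetric] val_adapted)
          finally show "avg (Suc k) (pay \<tau>' \<sigma>) w' \<le> avg (Suc k) (val (Suc k)) w' + \<delta>" .
        qed auto
        finally show ?thesis by (auto simp: c_def)
      qed
    qed
    finally show "val k w \<le> c + \<delta>" .
  qed
  then show ?thesis
    by (auto simp: c_def max_def split: if_splits)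
qed

text \<open>If the minimizer never stops, a plan of the maximizer is constant on \<open>cls \<infinity> w\<close> and earns at most \<open>c\<close> there.
  The rest of \<open>cls m w\<close>, on which nothing is known, has relative weight tending to zero.\<close>

lemma val_tail_bound:
  assumes w: "w \<in> set_pmf p" and c: "x \<infinity> w \<le> c" "\<And>k. m \<le> k \<Longrightarrow> k \<in> K \<Longrightarrow> x k w \<le> c"
  shows "val m w \<le> c + 2 * B * (1 - measure p (cls \<infinity> w) / measure p (cls m w))"
proof -
  define P where "P = measure p (cls m w)"
  define P' where "P' = measure p (cls \<infinity> w)"
  have P: "0 < P" unfolding P_def using prob_cls_pos[OF w] .
  have sub: "cls \<infinity> w \<subseteq> cls m w"
    by (rule cls_mono) simp
  then have PP: "P' \<le> P"
    unfolding P_def P'_def by (intro measure_pmf.finite_measure_mono) auto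
  have "- B \<le> c" "0 \<le> B"
    using c(1) x_bound[of \<infinity> w] by auto
  have "snell m (\<lambda>_. \<infinity>) w \<le> c + 2 * B * (1 - P' / P)"
  proof (rule snell_least)
    fix \<tau> assume \<tau>: "\<tau> \<in> plans K m"
    let ?f = "pay \<tau> (\<lambda>_. \<infinity>)" and ?i = "indicator (cls \<infinity> w) :: 'a \<Rightarrow> real"
    have f: "?f w' \<le> c" if "w' \<in> cls \<infinity> w" for w'
    proof -
      have "\<tau> w' = \<tau> w" by (rule stop_ruleD[OF plansD(1)[OF \<tau>] that]) simp
      moreover have "w' \<in> cls (\<tau> w) w" using that cls_mono[of "\<tau> w" \<infinity> w] by auto
      ultimately have "?f w' = x (\<tau> w) w" using x_adapted by (simp add: pay_def)
      also have "\<dots> \<le> c"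
        using c plansD(2,3)[OF \<tau>, of w] by (cases "\<tau> w") auto
      finally show ?thesis .
    qed
    have "(\<integral>y. indicator (cls m w) y * ?f y \<partial>p)
        \<le> (\<integral>y. ?i y * (c - B) + indicator (cls m w) y * B \<partial>p)"
      using f sub pay_bound[of \<tau> "\<lambda>_. \<infinity>"]
      by (intro integral_mono integrable_bdd bdd_add bdd_indicator bdd_const bdd_pay)
        (auto simp: indicator_def abs_le_iff)
    also have "\<dots> = P' * (c - B) + P * B"
      unfolding P_def P'_def
      by (subst Bochner_Integration.integral_add)
        (auto intro!: integrable_bdd bdd_indicator intro: bddI[of _ 1])
    finally have "avg m ?f w \<le> (P' * (c - B) + P * B) / P"
      unfolding avg_def P_def[symmetric] using P by (simp add: divide_right_mono)
    also have "\<dots> = c + (B - c) * (1 - P' / P)"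
      using P by (simp add: field_simps)
    also have "\<dots> \<le> c + 2 * B * (1 - P' / P)"
      using P PP \<open>- B \<le> c\<close> by (intro add_left_mono mult_right_mono) auto
    finally show "avg m ?f w \<le> c + 2 * B * (1 - P' / P)" .
  qed
  then show ?thesis
    using val_le[OF plans_infinity, of m w] unfolding P_def P'_def by linarith
qed

text \<open>Let \<open>V\<close> be the supremum of the values from some late turn on. Stopping pays at most \<open>V - \<epsilon>\<close> from then on, so
  the preceding bound gives \<open>V \<le> max (V - \<epsilon>) (x \<infinity> w)\<close> up to a small error, and the first alternative in the maximum
  is impossible once the error is below \<open>\<epsilon>\<close>.\<close>

lemma val_tail:
  assumes w: "w \<in> set_pmf p" and "0 < \<epsilon>" "0 < \<delta>"
    and own: "\<And>k. n \<le> k \<Longrightarrow> k \<in> K \<Longrightarrow> x k w \<le> val k w - \<epsilon>"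
  shows "eventually (\<lambda>m. val m w \<le> x \<infinity> w + \<delta>) sequentially"
proof -
  define \<gamma> where "\<gamma> m = 2 * B * (1 - measure p (cls \<infinity> w) / measure p (cls (enat m) w))" for m
  \<comment> \<open>Below \<open>\<epsilon>\<close>, to exclude the first alternative in the maximum, and at most the admitted error \<open>\<delta>\<close>.\<close>
  define d where "d = min \<delta> (\<epsilon> / 2)"
  have d: "0 < d" "d \<le> \<delta>" "d < \<epsilon>" using assms by (auto simp: d_def)
  have pos: "measure p (cls \<infinity> w) \<noteq> 0"
    using prob_cls_pos[OF w, of \<infinity>] by simp
  have "(\<lambda>m. measure p (cls (enat m) w)) \<longlonglongrightarrow> measure p (\<Inter>m. cls (enat m) w)"
    by (rule measure_pmf.finite_Lim_measure_decseq) (auto simp: decseq_def intro!: cls_mono)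
  then have "\<gamma> \<longlonglongrightarrow> 2 * B * (1 - measure p (cls \<infinity> w) / measure p (cls \<infinity> w))"
    unfolding \<gamma>_def cls_infinity[symmetric] by (intro tendsto_intros pos)
  then have "\<gamma> \<longlonglongrightarrow> 0" using pos by simp
  then have "eventually (\<lambda>m. \<gamma> m < d) sequentially"
    using d(1) by (rule order_tendstoD(2))
  then obtain m0 where m0: "\<And>m. m0 \<le> m \<Longrightarrow> \<gamma> m < d"
    by (auto simp: eventually_sequentially)
  have "val m w \<le> x \<infinity> w + \<delta>" if "max n m0 \<le> m" for m
  proof -
    define V where "V = (SUP k\<in>{m..}. val k w)"
    have V: "val k w \<le> V" if "m \<le> k" for k
      unfolding V_def using val_bound that
      by (intro cSUP_upper bdd_aboveI[of _ B]) (auto simp: abs_le_iff)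
    have "V \<le> max (V - \<epsilon>) (x \<infinity> w) + d"
      unfolding V_def
    proof (rule cSUP_least)
      fix k assume "k \<in> {m..}"
      then have k: "m \<le> k" by simp
      have "val k w \<le> max (V - \<epsilon>) (x \<infinity> w) + \<gamma> k"
        unfolding \<gamma>_def
      proof (rule val_tail_bound[OF w])
        show "x (enat j) w \<le> max (V - \<epsilon>) (x \<infinity> w)" if "k \<le> j" "j \<in> K" for j
          using own[of j] V[of j] k that \<open>max n m0 \<le> m\<close> by simp
      qed simp
      then show "val k w \<le> max ((SUP k\<in>{m..}. val k w) - \<epsilon>) (x \<infinity> w) + d"
        using m0[of k] k that by (simp add: V_def)
    qed simp
    then have "V \<le> x \<infinity> w + d" using d by (auto simp: max_def split: if_splits)
    then show ?thesis using V[of m] d by simp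
  qed
  then show ?thesis
    unfolding eventually_sequentially by blast
qed

text \<open>Before the maximizer's rule \<open>\<tau>\<close> applies, the value is a submartingale by \<open>val_le_step\<close>; when \<open>\<tau>\<close> stops, the payoff
  is within \<open>\<epsilon>\<close> of the value, and when the minimizer stops, the payoff is at least the value. The paths on which
  nobody stops are controlled by \<open>val_tail\<close>.\<close>

lemma val_guaranteed:
  assumes \<tau>: "\<tau> \<in> plans K n0" and \<sigma>: "\<sigma> \<in> plans L n0" and "0 < \<epsilon>"
    and good: "\<And>w k. \<tau> w = enat k \<Longrightarrow> val k w - \<epsilon> \<le> x k w"
    and early: "\<And>w k. k \<in> K \<Longrightarrow> n0 \<le> k \<Longrightarrow> enat k < \<tau> w \<Longrightarrow> x k w < val k w - \<epsilon>"
    and w: "w \<in> set_pmf p" and n: "n0 \<le> n" "enat n \<le> \<tau> w" "enat n \<le> \<sigma> w"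
  shows "val n w \<le> avg n (pay \<tau> \<sigma>) w + \<epsilon>"
proof -
  define \<pi> where "\<pi> w = min (\<tau> w) (\<sigma> w)" for w
  have st: "stop_rule \<pi>"
    unfolding \<pi>_def using plansD(1)[OF \<tau>] plansD(1)[OF \<sigma>] by (rule stop_rule_min)
  \<comment> \<open>The payoff if play has ended before turn \<open>m\<close>, and the value less \<open>\<epsilon>\<close> otherwise: its averages do not decrease in \<open>m\<close>.\<close>
  define f where "f m w = (if \<pi> w < enat m then pay \<tau> \<sigma> w else val m w - \<epsilon>)" for m w
  have bdd_f: "bdd (f m)" for m
    unfolding f_def by (intro bdd_if bdd_diff bdd_pay bdd_val bdd_const)
  have f_step: "avg m (f m) w' \<le> avg m (f (Suc m)) w' + 0" if w': "w' \<in> set_pmf p" and m: "n0 \<le> m" for w' m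
  proof (cases "\<pi> w' < enat m")
    case True
    have "avg m (f m) w' = avg m (f (Suc m)) w'"
    proof (rule avg_cong)
      fix w'' assume "w'' \<in> cls m w'"
      then have "\<pi> w'' < enat m" using stop_rule_less_iff[OF st] True by blast
      moreover from this have "\<pi> w'' < enat (Suc m)"
        by (rule less_trans) simp
      ultimately show "f m w'' = f (Suc m) w''"
        unfolding f_def by simp
    qed
    then show ?thesis by simp
  next
    case False
    have "avg m (f m) w' = val m w' - \<epsilon>"
      using w' False by (intro avg_const_on) (auto simp: f_def stop_rule_less_iff[OF st] val_adapted)
    also have "\<dots> \<le> avg m (f (Suc m)) w'"
    proof (cases "\<pi> w' = enat m")
      case True
      have "f (Suc m) w'' = x m w'" if "w'' \<in> cls m w'" for w''
      proof -
        have "\<pi> w'' = enat m" using stop_ruleD[OF st that] True by simp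
        then show ?thesis using x_adapted[OF that] by (simp add: f_def pay_def \<pi>_def)
      qed
      then have "avg m (f (Suc m)) w' = x m w'"
        using w' by (intro avg_const_on)
      moreover have "val m w' - \<epsilon> \<le> x m w'"
      proof (cases "\<tau> w' = enat m")
        case True
        then show ?thesis by (rule good)
      next
        case False
        then have "\<sigma> w' = enat m" using \<open>\<pi> w' = enat m\<close> by (auto simp: \<pi>_def min_def split: if_splits)
        then show ?thesis using val_le_x[OF plansD(3)[OF \<sigma>] w'] \<open>0 < \<epsilon>\<close> by fastforce
      qed
      ultimately show ?thesis by simp
    next
      case neq: False
      have gt: "enat m < \<pi> w'" using False neq by auto
      have "val m w' \<le> avg m (val (Suc m)) w'"
        using val_le_step[OF w', of m] early[of m w'] m gt \<open>0 < \<epsilon>\<close> by (fastforce simp: \<pi>_def)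
      also have "\<dots> \<le> avg m (f (Suc m)) w' + \<epsilon>"
      proof (rule avg_mono[OF _ bdd_f w'])
        fix w'' assume "w'' \<in> cls m w'"
        then have "\<not> \<pi> w'' \<le> enat m" using gt stop_rule_le_iff[OF st, of w'' m w'] by simp
        then show "val (Suc m) w'' \<le> f (Suc m) w'' + \<epsilon>"
          by (cases "\<pi> w''") (auto simp: f_def)
      qed simp
      finally show ?thesis by simp
    qed
    finally show ?thesis by simp
  qed
  have claim: "val n w \<le> avg n (f m) w + \<epsilon>" if "n \<le> m" for m
    using that
  proof (induction m rule: dec_induct)
    case base
    have "\<not> \<pi> w < enat n" using n by (auto simp: \<pi>_def min_less_iff_disj)
    then have "avg n (f n) w = val n w - \<epsilon>"
      using w by (intro avg_const_on) (auto simp: f_def stop_rule_less_iff[OF st] val_adapted)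
    then show ?case by simp
  next
    case (step m)
    have "avg n (f m) w \<le> avg n (f (Suc m)) w + 0"
    proof (rule avg_le_by_cells[OF bdd_f bdd_f stop_rule_const[of "enat m"] w])
      show "avg (enat m) (f m) w' \<le> avg (enat m) (f (Suc m)) w' + 0" if "w' \<in> set_pmf p" for w'
        using that n(1) step(1) by (intro f_step) auto
    qed (use step(1) in simp)
    then show ?case using step(3) by simp
  qed
  \<comment> \<open>A bound for the excess of \<open>f m\<close> over the payoff that vanishes in the limit.\<close>
  define h where "h m w = (if \<pi> w < enat m then 0 else max 0 (val m w - pay \<tau> \<sigma> w))" for m w
  have h_bound: "\<bar>h m w\<bar> \<le> 2 * B" for m w
  proof -
    have "0 \<le> B" using x_bound[of \<infinity> w] by simp
    then show ?thesis
      using val_bound[of m w] pay_bound[of \<tau> \<sigma> w] by (cases "\<pi> w < enat m") (simp_all add: h_def)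
  qed
  have lim: "(\<lambda>m. avg n (h m) w) \<longlonglongrightarrow> 0"
  proof (rule avg_tendsto_0[OF h_bound])
    fix w' assume w': "w' \<in> set_pmf p"
    show "(\<lambda>m. h m w') \<longlonglongrightarrow> 0"
    proof (cases "\<pi> w'")
      case (enat k)
      have "eventually (\<lambda>m. h m w' = 0) sequentially"
        using eventually_gt_at_top[of k] by eventually_elim (simp add: h_def enat)
      then show ?thesis by (rule tendsto_eventually)
    next
      case infinity
      then have inf: "\<tau> w' = \<infinity>" "pay \<tau> \<sigma> w' = x \<infinity> w'"
        by (auto simp: \<pi>_def pay_def min_def split: if_splits)
      show ?thesis
      proof (rule order_tendstoI)
        fix a :: real assume "a < 0"
        then show "eventually (\<lambda>m. a < h m w') sequentially"
          unfolding h_def by (intro always_eventually allI) (simp add: less_max_iff_disj)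
      next
        fix a :: real assume "0 < a"
        then have "eventually (\<lambda>m. val m w' \<le> x \<infinity> w' + a / 2) sequentially"
        proof (intro val_tail[OF w' \<open>0 < \<epsilon>\<close>])
          show "x (enat k) w' \<le> val k w' - \<epsilon>" if "n0 \<le> k" "k \<in> K" for k
            using early[OF that(2,1)] inf(1) by (simp add: less_imp_le)
        qed simp
        then show "eventually (\<lambda>m. h m w' < a) sequentially"
          by eventually_elim (use \<open>0 < a\<close> in \<open>auto simp: h_def inf(2)\<close>)
      qed
    qed
  qed
  have "val n w \<le> avg n (pay \<tau> \<sigma>) w + \<epsilon> + avg n (h m) w" if "n \<le> m" for m
  proof -
    have "avg n (f m) w \<le> avg n (\<lambda>w. pay \<tau> \<sigma> w + h m w) w + 0"
      by (intro avg_mono[OF bdd_f] w bdd_add bdd_pay bddI[OF h_bound])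
        (use \<open>0 < \<epsilon>\<close> in \<open>auto simp: f_def h_def\<close>)
    also have "\<dots> = avg n (pay \<tau> \<sigma>) w + avg n (h m) w"
      by (simp add: avg_add bddI[OF h_bound])
    finally show ?thesis using claim[OF that] by simp
  qed
  then have "eventually (\<lambda>m. val n w \<le> avg n (pay \<tau> \<sigma>) w + \<epsilon> + avg n (h m) w) sequentially"
    by (auto simp: eventually_sequentially)
  moreover have "(\<lambda>m. avg n (pay \<tau> \<sigma>) w + \<epsilon> + avg n (h m) w) \<longlonglongrightarrow> avg n (pay \<tau> \<sigma>) w + \<epsilon> + 0"
    by (intro tendsto_intros lim)
  ultimately show ?thesis
    using tendsto_lowerbound[of "\<lambda>m. avg n (pay \<tau> \<sigma>) w + \<epsilon> + avg n (h m) w"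
      "avg n (pay \<tau> \<sigma>) w + \<epsilon> + 0" sequentially "val n w"] by simp
qed

end

section \<open>One stage of the discrete game\<close>

lemma INF_enat_eq_iff:
  fixes f :: "'b \<Rightarrow> enat"
  shows "(INF j\<in>A. f j) = enat k \<longleftrightarrow> (\<exists>j\<in>A. f j = enat k) \<and> (\<forall>j\<in>A. enat k \<le> f j)"
proof
  assume *: "(INF j\<in>A. f j) = enat k"
  then have "A \<noteq> {}" by (auto simp: top_enat_def)
  then have "(INF j\<in>A. f j) \<in> f ` A"
    unfolding Inf_enat_def by (auto intro: LeastI)
  moreover have "(INF j\<in>A. f j) \<le> f j" if "j \<in> A" for j
    using that by (rule INF_lower)
  ultimately show "(\<exists>j\<in>A. f j = enat k) \<and> (\<forall>j\<in>A. enat k \<le> f j)"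
    using * by auto
next
  assume "(\<exists>j\<in>A. f j = enat k) \<and> (\<forall>j\<in>A. enat k \<le> f j)"
  then show "(INF j\<in>A. f j) = enat k"
    by (metis INF_lower antisym INF_greatest)
qed

lemma INF_enat_eq_infinity_iff:
  fixes f :: "'b \<Rightarrow> enat"
  shows "(INF j\<in>A. f j) = \<infinity> \<longleftrightarrow> (\<forall>j\<in>A. f j = \<infinity>)"
  unfolding top_enat_def[symmetric] INF_top_conv ..

definition hit :: "(nat \<Rightarrow> bool) \<Rightarrow> enat" where
  "hit G = (if \<exists>k. G k then enat (LEAST k. G k) else \<infinity>)"

lemma hit_eq_enat_iff: "hit G = enat k \<longleftrightarrow> G k \<and> (\<forall>l<k. \<not> G l)"
proof
  assume "hit G = enat k"
  then have "\<exists>k. G k" "k = (LEAST k. G k)"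
    by (auto simp: hit_def split: if_splits)
  then show "G k \<and> (\<forall>l<k. \<not> G l)"
    by (metis LeastI_ex not_less_Least)
next
  assume *: "G k \<and> (\<forall>l<k. \<not> G l)"
  then have "(LEAST k. G k) = k"
    by (intro Least_equality) (auto simp: not_less[symmetric])
  then show "hit G = enat k"
    using * by (auto simp: hit_def)
qed

lemma hit_eq_infinity_iff: "hit G = \<infinity> \<longleftrightarrow> (\<forall>k. \<not> G k)"
  by (simp add: hit_def)

lemma not_before_hit: "enat k < hit G \<Longrightarrow> \<not> G k"
  using hit_eq_enat_iff[of G] hit_eq_infinity_iff[of G] by (cases "hit G") auto

context info_tree
begin

lemma stop_rule_INF:
  assumes "\<And>j. j \<in> A \<Longrightarrow> stop_rule (\<sigma> j)"
  shows "stop_rule (\<lambda>w. INF j\<in>A. \<sigma> j w)"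
  unfolding stop_rule_def
proof (intro allI ballI)
  fix w w' assume c: "w' \<in> cls (INF j\<in>A. \<sigma> j w) w"
  show "(INF j\<in>A. \<sigma> j w') = (INF j\<in>A. \<sigma> j w)"
  proof (cases "INF j\<in>A. \<sigma> j w")
    case (enat k)
    then have c: "w' \<in> cls (enat k) w" using c by simp
    have "(\<exists>j\<in>A. \<sigma> j w = enat k) \<and> (\<forall>j\<in>A. enat k \<le> \<sigma> j w)"
      using enat INF_enat_eq_iff by metis
    then have "(\<exists>j\<in>A. \<sigma> j w' = enat k) \<and> (\<forall>j\<in>A. enat k \<le> \<sigma> j w')"
      using stop_ruleD[OF assms c] stop_rule_less_iff[OF assms c] by (metis not_le order_refl)
    then show ?thesis using enat INF_enat_eq_iff by metis
  next
    case infinity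
    then have "w' \<in> cls \<infinity> w" using c by simp
    then have "\<sigma> j w' = \<sigma> j w" if "j \<in> A" for j
      using stop_ruleD[OF assms[OF that]] by simp
    then show ?thesis by simp
  qed
qed

lemma stop_rule_hit:
  assumes G: "\<And>k w w'. w' \<in> cls (enat k) w \<Longrightarrow> G k w' = G k w"
  shows "stop_rule (\<lambda>w. hit (\<lambda>k. G k w))"
  unfolding stop_rule_def
proof (intro allI ballI)
  fix w w' assume c: "w' \<in> cls (hit (\<lambda>k. G k w)) w"
  have G': "G k w' = G k w" if "enat k \<le> hit (\<lambda>k. G k w)" for k
    using G[of w' k w] c cls_mono[OF that, of w] by blast
  show "hit (\<lambda>k. G k w') = hit (\<lambda>k. G k w)"
  proof (cases "hit (\<lambda>k. G k w)")
    case (enat k)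
    then show ?thesis
      using G' hit_eq_enat_iff[of _ k] by (metis enat_ord_simps(1) less_imp_le_nat order_refl)
  next
    case infinity
    then show ?thesis
      using G' by (metis enat_ord_simps(3) hit_eq_infinity_iff)
  qed
qed

text \<open>The stage game ends with the first stop; a stop at turn \<open>k\<close> pays \<open>X k w i\<close> to player \<open>i\<close>. The equilibrium
  combines the guaranteeing rules of the zero-sum games of each player against the others with the threat
  of the others to hold a player who does not stop on time down to the value of that player.\<close>

theorem stage_equilibrium:
  fixes X :: "enat \<Rightarrow> 'a \<Rightarrow> nat \<Rightarrow> real" and pl :: "nat \<Rightarrow> nat"
  assumes X_adapted: "\<And>k w w' i. w' \<in> cls k w \<Longrightarrow> X k w' i = X k w i"
    and X_bound: "\<And>k w i. \<bar>X k w i\<bar> \<le> B"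
    and "0 < \<epsilon>"
  shows "\<exists>\<sigma>. (\<forall>j\<in>A. \<sigma> j \<in> plans {k. pl k = j} n) \<and>
    (\<forall>i\<in>A. \<forall>\<xi>\<in>plans {k. pl k = i} n. \<forall>w\<in>set_pmf p.
      avg n (\<lambda>w. X (INF j\<in>A. (\<sigma>(i := \<xi>)) j w) w i) w
        \<le> avg n (\<lambda>w. X (INF j\<in>A. \<sigma> j w) w i) w + 2 * \<epsilon>)"
proof -
  define T where "T i = {k. pl k = i}" for i
  define L where "L i = {k. pl k \<in> A - {i}}" for i
  define v where "v i = zero_sum.val p cls (\<lambda>k w. X k w i) (T i) (L i)" for i
  have zs: "zero_sum cls (\<lambda>k w. X k w i) (T i) (L i) B" for i
    by unfold_locales (use X_adapted X_bound in \<open>auto simp: T_def L_def\<close>)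
  \<comment> \<open>The rule \<open>\<tau> i\<close> guarantees player \<open>i\<close> the value up to \<open>\<epsilon>\<close>; on the path of play the stage ends at \<open>\<pi>\<close>.\<close>
  define G where "G i k w \<longleftrightarrow> n \<le> k \<and> pl k = i \<and> v i k w - \<epsilon> \<le> X k w i" for i k w
  define \<tau> where "\<tau> i = (\<lambda>w. hit (\<lambda>k. G i k w))" for i
  have "stop_rule (\<tau> i)" for i
    unfolding \<tau>_def
    by (rule stop_rule_hit) (simp add: G_def v_def X_adapted zero_sum.val_adapted[OF zs])
  moreover have "\<tau> i w = \<infinity> \<or> (\<exists>k\<in>T i. n \<le> k \<and> \<tau> i w = enat k)" for i w
    by (cases "\<tau> i w") (auto simp: \<tau>_def hit_eq_enat_iff G_def T_def)
  ultimately have \<tau>: "\<tau> i \<in> plans (T i) n" for i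
    by (auto simp: plans_def simp del: not_infinity_eq)
  define \<pi> where "\<pi> w = (INF j\<in>A. \<tau> j w)" for w
  have st_\<pi>: "stop_rule \<pi>"
    unfolding \<pi>_def using plansD(1)[OF \<tau>] by (rule stop_rule_INF)
  have \<pi>_turn: "pl k \<in> A \<and> \<tau> (pl k) w = enat k \<and> n \<le> k" if "\<pi> w = enat k" for w k
  proof -
    have "\<exists>j\<in>A. \<tau> j w = enat k"
      using that unfolding \<pi>_def INF_enat_eq_iff by blast
    then obtain j where "j \<in> A" "\<tau> j w = enat k" ..
    then show ?thesis
      using plansD(2,3)[OF \<tau>[of j], of w] by (auto simp: T_def)
  qed
  have "\<exists>q. q \<in> plans (L i) k \<and>
      (\<forall>w. zero_sum.snell p cls (\<lambda>k w. X k w i) (T i) k q w \<le> v i k w + \<epsilon>)" for i k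
    using zero_sum.val_attained[OF zs \<open>0 < \<epsilon>\<close>, of i k] unfolding v_def by blast
  then obtain q where q: "\<And>i k. q i k \<in> plans (L i) k"
    and q_le: "\<And>i k w. zero_sum.snell p cls (\<lambda>k w. X k w i) (T i) k (q i k) w \<le> v i k w + \<epsilon>"
    by metis
  \<comment> \<open>Nobody moves before \<open>\<pi>\<close>. If the player in turn does not stop then, the others follow the plan \<open>q\<close>
      against this player, each of them executing the stops at the own turns.\<close>
  define \<sigma> where "\<sigma> j w = (case \<pi> w of \<infinity> \<Rightarrow> \<infinity> | enat k \<Rightarrow>
      if pl k = j then enat k
      else case q (pl k) k w of \<infinity> \<Rightarrow> \<infinity> | enat l \<Rightarrow> if pl l = j then enat l else \<infinity>)" for j w
  have \<pi>_le_\<sigma>: "\<pi> w \<le> \<sigma> j w" for j w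
    using plansD(2)[OF q, of _ _ w] by (auto simp: \<sigma>_def split: enat.splits) (metis enat_ord_simps(1))
  have \<sigma>: "\<sigma> j \<in> plans (T j) n" for j
  proof -
    have "\<sigma> j w' = \<sigma> j w" if c: "w' \<in> cls (\<sigma> j w) w" for w w'
    proof -
      have \<pi>: "\<pi> w' = \<pi> w" using stop_ruleD[OF st_\<pi> c \<pi>_le_\<sigma>] .
      show ?thesis
      proof (cases "\<pi> w")
        case (enat k)
        have "q (pl k) k w' = q (pl k) k w" if "pl k \<noteq> j"
        proof (rule stop_ruleD[OF plansD(1)[OF q] c])
          show "q (pl k) k w \<le> \<sigma> j w"
            using that enat by (auto simp: \<sigma>_def split: enat.splits)
        qed
        then show ?thesis using \<pi> enat by (simp add: \<sigma>_def)
      qed (use \<pi> in \<open>simp add: \<sigma>_def\<close>)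
    qed
    then have "stop_rule (\<sigma> j)" by (simp add: stop_rule_def)
    moreover have "\<sigma> j w = \<infinity> \<or> (\<exists>k\<in>T j. n \<le> k \<and> \<sigma> j w = enat k)" for w
    proof (cases "\<sigma> j w")
      case (enat l)
      then obtain k where k: "\<pi> w = enat k" by (cases "\<pi> w") (auto simp: \<sigma>_def)
      then have "n \<le> l" using \<pi>_turn[OF k] \<pi>_le_\<sigma>[of w j] enat by simp
      moreover have "pl l = j"
        using enat k by (auto simp: \<sigma>_def split: if_splits enat.splits)
      ultimately show ?thesis using enat by (simp add: T_def)
    qed simp
    ultimately show ?thesis by (auto simp: plans_def simp del: not_infinity_eq)
  qed
  have first: "(INF j\<in>A. \<sigma> j w) = \<pi> w" for w
  proof (cases "\<pi> w")
    case (enat k)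
    then show ?thesis
      using \<pi>_turn[OF enat] \<pi>_le_\<sigma>[of w] INF_enat_eq_iff[of "\<lambda>j. \<sigma> j w" A k]
      by (auto simp: \<sigma>_def intro!: bexI[of _ "pl k"])
  next
    case infinity
    then have "(INF j\<in>A. \<sigma> j w) = \<infinity>"
      unfolding INF_enat_eq_infinity_iff by (simp add: \<sigma>_def)
    then show ?thesis using infinity by simp
  qed
  have rest: "(INF j\<in>A - {i}. \<sigma> j w) = (case \<pi> w of \<infinity> \<Rightarrow> \<infinity> | enat k \<Rightarrow>
      if pl k = i then q i k w else enat k)" for i w
  proof (cases "\<pi> w")
    case (enat k)
    show ?thesis
    proof (cases "pl k = i")
      case True
      show ?thesis
      proof (cases "q i k w")
        case q_eq: (enat l)
        then have "pl l \<in> A - {i}" using plansD(3)[OF q] by (auto simp: L_def)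
        then have "(INF j\<in>A - {i}. \<sigma> j w) = enat l"
          unfolding INF_enat_eq_iff using enat True q_eq by (auto simp: \<sigma>_def)
        then show ?thesis using enat True q_eq by simp
      next
        case infinity
        then have "(INF j\<in>A - {i}. \<sigma> j w) = \<infinity>"
          unfolding INF_enat_eq_infinity_iff using enat True by (auto simp: \<sigma>_def)
        then show ?thesis using enat True infinity by simp
      qed
    next
      case False
      then have "(INF j\<in>A - {i}. \<sigma> j w) = enat k"
        using \<pi>_turn[OF enat] \<pi>_le_\<sigma>[of w] enat unfolding INF_enat_eq_iff
        by (intro conjI bexI[of _ "pl k"]) (auto simp: \<sigma>_def)
      then show ?thesis using enat False by simp
    qed
  next
    case infinity
    then have "(INF j\<in>A - {i}. \<sigma> j w) = \<infinity>"
      unfolding INF_enat_eq_infinity_iff by (simp add: \<sigma>_def)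
    then show ?thesis using infinity by simp
  qed
  have dev: "(INF j\<in>A. (\<sigma>(i := \<xi>)) j w) = min (\<xi> w) (case \<pi> w of \<infinity> \<Rightarrow> \<infinity> | enat k \<Rightarrow>
      if pl k = i then q i k w else enat k)" if "i \<in> A" for i \<xi> w
  proof -
    have "(INF j\<in>A. (\<sigma>(i := \<xi>)) j w) = (INF j\<in>insert i (A - {i}). (\<sigma>(i := \<xi>)) j w)"
      using that by (simp add: insert_absorb)
    also have "\<dots> = min (\<xi> w) (INF j\<in>A - {i}. (\<sigma>(i := \<xi>)) j w)"
      by (simp only: INF_insert inf_min fun_upd_same)
    also have "(INF j\<in>A - {i}. (\<sigma>(i := \<xi>)) j w) = (INF j\<in>A - {i}. \<sigma> j w)"
      by (intro INF_cong) auto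
    finally show ?thesis unfolding rest .
  qed
  have "avg n (\<lambda>w. X (INF j\<in>A. (\<sigma>(i := \<xi>)) j w) w i) w
      \<le> avg n (\<lambda>w. X (\<pi> w) w i) w + 2 * \<epsilon>"
    if i: "i \<in> A" and \<xi>: "\<xi> \<in> plans (T i) n" and w: "w \<in> set_pmf p" for i \<xi> w
  proof -
    interpret zero_sum p cls "\<lambda>k w. X k w i" "T i" "L i" B by (rule zs)
    define m where "m w = (INF j\<in>A. (\<sigma>(i := \<xi>)) j w)" for w
    note m = dev[OF i, of \<xi>, folded m_def]
    have st_\<xi>: "stop_rule \<xi>" using plansD(1)[OF \<xi>] .
    have "avg n (\<lambda>w. X (m w) w i) w \<le> avg n (\<lambda>w. X (\<pi> w) w i) w + 2 * \<epsilon>"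
    proof (rule avg_le_by_cells[where \<kappa> = "\<lambda>w. min (\<xi> w) (\<pi> w)"])
      show "bdd (\<lambda>w. X (m w) w i)" "bdd (\<lambda>w. X (\<pi> w) w i)"
        by (auto intro: bddI X_bound)
      show "stop_rule (\<lambda>w. min (\<xi> w) (\<pi> w))"
        using st_\<xi> st_\<pi> by (rule stop_rule_min)
      show "enat n \<le> min (\<xi> w') (\<pi> w')" for w'
        using plansD(2)[OF \<xi>] \<pi>_turn[of w'] by (cases "\<pi> w'") auto
    next
      fix w' assume w': "w' \<in> set_pmf p"
      define k where "k = min (\<xi> w') (\<pi> w')"
      show "avg k (\<lambda>w. X (m w) w i) w' \<le> avg k (\<lambda>w. X (\<pi> w) w i) w' + 2 * \<epsilon>"
      proof (cases "\<forall>w''\<in>cls k w'. m w'' = \<pi> w''")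
        case True
        then have "avg k (\<lambda>w. X (m w) w i) w' = avg k (\<lambda>w. X (\<pi> w) w i) w'"
          by (intro avg_cong) simp
        then show ?thesis using \<open>0 < \<epsilon>\<close> by simp
      next
        case False
        then obtain w1 where w1: "w1 \<in> cls k w'" "m w1 \<noteq> \<pi> w1" by blast
        show ?thesis
        \<comment> \<open>Either the deviator stops ahead of \<open>\<pi>\<close>, or fails to stop at \<open>\<pi>\<close>.\<close>
        proof (cases "\<xi> w' < \<pi> w'")
          case True
          then obtain l where l: "\<xi> w' = enat l" by (cases "\<xi> w'") auto
          then have k: "k = enat l" "enat l < \<pi> w'" using True by (auto simp: k_def)
          have lT: "l \<in> T i" using plansD(3)[OF \<xi> l] .
          \<comment> \<open>An early stop pays at most the value, which waiting for \<open>\<pi>\<close> would have guaranteed up to \<open>\<epsilon>\<close>.\<close>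
          have "X (m w'') w'' i = X l w' i" if c: "w'' \<in> cls k w'" for w''
          proof -
            have "\<xi> w'' = enat l" using stop_ruleD[OF st_\<xi> c] l k by simp
            moreover have "\<not> \<pi> w'' \<le> enat l" using stop_rule_le_iff[OF st_\<pi> c] k by simp
            then have "enat l \<le> (INF j\<in>A - {i}. \<sigma> j w'')"
              using \<pi>_le_\<sigma>[of w''] by (intro INF_greatest) (meson less_imp_le not_le order_trans)
            ultimately have "m w'' = enat l" unfolding m rest by (simp add: min_def)
            then show ?thesis using X_adapted[OF c] k by simp
          qed
          then have "avg k (\<lambda>w. X (m w) w i) w' = X l w' i"
            using w' by (intro avg_const_on)
          also have "\<dots> \<le> v i l w'"
            unfolding v_def by (rule x_le_val[OF lT w'])
          also have "\<dots> \<le> avg l (pay (\<tau> i) (\<lambda>w. INF j\<in>A - {i}. \<tau> j w)) w' + \<epsilon>"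
            unfolding v_def
          proof (rule val_guaranteed[OF \<tau> _ \<open>0 < \<epsilon>\<close> _ _ w'])
            have "stop_rule (\<lambda>w. INF j\<in>A - {i}. \<tau> j w)"
              using plansD(1)[OF \<tau>] by (rule stop_rule_INF)
            moreover have "(INF j\<in>A - {i}. \<tau> j w) = \<infinity> \<or>
                (\<exists>k\<in>L i. n \<le> k \<and> (INF j\<in>A - {i}. \<tau> j w) = enat k)" for w
            proof (cases "INF j\<in>A - {i}. \<tau> j w")
              case (enat k)
              then obtain j where j: "j \<in> A - {i}" "\<tau> j w = enat k"
                using INF_enat_eq_iff by metis
              then have "pl k = j" "n \<le> k"
                using plansD(2,3)[OF \<tau>[of j], of w] by (auto simp: T_def)
              then show ?thesis using enat j by (auto simp: L_def)
            qed simp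
            ultimately show "(\<lambda>w. INF j\<in>A - {i}. \<tau> j w) \<in> plans (L i) n"
              by (auto simp: plans_def simp del: not_infinity_eq)
            show "val k w - \<epsilon> \<le> X (enat k) w i" if "\<tau> i w = enat k" for w k
              using that unfolding \<tau>_def hit_eq_enat_iff G_def v_def by simp
            show "X (enat k) w i < val k w - \<epsilon>" if "k \<in> T i" "n \<le> k" "enat k < \<tau> i w" for w k
            proof -
              have "\<not> G i k w"
                using that(3) unfolding \<tau>_def by (rule not_before_hit[where G = "\<lambda>k. G i k w"])
              then show ?thesis using that by (auto simp: G_def T_def v_def)
            qed
            show "n \<le> l" using plansD(2)[OF \<xi>, of w'] l by simp
            show "enat l \<le> \<tau> i w'" "enat l \<le> (INF j\<in>A - {i}. \<tau> j w')"
              using k(2) i INF_superset_mono[of "A - {i}" A "\<lambda>j. \<tau> j w'" "\<lambda>j. \<tau> j w'"]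
                INF_lower[OF i, of "\<lambda>j. \<tau> j w'"] unfolding \<pi>_def by auto
          qed
          also have "pay (\<tau> i) (\<lambda>w. INF j\<in>A - {i}. \<tau> j w) = (\<lambda>w. X (\<pi> w) w i)"
          proof -
            have "\<pi> w = min (\<tau> i w) (INF j\<in>A - {i}. \<tau> j w)" for w
              unfolding \<pi>_def using i by (metis INF_insert inf_min insert_Diff)
            then show ?thesis by (simp add: pay_def)
          qed
          finally show ?thesis using \<open>0 < \<epsilon>\<close> by (simp add: k)
        next
          case False
          then have k_eq: "k = \<pi> w'" by (simp add: k_def)
          have "k \<noteq> \<infinity>"
          proof
            assume "k = \<infinity>"
            then have "\<xi> w1 = \<infinity>" "\<pi> w1 = \<infinity>"
              using stop_ruleD[OF st_\<xi> w1(1)] stop_ruleD[OF st_\<pi> w1(1)] False k_eq by auto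
            then show False using w1(2) by (simp add: m)
          qed
          then obtain l where l: "k = enat l" by auto
          then have \<pi>l: "\<pi> w' = enat l" and \<xi>l: "enat l \<le> \<xi> w'" using k_eq False by auto
          have \<pi>'': "\<pi> w'' = enat l" and \<xi>'': "enat l \<le> \<xi> w''" if "w'' \<in> cls k w'" for w''
            using stop_ruleD[OF st_\<pi> that] \<pi>l stop_rule_less_iff[OF st_\<xi> that] \<xi>l l by auto
          have pl: "pl l = i"
            using w1(2) \<pi>''[OF w1(1)] \<xi>''[OF w1(1)] by (cases "pl l = i") (simp_all add: m min_absorb2)
          have "\<xi> w' \<noteq> enat l"
          proof
            assume "\<xi> w' = enat l"
            then have "\<xi> w1 = enat l" using stop_ruleD[OF st_\<xi> w1(1)] l by simp
            then show False using w1 \<pi>''[OF w1(1)] pl plansD(2)[OF q, of l i w1] by (simp add: m)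
          qed
          then have "enat l < \<xi> w'" using \<xi>l by simp
          \<comment> \<open>From turn \<open>l\<close> on, the deviator faces the plan \<open>q i l\<close>, although \<open>X l\<close> was within \<open>\<epsilon>\<close> of the value.\<close>
          define \<xi>' where "\<xi>' = (\<lambda>w. if \<xi> w < enat l then \<infinity> else \<xi> w)"
          have \<xi>': "\<xi>' \<in> plans (T i) l"
            unfolding \<xi>'_def by (rule plans_from[OF \<xi>])
          have "avg k (\<lambda>w. X (m w) w i) w' = avg l (pay \<xi>' (q i l)) w'"
            unfolding l
          proof (rule avg_cong)
            fix w'' assume "w'' \<in> cls (enat l) w'"
            then show "X (m w'') w'' i = pay \<xi>' (q i l) w''"
              using \<pi>''[of w''] \<xi>''[of w''] pl l by (simp add: pay_def m \<xi>'_def not_less[symmetric])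
          qed
          also have "\<dots> \<le> v i l w' + \<epsilon>"
            using avg_le_snell[OF \<xi>', of "q i l" w'] q_le[of i l w'] by linarith
          also have "v i l w' \<le> X l w' i + \<epsilon>"
            using \<pi>_turn[OF \<pi>l] pl unfolding \<tau>_def hit_eq_enat_iff G_def by auto
          also have "X l w' i = avg k (\<lambda>w. X (\<pi> w) w i) w'"
            using \<pi>'' X_adapted l w' by (intro avg_const_on[symmetric]) auto
          finally show ?thesis by simp
        qed
      qed
    qed (rule w)
    then show ?thesis unfolding m_def .
  qed
  then show ?thesis
    using \<sigma> by (intro exI[of _ \<sigma>]) (simp add: first T_def)
qed

end

section \<open>The discrete game\<close>

text \<open>A history assigns to every player the turn of the stop, or \<open>\<infinity>\<close> while the player is active.\<close>

definition remaining :: "nat \<Rightarrow> (nat \<Rightarrow> enat) \<Rightarrow> nat set" where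
  "remaining N y = {j\<in>{1..N}. y j = \<infinity>}"

lemma finite_remaining [simp]: "finite (remaining N y)"
  by (simp add: remaining_def)

lemma remaining_upd: "remaining N (y(i := enat k)) = remaining N y - {i}"
  by (auto simp: remaining_def)

lemma card_remaining_upd:
  "i \<in> remaining N y \<Longrightarrow> card (remaining N y) = Suc (card (remaining N (y(i := enat k))))"
  unfolding remaining_upd by (rule card.remove) simp_all

lemma card_remaining_upd_less:
  "i \<in> remaining N y \<Longrightarrow> card (remaining N (y(i := enat k))) < card (remaining N y)"
  using card_remaining_upd[of i N y k] by simp

context
  fixes N :: nat and pl :: "nat \<Rightarrow> nat"
begin

text \<open>The plans \<open>c\<close> give the turn at which each active player intends to stop, depending on the history and on
  the first turn that may be used. That the turn belongs to an active player holds for all plans of interest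
  and is tested only for the sake of termination.\<close>

function play :: "((nat \<Rightarrow> enat) \<times> nat \<Rightarrow> nat \<Rightarrow> enat) \<Rightarrow> (nat \<Rightarrow> enat) \<times> nat \<Rightarrow> nat \<Rightarrow> enat" where
  "play c (y, n) = (case INF j\<in>remaining N y. c (y, n) j of
      \<infinity> \<Rightarrow> y
    | enat k \<Rightarrow> if pl k \<in> remaining N y then play c (y(pl k := enat k), Suc k) else y)"
  by pat_completeness auto
termination
proof (relation "Wellfounded.measure (\<lambda>(c, y, n). card (remaining N y))")
  show "((c, y(pl k := enat k), Suc k), c, y, n) \<in> Wellfounded.measure (\<lambda>(c, y, n). card (remaining N y))"
    if "pl k \<in> remaining N y" for c :: "(nat \<Rightarrow> enat) \<times> nat \<Rightarrow> nat \<Rightarrow> enat" and y n k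
    using card_remaining_upd_less[OF that, of k] by (simp only: in_measure split)
qed (rule wf_measure)

declare play.simps [simp del]

definition play_from :: "((nat \<Rightarrow> enat) \<times> nat \<Rightarrow> nat \<Rightarrow> enat) \<Rightarrow> (nat \<Rightarrow> enat) \<Rightarrow> enat \<Rightarrow> nat \<Rightarrow> enat" where
  "play_from c y k = (case k of \<infinity> \<Rightarrow> y
    | enat k \<Rightarrow> if pl k \<in> remaining N y then play c (y(pl k := enat k), Suc k) else y)"

lemma play_eq: "play c (y, n) = play_from c y (INF j\<in>remaining N y. c (y, n) j)"
  unfolding play_from_def by (rule play.simps)

lemma play_cong:
  assumes "\<And>y' n' j. remaining N y' \<subseteq> remaining N y \<Longrightarrow> j \<in> remaining N y' \<Longrightarrow> c (y', n') j = d (y', n') j"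
  shows "play c (y, n) = play d (y, n)"
  using assms
proof (induction "card (remaining N y)" arbitrary: y n rule: less_induct)
  case less
  have first: "(INF j\<in>remaining N y. c (y, n) j) = (INF j\<in>remaining N y. d (y, n) j)"
    using less.prems by (intro INF_cong) auto
  have "play c (y(pl k := enat k), Suc k) = play d (y(pl k := enat k), Suc k)"
    if "pl k \<in> remaining N y" for k
    using that less.prems by (intro less.hyps) (auto simp: card_remaining_upd_less, auto simp: remaining_upd)
  then show ?case
    unfolding play_eq[of _ y n] first by (auto simp: play_from_def split: enat.splits)
qed

lemma play_from_cong:
  assumes "\<And>y' n' j. card (remaining N y') < card (remaining N y) \<Longrightarrow> remaining N y' \<subseteq> remaining N y \<Longrightarrow>
    j \<in> remaining N y' \<Longrightarrow> c (y', n') j = d (y', n') j"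
  shows "play_from c y k = play_from d y k"
proof -
  have "play c (y(pl k := enat k), Suc k) = play d (y(pl k := enat k), Suc k)"
    if "pl k \<in> remaining N y" for k
  proof (rule play_cong)
    fix y' n' j assume *: "remaining N y' \<subseteq> remaining N (y(pl k := enat k))" "j \<in> remaining N y'"
    then have "card (remaining N y') \<le> card (remaining N (y(pl k := enat k)))"
      by (intro card_mono) auto
    then show "c (y', n') j = d (y', n') j"
      using * card_remaining_upd_less[OF that, of k] unfolding remaining_upd
      by (intro assms) auto
  qed
  then show ?thesis
    by (auto simp: play_from_def split: enat.splits)
qed

end

context info_tree
begin

definition deviate :: "((nat \<Rightarrow> enat) \<times> nat \<Rightarrow> nat \<Rightarrow> 'a \<Rightarrow> enat) \<Rightarrow> nat \<Rightarrow> ('a \<Rightarrow> enat) \<Rightarrow> 'a \<Rightarrow>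
    (nat \<Rightarrow> enat) \<times> nat \<Rightarrow> nat \<Rightarrow> enat" where
  "deviate P i \<xi> w s j = (if j = i then \<xi> w else P s j w)"

text \<open>The plans are constructed by well-founded recursion on the number of active players: the stage payoffs at a
  history are determined by the plans at histories with fewer active players. A deviation of player \<open>i\<close> can be
  described by the single stopping time \<open>\<xi>\<close> at which it makes \<open>i\<close> stop, because the others follow fixed plans and
  reveal nothing beyond the state. It gains at most \<open>2 \<epsilon>\<close> in each stage.\<close>

theorem discrete_equilibrium:
  fixes u :: "nat \<Rightarrow> (nat \<Rightarrow> enat) \<Rightarrow> 'a \<Rightarrow> real" and pl :: "nat \<Rightarrow> nat" and N :: nat
  assumes u_bound: "\<And>i y w. \<bar>u i y w\<bar> \<le> B" and "0 < \<epsilon>"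
  shows "\<exists>P. (\<forall>y n. \<forall>j\<in>remaining N y. P (y, n) j \<in> plans {k. pl k = j} n) \<and>
    (\<forall>y n. \<forall>i\<in>remaining N y. \<forall>\<xi>\<in>plans {k. pl k = i} n. \<forall>w\<in>set_pmf p.
      avg n (\<lambda>w. u i (play N pl (deviate P i \<xi> w) (y, n)) w) w
      \<le> avg n (\<lambda>w. u i (play N pl (\<lambda>s j. P s j w) (y, n)) w) w + real (card (remaining N y)) * (2 * \<epsilon>))"
proof -
  \<comment> \<open>The value to player \<open>i\<close> of a stop at turn \<open>k\<close> after history \<open>y\<close>, if all plans are followed from then on.\<close>
  define X where "X P y k w i = avg k (\<lambda>w. u i (play_from N pl (\<lambda>s j. P s j w) y k) w) w"
    for P :: "(nat \<Rightarrow> enat) \<times> nat \<Rightarrow> nat \<Rightarrow> 'a \<Rightarrow> enat" and y k w i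
  have X_bound: "\<bar>X P y k w i\<bar> \<le> B" for P y k w i
    unfolding X_def by (rule avg_bound) (rule u_bound)
  have X_adapted: "X P y k w' i = X P y k w i" if "w' \<in> cls k w" for P y k w w' i
    unfolding X_def using that by (rule avg_adapted)
  define ok where "ok P s \<sigma> \<longleftrightarrow> (\<forall>j\<in>remaining N (fst s). \<sigma> j \<in> plans {k. pl k = j} (snd s)) \<and>
    (\<forall>i\<in>remaining N (fst s). \<forall>\<xi>\<in>plans {k. pl k = i} (snd s). \<forall>w\<in>set_pmf p.
      avg (snd s) (\<lambda>w. X P (fst s) (INF j\<in>remaining N (fst s). (\<sigma>(i := \<xi>)) j w) w i) w
        \<le> avg (snd s) (\<lambda>w. X P (fst s) (INF j\<in>remaining N (fst s). \<sigma> j w) w i) w + 2 * \<epsilon>)"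
    for P :: "(nat \<Rightarrow> enat) \<times> nat \<Rightarrow> nat \<Rightarrow> 'a \<Rightarrow> enat" and s and \<sigma> :: "nat \<Rightarrow> 'a \<Rightarrow> enat"
  have "\<exists>P. \<forall>s. ok P s (P s)"
  proof (rule dependent_wf_choice[OF wf_measure[of "\<lambda>s. card (remaining N (fst s))"]])
    fix P P' :: "(nat \<Rightarrow> enat) \<times> nat \<Rightarrow> nat \<Rightarrow> 'a \<Rightarrow> enat" and s \<sigma>
    assume *: "\<And>z. (z, s) \<in> Wellfounded.measure (\<lambda>s. card (remaining N (fst s))) \<Longrightarrow> P z = P' z"
    have "X P (fst s) = X P' (fst s)"
      unfolding X_def using * by (intro ext arg_cong3[where f = avg] arg_cong2[where f = "u _"] refl play_from_cong) auto
    then show "ok P s \<sigma> = ok P' s \<sigma>"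
      by (simp add: ok_def)
  next
    fix P :: "(nat \<Rightarrow> enat) \<times> nat \<Rightarrow> nat \<Rightarrow> 'a \<Rightarrow> enat" and s
    show "\<exists>\<sigma>. ok P s \<sigma>"
      unfolding ok_def by (rule stage_equilibrium[OF X_adapted X_bound \<open>0 < \<epsilon>\<close>])
  qed
  then obtain P where P: "\<And>s. ok P s (P s)" by blast
  have plans_P: "P (y, n) j \<in> plans {k. pl k = j} n" if "j \<in> remaining N y" for y n j
    using P[of "(y, n)"] that by (simp add: ok_def)
  have bdd_u: "bdd (\<lambda>w. u i (f w) w)" for i f
    using u_bound by (rule bddI)
  have bdd_X: "bdd (\<lambda>w. X P y (f w) w i)" for y f i
    using X_bound by (rule bddI)
  have "avg n (\<lambda>w. u i (play N pl (deviate P i \<xi> w) (y, n)) w) w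
      \<le> avg n (\<lambda>w. u i (play N pl (\<lambda>s j. P s j w) (y, n)) w) w + real (card (remaining N y)) * (2 * \<epsilon>)"
    if "i \<in> remaining N y" "\<xi> \<in> plans {k. pl k = i} n" "w \<in> set_pmf p" for y n i \<xi> w
    using that
  proof (induction "card (remaining N y)" arbitrary: y n \<xi> w rule: less_induct)
    case less
    note i = less.prems(1) and \<xi> = less.prems(2) and w = less.prems(3)
    define A where "A = remaining N y"
    define \<sigma> where "\<sigma> = P (y, n)"
    define m where "m w = (INF j\<in>A. (\<sigma>(i := \<xi>)) j w)" for w
    define \<pi> where "\<pi> w = (INF j\<in>A. \<sigma> j w)" for w
    define c where "c = real (card A - 1) * (2 * \<epsilon>)"
    have c: "0 \<le> c" "c + 2 * \<epsilon> = real (card A) * (2 * \<epsilon>)"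
      using \<open>0 < \<epsilon>\<close> card_remaining_upd[OF i, of undefined] by (auto simp: c_def A_def algebra_simps)
    have \<sigma>: "\<sigma> j \<in> plans {k. pl k = j} n" if "j \<in> A" for j
      using plans_P that by (simp add: \<sigma>_def A_def)
    then have \<sigma>': "(\<sigma>(i := \<xi>)) j \<in> plans {k. pl k = j} n" if "j \<in> A" for j
      using \<xi> that by auto
    have first: "stop_rule (\<lambda>w. INF j\<in>A. f j w)" "enat n \<le> (INF j\<in>A. f j w)"
      "(INF j\<in>A. f j w) = enat k \<Longrightarrow> pl k \<in> A"
      if f: "\<And>j. j \<in> A \<Longrightarrow> f j \<in> plans {k. pl k = j} n" for f w k
    proof -
      show "stop_rule (\<lambda>w. INF j\<in>A. f j w)" using plansD(1)[OF f] by (rule stop_rule_INF)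
      show "enat n \<le> (INF j\<in>A. f j w)" using plansD(2)[OF f] by (rule INF_greatest)
      show "pl k \<in> A" if "(INF j\<in>A. f j w) = enat k"
      proof -
        have "\<exists>j\<in>A. f j w = enat k" using \<open>(INF j\<in>A. f j w) = enat k\<close> unfolding INF_enat_eq_iff by simp
        then show ?thesis using plansD(3)[OF f] by fastforce
      qed
    qed
    have out: "play N pl (\<lambda>s j. P s j w) (y, n) = play_from N pl (\<lambda>s j. P s j w) y (\<pi> w)" for w
      unfolding play_eq[of _ _ _ y n] \<pi>_def \<sigma>_def A_def ..
    have dev: "play N pl (deviate P i \<xi> w) (y, n) = play_from N pl (deviate P i \<xi> w) y (m w)" for w
      unfolding play_eq[of _ _ _ y n] m_def \<sigma>_def A_def
      by (intro arg_cong[where f = "play_from _ _ _ _"] INF_cong) (auto simp: deviate_def)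
    have X_const: "avg k (\<lambda>w. X P y (f w) w i) w = X P y k w i"
      if "stop_rule f" "k = f w" "w \<in> set_pmf p" for f k w
      using that X_adapted by (intro avg_const_on) (auto simp: stop_rule_def)
    have "avg n (\<lambda>w. u i (play N pl (deviate P i \<xi> w) (y, n)) w) w \<le> avg n (\<lambda>w. X P y (m w) w i) w + c"
    proof (rule avg_le_by_cells[OF bdd_u bdd_X, where \<kappa> = m])
      show st_m: "stop_rule m" "\<And>w. enat n \<le> m w"
        unfolding m_def using first[OF \<sigma>'] by auto
      fix w' assume w': "w' \<in> set_pmf p"
      have m'': "m w'' = m w'" if "w'' \<in> cls (m w') w'" for w''
        using stop_ruleD[OF st_m(1) that] by simp
      have "avg (m w') (\<lambda>w. u i (play N pl (deviate P i \<xi> w) (y, n)) w) w'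
        \<le> avg (m w') (\<lambda>w. u i (play_from N pl (\<lambda>s j. P s j w) y (m w')) w) w' + c"
      \<comment> \<open>After a stop of \<open>i\<close>, or if nobody stops, there is nothing left to deviate from.\<close>
      proof (cases "\<exists>k. m w' = enat k \<and> pl k \<noteq> i")
        case False
        have "play_from N pl (deviate P i \<xi> w'') y (m w') = play_from N pl (\<lambda>s j. P s j w'') y (m w')" for w''
        proof (cases "m w'")
          case (enat k)
          then have "pl k = i" using False by auto
          then have "play N pl (deviate P i \<xi> w'') (y(pl k := enat k), Suc k) =
              play N pl (\<lambda>s j. P s j w'') (y(pl k := enat k), Suc k)"
            by (intro play_cong) (auto simp: remaining_upd deviate_def)
          then show ?thesis using enat by (simp add: play_from_def)
        qed (simp add: play_from_def)
        then have "avg (m w') (\<lambda>w. u i (play N pl (deviate P i \<xi> w) (y, n)) w) w'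
          = avg (m w') (\<lambda>w. u i (play_from N pl (\<lambda>s j. P s j w) y (m w')) w) w'"
          unfolding dev using m'' by (intro avg_cong) simp
        then show ?thesis using c(1) by simp
      next
        case True
        then obtain k where k: "m w' = enat k" "pl k \<noteq> i" by blast
        have plk: "pl k \<in> A" using first(3)[OF \<sigma>'] k unfolding m_def by blast
        \<comment> \<open>Another player stops first, and the deviation goes on in the next stage.\<close>
        define y' where "y' = y(pl k := enat k)"
        define \<xi>' where "\<xi>' = (\<lambda>w. if \<xi> w < enat (Suc k) then \<infinity> else \<xi> w)"
        have \<xi>': "\<xi>' \<in> plans {k. pl k = i} (Suc k)"
          unfolding \<xi>'_def by (rule plans_from[OF \<xi>])
        have dev': "play N pl (deviate P i \<xi> w'') (y, n) = play N pl (deviate P i \<xi>' w'') (y', Suc k)"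
          if "w'' \<in> cls k w'" for w''
        proof -
          have m: "m w'' = enat k" using m'' k that by simp
          then have "enat k \<le> \<xi> w''"
            using INF_lower[of i A "\<lambda>j. (\<sigma>(i := \<xi>)) j w''"] i by (simp add: m_def A_def)
          moreover have "\<xi> w'' \<noteq> enat k" using plansD(3)[OF \<xi>, of w'' k] k(2) by auto
          ultimately have "\<xi>' w'' = \<xi> w''" by (cases "\<xi> w''") (auto simp: \<xi>'_def)
          then have "deviate P i \<xi>' w'' = deviate P i \<xi> w''" by (intro ext) (simp add: deviate_def)
          then show ?thesis
            using plk unfolding dev m by (simp add: play_from_def A_def y'_def)
        qed
        have less_card: "card (remaining N y') < card (remaining N y)"
          using card_remaining_upd[of "pl k" N y k] plk by (simp add: A_def y'_def)
        have c': "c = real (card (remaining N y')) * (2 * \<epsilon>)"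
          using card_remaining_upd[of "pl k" N y k] plk by (simp add: A_def y'_def c_def)
        have "avg k (\<lambda>w. u i (play N pl (deviate P i \<xi>' w) (y', Suc k)) w) w'
          \<le> avg k (\<lambda>w. u i (play N pl (\<lambda>s j. P s j w) (y', Suc k)) w) w' + c"
        proof (rule avg_le_by_cells[OF bdd_u bdd_u stop_rule_const w'])
          fix w'' assume "w'' \<in> set_pmf p"
          then show "avg (Suc k) (\<lambda>w. u i (play N pl (deviate P i \<xi>' w) (y', Suc k)) w) w''
            \<le> avg (Suc k) (\<lambda>w. u i (play N pl (\<lambda>s j. P s j w) (y', Suc k)) w) w'' + c"
            unfolding c' using i k(2) \<xi>' less_card by (intro less.hyps) (auto simp: y'_def remaining_upd)
        qed simp
        also have "avg k (\<lambda>w. u i (play N pl (deviate P i \<xi>' w) (y', Suc k)) w) w' =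
            avg (m w') (\<lambda>w. u i (play N pl (deviate P i \<xi> w) (y, n)) w) w'"
          unfolding k using dev' by (intro avg_cong) simp
        also have "(\<lambda>w. u i (play N pl (\<lambda>s j. P s j w) (y', Suc k)) w) =
            (\<lambda>w. u i (play_from N pl (\<lambda>s j. P s j w) y (m w')) w)"
          using plk by (simp add: k play_from_def A_def y'_def)
        finally show ?thesis by (simp add: k)
      qed
      also have "avg (m w') (\<lambda>w. u i (play_from N pl (\<lambda>s j. P s j w) y (m w')) w) w' =
          avg (m w') (\<lambda>w. X P y (m w) w i) w'"
        using X_const[OF st_m(1) refl w'] by (simp add: X_def)
      finally show "avg (m w') (\<lambda>w. u i (play N pl (deviate P i \<xi> w) (y, n)) w) w' \<le>
          avg (m w') (\<lambda>w. X P y (m w) w i) w' + c" .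
    qed (rule w)
    also have "avg n (\<lambda>w. X P y (m w) w i) w \<le> avg n (\<lambda>w. X P y (\<pi> w) w i) w + 2 * \<epsilon>"
      using P[of "(y, n)"] i \<xi> w unfolding m_def \<pi>_def \<sigma>_def A_def ok_def by simp
    also have "avg n (\<lambda>w. X P y (\<pi> w) w i) w \<le>
        avg n (\<lambda>w. u i (play N pl (\<lambda>s j. P s j w) (y, n)) w) w + 0"
    proof (rule avg_le_by_cells[OF bdd_X bdd_u, where \<kappa> = \<pi>])
      show st_\<pi>: "stop_rule \<pi>" "\<And>w. enat n \<le> \<pi> w"
        unfolding \<pi>_def using first[OF \<sigma>] by auto
      fix w' assume w': "w' \<in> set_pmf p"
      have "avg (\<pi> w') (\<lambda>w. X P y (\<pi> w) w i) w' =
          avg (\<pi> w') (\<lambda>w. u i (play_from N pl (\<lambda>s j. P s j w) y (\<pi> w')) w) w'"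
        using X_const[OF st_\<pi>(1) refl w'] by (simp add: X_def)
      also have "\<dots> = avg (\<pi> w') (\<lambda>w. u i (play N pl (\<lambda>s j. P s j w) (y, n)) w) w'"
        unfolding out using stop_ruleD[OF st_\<pi>(1)] by (intro avg_cong) simp
      finally show "avg (\<pi> w') (\<lambda>w. X P y (\<pi> w) w i) w' \<le>
          avg (\<pi> w') (\<lambda>w. u i (play N pl (\<lambda>s j. P s j w) (y, n)) w) w' + 0" by simp
    qed (rule w)
    finally show ?case using c(2) by (simp add: A_def)
  qed
  then show ?thesis using plans_P by blast
qed

end

section \<open>Runs of the game in continuous time\<close>

definition responds_later :: "nat \<Rightarrow> (nat \<Rightarrow> 'a strategy) \<Rightarrow> 'a \<Rightarrow> bool" where
  "responds_later N \<rho> w \<longleftrightarrow> (\<forall>S j t. S \<subseteq> {1..N} \<longrightarrow> S \<noteq> {} \<longrightarrow> j \<in> {1..N} - S \<longrightarrow> t \<in> S \<rightarrow>\<^sub>E UNIV \<longrightarrow>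
     Max (t ` S) < \<top> \<longrightarrow> Max (t ` S) < \<rho> j S t w)"

lemma responds_laterD:
  "responds_later N \<rho> w \<Longrightarrow> S \<subseteq> {1..N} \<Longrightarrow> S \<noteq> {} \<Longrightarrow> j \<in> {1..N} - S \<Longrightarrow> t \<in> S \<rightarrow>\<^sub>E UNIV \<Longrightarrow>
    Max (t ` S) < \<top> \<Longrightarrow> Max (t ` S) < \<rho> j S t w"
  unfolding responds_later_def by blast

definition next_time :: "nat \<Rightarrow> (nat \<Rightarrow> 'a strategy) \<Rightarrow> 'a \<Rightarrow> nat set \<Rightarrow> (nat \<Rightarrow> ennreal) \<Rightarrow> ennreal" where
  "next_time N \<rho> w S r = Min ((\<lambda>i. \<rho> i S (restrict r S) w) ` ({1..N} - S))"

definition next_players :: "nat \<Rightarrow> (nat \<Rightarrow> 'a strategy) \<Rightarrow> 'a \<Rightarrow> nat set \<Rightarrow> (nat \<Rightarrow> ennreal) \<Rightarrow> nat set" where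
  "next_players N \<rho> w S r = {i \<in> {1..N} - S. \<rho> i S (restrict r S) w = next_time N \<rho> w S r}"

lemma run_game_step:
  "\<not> {1..N} \<subseteq> S \<Longrightarrow> run_game N \<rho> w S r = run_game N \<rho> w (S \<union> next_players N \<rho> w S r)
    (\<lambda>j. if j \<in> next_players N \<rho> w S r then next_time N \<rho> w S r else r j)"
  unfolding next_players_def next_time_def by (subst run_game.simps) (simp only: Let_def if_False)

lemma run_game_all: "{1..N} \<subseteq> S \<Longrightarrow> run_game N \<rho> w S r = r"
  by (subst run_game.simps) simp

lemma next_time_le: "i \<in> {1..N} - S \<Longrightarrow> next_time N \<rho> w S r \<le> \<rho> i S (restrict r S) w"
  unfolding next_time_def by (intro Min_le) auto

lemma next_players_nonempty: "\<not> {1..N} \<subseteq> S \<Longrightarrow> \<exists>i. i \<in> next_players N \<rho> w S r"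
proof -
  assume "\<not> {1..N} \<subseteq> S"
  then have "next_time N \<rho> w S r \<in> (\<lambda>i. \<rho> i S (restrict r S) w) ` ({1..N} - S)"
    unfolding next_time_def by (intro Min_in) auto
  then show ?thesis by (auto simp: next_players_def)
qed

lemma next_players_subset: "next_players N \<rho> w S r \<subseteq> {1..N} - S"
  by (auto simp: next_players_def)

text \<open>The states met by a run: a stop at time infinity can only occur when everybody stops.\<close>

definition admissible_state :: "nat \<Rightarrow> nat set \<Rightarrow> (nat \<Rightarrow> ennreal) \<Rightarrow> bool" where
  "admissible_state N S r \<longleftrightarrow> S \<subseteq> {1..N} \<and> (S = {} \<or> S = {1..N} \<or> (\<forall>l\<in>S. r l < \<top>))"

lemma next_time_later:
  assumes "responds_later N \<rho> w" "admissible_state N S r" "\<not> {1..N} \<subseteq> S" "l \<in> S"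
  shows "r l < next_time N \<rho> w S r"
proof -
  obtain i where i: "i \<in> next_players N \<rho> w S r"
    using next_players_nonempty[OF assms(3), of \<rho> w r] by blast
  have fin: "finite S" "\<forall>l\<in>S. r l < \<top>" "S \<subseteq> {1..N}"
    using assms(2-4) finite_subset[of S "{1..N}"] by (auto simp: admissible_state_def)
  then have "Max (restrict r S ` S) < \<top>"
    using assms(4) by (subst Max_less_iff) auto
  then have "Max (restrict r S ` S) < \<rho> i S (restrict r S) w"
    using assms(4) i fin unfolding next_players_def by (intro responds_laterD[OF assms(1)]) auto
  moreover have "r l \<le> Max (restrict r S ` S)"
    using assms(4) fin by (intro Max_ge) (auto intro!: image_eqI[of _ _ l])
  ultimately show ?thesis
    using i by (auto simp: next_players_def)
qed

lemma admissible_state_step: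
  assumes "admissible_state N S r" "\<not> {1..N} \<subseteq> S"
  shows "admissible_state N (S \<union> next_players N \<rho> w S r)
    (\<lambda>j. if j \<in> next_players N \<rho> w S r then next_time N \<rho> w S r else r j)"
proof (cases "next_time N \<rho> w S r = \<top>")
  case True
  then have "next_players N \<rho> w S r = {1..N} - S"
    using next_time_le[of _ N S \<rho> w r] by (auto simp: next_players_def top_unique)
  then show ?thesis
    using assms by (auto simp: admissible_state_def)
next
  case False
  then show ?thesis
    using assms next_players_subset[of N \<rho> w S r] by (auto simp: admissible_state_def less_top)
qed

text \<open>Stop times strictly increase from step to step. Therefore the players who stop before a given time \<open>s\<close> form one
  of the sets that the run passes through, and what the others plan at that moment decides who stops at \<open>s\<close>.
  This describes the outcome without reference to the recursion.\<close>

theorem run_game_stages: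
  assumes "responds_later N \<rho> w" "admissible_state N S r"
  defines "R \<equiv> run_game N \<rho> w S r"
  shows "\<And>l. l \<in> S \<Longrightarrow> R l = r l"
    and "\<And>l. l \<in> {1..N} - S \<Longrightarrow> next_time N \<rho> w S r \<le> R l"
    and "\<And>s j. S \<subseteq> {l\<in>{1..N}. R l < s} \<Longrightarrow> j \<in> {1..N} \<Longrightarrow> s \<le> R j \<Longrightarrow>
      s \<le> \<rho> j {l\<in>{1..N}. R l < s} (restrict R {l\<in>{1..N}. R l < s}) w \<and>
      (\<rho> j {l\<in>{1..N}. R l < s} (restrict R {l\<in>{1..N}. R l < s}) w = s \<longleftrightarrow> R j = s)"
proof -
  let ?claim = "\<lambda>S r R. (\<forall>l\<in>S. R l = r l) \<and> (\<forall>l\<in>{1..N} - S. next_time N \<rho> w S r \<le> R l) \<and>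
    (\<forall>s. \<forall>j\<in>{1..N}. S \<subseteq> {l\<in>{1..N}. R l < s} \<longrightarrow> s \<le> R j \<longrightarrow>
      s \<le> \<rho> j {l\<in>{1..N}. R l < s} (restrict R {l\<in>{1..N}. R l < s}) w \<and>
      (\<rho> j {l\<in>{1..N}. R l < s} (restrict R {l\<in>{1..N}. R l < s}) w = s \<longleftrightarrow> R j = s))"
  have "?claim S r (run_game N \<rho> w S r)"
    using assms(2)
  proof (induction "card ({1..N} - S)" arbitrary: S r rule: less_induct)
    case less
    show ?case
    proof (cases "{1..N} \<subseteq> S")
      case True
      then show ?thesis
        using less.prems by (auto simp: run_game_all admissible_state_def)
    next
      case False
      define m where "m = next_time N \<rho> w S r"
      define J where "J = next_players N \<rho> w S r"
      define r' where "r' = (\<lambda>j. if j \<in> J then m else r j)"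
      define R where "R = run_game N \<rho> w S r"
      have R: "R = run_game N \<rho> w (S \<union> J) r'"
        unfolding R_def r'_def J_def m_def by (rule run_game_step[OF False])
      have J: "J \<subseteq> {1..N} - S" "J \<noteq> {}"
        using next_players_subset[of N \<rho> w S r] next_players_nonempty[OF False, of \<rho> w r] unfolding J_def by blast+
      have S: "S \<subseteq> {1..N}" using less.prems by (simp add: admissible_state_def)
      have adm: "admissible_state N (S \<union> J) r'"
        unfolding J_def r'_def m_def by (rule admissible_state_step[OF less.prems False])
      have "card ({1..N} - (S \<union> J)) < card ({1..N} - S)"
        using J by (intro psubset_card_mono) auto
      from less.hyps[OF this adm] have IH: "?claim (S \<union> J) r' R"
        unfolding R .
      have R_old: "R l = r l" if "l \<in> S" for l
        using IH that J by (auto simp: r'_def)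
      have R_J: "R l = m" if "l \<in> J" for l
        using IH that by (auto simp: r'_def)
      have R_later: "m < R l" if l: "l \<in> {1..N} - (S \<union> J)" for l
      proof -
        obtain i where i: "i \<in> J" using J by blast
        have "r' i < next_time N \<rho> w (S \<union> J) r'"
          using l i by (intro next_time_later[OF assms(1) adm]) auto
        then show ?thesis
          using IH l i by (auto simp: r'_def intro: less_le_trans)
      qed
      have R_ge: "m \<le> R l" if "l \<in> {1..N} - S" for l
        using R_J[of l] R_later[of l] that by (cases "l \<in> J") auto
      have "s \<le> \<rho> j D (restrict R D) w \<and> (\<rho> j D (restrict R D) w = s \<longleftrightarrow> R j = s)"
        if D: "D = {l\<in>{1..N}. R l < s}" and sub: "S \<subseteq> D" and j: "j \<in> {1..N}" "s \<le> R j" for s j D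
      proof (cases "s \<le> m")
        case True
        have "D = S"
        proof (rule subset_antisym[OF _ sub])
          show "D \<subseteq> S"
          proof
            fix l assume "l \<in> D"
            then show "l \<in> S"
              using R_ge[of l] True unfolding D by (cases "l \<in> S") auto
          qed
        qed
        have D_eq: "restrict R S = restrict r S"
          using R_old by (auto simp: restrict_def)
        have jS: "j \<in> {1..N} - S" using j D \<open>D = S\<close> by auto
        have "m \<le> \<rho> j S (restrict r S) w"
          unfolding m_def using jS by (rule next_time_le)
        moreover have "R j = m \<longleftrightarrow> \<rho> j S (restrict r S) w = m"
        proof -
          have "j \<in> J \<longleftrightarrow> \<rho> j S (restrict r S) w = m"
            using jS by (simp add: J_def next_players_def m_def)
          then show ?thesis using R_J[of j] R_later[of j] jS by (cases "j \<in> J") auto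
        qed
        moreover have "m \<le> R j" using R_ge[OF jS] .
        ultimately show ?thesis
          unfolding \<open>D = S\<close> D_eq using True by auto
      next
        case False
        then have "S \<union> J \<subseteq> D"
          using sub R_J J unfolding D by auto
        then show ?thesis using IH j unfolding D by blast
      qed
      then show ?thesis
        using R_old R_ge unfolding R_def[symmetric] m_def by blast
    qed
  qed
  then show "\<And>l. l \<in> S \<Longrightarrow> R l = r l"
    and "\<And>l. l \<in> {1..N} - S \<Longrightarrow> next_time N \<rho> w S r \<le> R l"
    and "\<And>s j. S \<subseteq> {l\<in>{1..N}. R l < s} \<Longrightarrow> j \<in> {1..N} \<Longrightarrow> s \<le> R j \<Longrightarrow>
      s \<le> \<rho> j {l\<in>{1..N}. R l < s} (restrict R {l\<in>{1..N}. R l < s}) w \<and>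
      (\<rho> j {l\<in>{1..N}. R l < s} (restrict R {l\<in>{1..N}. R l < s}) w = s \<longleftrightarrow> R j = s)"
    unfolding R_def by blast+
qed

text \<open>As long as the next stop is not later than \<open>T\<close>, the plans agree in all that decides who stops next and when, so the
  two runs take the same steps.\<close>

theorem run_game_nonanticipating:
  assumes later: "responds_later N \<rho> w" "responds_later N \<rho> w'"
    and agree: "\<And>i S t. i \<in> {1..N} - S \<Longrightarrow> S \<subseteq> {1..N} \<Longrightarrow> t \<in> S \<rightarrow>\<^sub>E UNIV \<Longrightarrow> \<rho> i S t w \<le> T \<or> \<rho> i S t w' \<le> T \<Longrightarrow>
      \<rho> i S t w' = \<rho> i S t w"
    and "admissible_state N S r" "l \<in> {1..N}" "run_game N \<rho> w S r l \<le> T"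
  shows "run_game N \<rho> w' S r l = run_game N \<rho> w S r l"
  using assms(4-6)
proof (induction "card ({1..N} - S)" arbitrary: S r rule: less_induct)
  case less
  show ?case
  proof (cases "l \<in> S")
    case True
    then show ?thesis
      using run_game_stages(1)[OF later(1) less.prems(1)] run_game_stages(1)[OF later(2) less.prems(1)] by simp
  next
    case l: False
    then have not_all: "\<not> {1..N} \<subseteq> S" using less.prems by auto
    have S: "S \<subseteq> {1..N}" using less.prems by (simp add: admissible_state_def)
    have agree': "\<rho> i S (restrict r S) w' = \<rho> i S (restrict r S) w"
      if "i \<in> {1..N} - S" "\<rho> i S (restrict r S) w \<le> T \<or> \<rho> i S (restrict r S) w' \<le> T" for i
      using that S by (intro agree) auto
    define m where "m = next_time N \<rho> w S r"
    define m' where "m' = next_time N \<rho> w' S r"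
    have m: "m \<le> T"
      using run_game_stages(2)[OF later(1) less.prems(1), of l] l less.prems unfolding m_def by simp
    obtain i where i: "i \<in> {1..N} - S" "\<rho> i S (restrict r S) w = m"
      using next_players_nonempty[OF not_all, of \<rho> w r] by (auto simp: next_players_def m_def)
    obtain i' where i': "i' \<in> {1..N} - S" "\<rho> i' S (restrict r S) w' = m'"
      using next_players_nonempty[OF not_all, of \<rho> w' r] by (auto simp: next_players_def m'_def)
    have "m' \<le> m"
      using agree'[OF i(1)] i m next_time_le[OF i(1), of \<rho> w' r] unfolding m'_def by simp
    moreover have "m \<le> m'"
      using agree'[OF i'(1)] i' order_trans[OF \<open>m' \<le> m\<close> m] next_time_le[OF i'(1), of \<rho> w r] unfolding m_def by simp
    ultimately have eq: "m' = m" by simp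
    define J where "J = next_players N \<rho> w S r"
    have "\<rho> j S (restrict r S) w' = m \<longleftrightarrow> \<rho> j S (restrict r S) w = m" if "j \<in> {1..N} - S" for j
      using agree'[OF that] m by auto
    then have J: "next_players N \<rho> w' S r = J"
      using eq unfolding J_def next_players_def m_def m'_def by auto
    define r' where "r' = (\<lambda>j. if j \<in> J then m else r j)"
    have run: "run_game N \<rho> w S r = run_game N \<rho> w (S \<union> J) r'"
      "run_game N \<rho> w' S r = run_game N \<rho> w' (S \<union> J) r'"
      using run_game_step[OF not_all, of \<rho> w r] run_game_step[OF not_all, of \<rho> w' r] J eq
      unfolding r'_def J_def m_def m'_def by (simp_all cong: if_cong)
    have "card ({1..N} - (S \<union> J)) < card ({1..N} - S)"
      using next_players_nonempty[OF not_all, of \<rho> w r] next_players_subset[of N \<rho> w S r] unfolding J_def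
      by (intro psubset_card_mono) blast+
    moreover have "admissible_state N (S \<union> J) r'"
      unfolding J_def r'_def m_def by (rule admissible_state_step[OF less.prems(1) not_all])
    ultimately show ?thesis
      using less.prems unfolding run by (intro less.hyps) auto
  qed
qed

section \<open>Rounding to the grid of turns\<close>

definition turn :: "nat \<Rightarrow> nat \<Rightarrow> nat" where
  "turn N k = Suc (k mod N)"

definition grid_time :: "real \<Rightarrow> enat \<Rightarrow> ennreal" where
  "grid_time h k = (case k of enat k \<Rightarrow> ennreal (real k * h) | \<infinity> \<Rightarrow> \<top>)"

definition round_up :: "nat \<Rightarrow> real \<Rightarrow> nat \<Rightarrow> ennreal \<Rightarrow> enat" where
  "round_up N h l t = hit (\<lambda>k. turn N k = l \<and> t \<le> grid_time h (enat k))"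

lemma grid_time_infinity [simp]: "grid_time h \<infinity> = \<top>"
  by (simp add: grid_time_def)

lemma grid_time_less_top [simp]: "grid_time h (enat k) < \<top>"
  by (simp add: grid_time_def)

lemma grid_time_mono_iff: "0 < h \<Longrightarrow> grid_time h k \<le> grid_time h l \<longleftrightarrow> k \<le> l"
  by (cases k; cases l) (auto simp: grid_time_def top_unique)

lemma grid_time_less_iff: "0 < h \<Longrightarrow> grid_time h k < grid_time h l \<longleftrightarrow> k < l"
  using grid_time_mono_iff[of h l k] by (simp add: not_le[symmetric])

lemma round_up_top [simp]: "round_up N h l \<top> = \<infinity>"
  by (simp add: round_up_def hit_eq_infinity_iff not_le)

lemma round_up_ge:
  assumes "0 < h" "grid_time h (enat k) \<le> t"
  shows "enat k \<le> round_up N h l t"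
proof (cases "round_up N h l t")
  case (enat n)
  then have "grid_time h (enat k) \<le> grid_time h (enat n)"
    using assms(2) by (auto simp: round_up_def hit_eq_enat_iff)
  then show ?thesis using enat assms(1) by (simp add: grid_time_mono_iff)
qed simp

lemma round_up_grid_time:
  assumes "0 < h" "turn N k = l"
  shows "round_up N h l (grid_time h (enat k)) = enat k"
  using assms by (simp add: round_up_def hit_eq_enat_iff grid_time_mono_iff)

text \<open>Each player has one turn in any \<open>N\<close> consecutive ones, so rounding shifts a finite time by at most \<open>N h\<close>.\<close>

lemma round_up_approx:
  assumes h: "0 < h" and l: "l \<in> {1..N}" and t: "t < \<top>"
  obtains k where "round_up N h l t = enat k" "turn N k = l" "t \<le> grid_time h (enat k)"
    "grid_time h (enat k) \<le> t + ennreal (real N * h)"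
proof -
  obtain n :: nat where n: "enn2real t \<le> real n * h"
    using h by (metis reals_Archimedean3 less_imp_le)
  define k' where "k' = n * N + (l - 1)"
  have N: "1 \<le> N" using l by simp
  have "turn N k' = l"
    using l by (cases l) (simp_all add: turn_def k'_def)
  moreover have "t \<le> grid_time h (enat k')"
  proof -
    have "n * 1 \<le> k'" unfolding k'_def using N by (intro trans_le_add1 mult_le_mono2)
    then have "enn2real t \<le> real k' * h"
      using n h by (auto intro: order_trans[OF n] mult_right_mono)
    then have "ennreal (enn2real t) \<le> ennreal (real k' * h)" by (rule ennreal_leI)
    then show ?thesis using t by (simp add: grid_time_def)
  qed
  ultimately obtain k where k: "round_up N h l t = enat k"
    unfolding round_up_def using hit_eq_infinity_iff[of "\<lambda>k. turn N k = l \<and> t \<le> grid_time h (enat k)"]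
    by (cases "hit (\<lambda>k. turn N k = l \<and> t \<le> grid_time h (enat k))") auto
  then have turn: "turn N k = l" and le: "t \<le> grid_time h (enat k)"
    and least: "\<And>k'. k' < k \<Longrightarrow> turn N k' = l \<Longrightarrow> grid_time h (enat k') < t"
    by (auto simp: round_up_def hit_eq_enat_iff)
  have "grid_time h (enat k) \<le> t + ennreal (real N * h)"
  proof (cases "N \<le> k")
    case True
    then have "turn N (k - N) = l"
      using turn by (simp add: turn_def le_mod_geq)
    then have "grid_time h (enat (k - N)) < t"
      using True N by (intro least) auto
    then have "grid_time h (enat (k - N)) + ennreal (real N * h) \<le> t + ennreal (real N * h)"
      by (intro add_mono) auto
    moreover have "grid_time h (enat (k - N)) + ennreal (real N * h) = grid_time h (enat k)"
      using True h by (simp add: grid_time_def ennreal_plus[symmetric] of_nat_diff algebra_simps del: ennreal_plus)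
    ultimately show ?thesis by simp
  next
    case False
    then have "grid_time h (enat k) \<le> ennreal (real N * h)"
      unfolding grid_time_def using h by (auto intro!: ennreal_leI mult_right_mono)
    then show ?thesis by (simp add: add_increasing)
  qed
  then show ?thesis using that k turn le by blast
qed

definition visible :: "nat \<Rightarrow> (nat \<Rightarrow> enat) \<Rightarrow> nat \<Rightarrow> enat" where
  "visible k x = (\<lambda>l. if x l < enat k then x l else \<infinity>)"

text \<open>Plans made after a stop concern the turns following it.\<close>

definition start :: "nat \<Rightarrow> nat \<Rightarrow> (nat \<Rightarrow> enat) \<Rightarrow> nat" where
  "start N k0 y = (if remaining N y = {1..N} then k0 else Suc (Max {k. \<exists>l\<in>{1..N}. y l = enat k}))"

definition planned :: "nat \<Rightarrow> ((nat \<Rightarrow> enat) \<times> nat \<Rightarrow> nat \<Rightarrow> enat) \<Rightarrow> nat \<Rightarrow> (nat \<Rightarrow> enat) \<Rightarrow> nat \<Rightarrow> nat \<Rightarrow> bool" where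
  "planned N c k0 x j k \<longleftrightarrow> turn N k = j \<and> k0 \<le> k \<and> c (visible k x, start N k0 (visible k x)) j = enat k"

text \<open>An outcome \<open>x\<close> is the play of the plans \<open>c\<close> against a stop of \<open>i\<close> at \<open>x i\<close> as soon as everybody else stops at the
  first turn that the own plan, evaluated at the visible part of \<open>x\<close>, prescribes. Indeed, the visible history
  does not change between two stops, so the next stop in \<open>x\<close> is the earliest turn planned at the last one.\<close>

theorem play_eqI:
  assumes x_out: "\<And>l. l \<notin> {1..N} \<Longrightarrow> x l = \<infinity>"
    and x_turn: "\<And>l k. x l = enat k \<Longrightarrow> turn N k = l \<and> k0 \<le> k"
    and others: "\<And>j. j \<in> {1..N} \<Longrightarrow> j \<noteq> i \<Longrightarrow> x j = hit (planned N c k0 x j)"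
    and c: "\<And>y n j k. j \<in> remaining N y \<Longrightarrow> c (y, n) j = enat k \<Longrightarrow> turn N k = j \<and> n \<le> k"
  shows "play N (turn N) (\<lambda>s j. if j = i then x i else c s j) (\<lambda>_. \<infinity>, k0) = x"
proof -
  define c' where "c' s j = (if j = i then x i else c s j)" for s j
  have main: "play N (turn N) c' (visible n x, n) = x" if "start N k0 (visible n x) = n" "k0 \<le> n" for n
    using that
  proof (induction "card (remaining N (visible n x))" arbitrary: n rule: less_induct)
    case less
    define y where "y = visible n x"
    define A where "A = remaining N y"
    have A_iff: "l \<in> A \<longleftrightarrow> l \<in> {1..N} \<and> enat n \<le> x l" for l
      by (auto simp: A_def y_def remaining_def visible_def)
    define m where "m = (INF j\<in>A. c' (y, n) j)"
    define m' where "m' = (INF j\<in>A. x j)"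
    have visible_eq: "visible k x = y" if "n \<le> k" "enat k \<le> m'" for k
    proof
      fix l
      show "visible k x l = y l"
      proof (cases "l \<in> A")
        case True
        then have "enat k \<le> x l" using that INF_lower[OF True, of x] by (auto simp: m'_def)
        then show ?thesis using True by (auto simp: A_iff y_def visible_def)
      next
        case False
        have "x l = \<infinity> \<or> x l < enat n" using False x_out by (auto simp: A_iff not_le)
        moreover have "x l < enat n \<Longrightarrow> x l < enat k"
          using that(1) by (meson enat_ord_simps(1) less_le_trans)
        ultimately show ?thesis by (auto simp: y_def visible_def)
      qed
    qed
    have planned_iff: "planned N c k0 x j k \<longleftrightarrow> c (y, n) j = enat k"
      if "n \<le> k" "enat k \<le> m'" "j \<in> A" for j k
      using visible_eq[OF that(1,2)] less.prems that c[of j y n k] by (auto simp: planned_def y_def A_def)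
    have "m = m'"
    proof (rule antisym)
      show "m \<le> m'"
      proof (cases m')
        case (enat k)
        then obtain l where l: "l \<in> A" "x l = enat k"
          unfolding m'_def INF_enat_eq_iff by blast
        have "c' (y, n) l = enat k"
        proof (cases "l = i")
          case False
          then have "planned N c k0 x l k"
            using others[of l] l hit_eq_enat_iff[of "planned N c k0 x l" k] by (simp add: A_iff)
          then show ?thesis
            using planned_iff[of k l] l enat False by (auto simp: A_iff c'_def)
        qed (use l in \<open>simp add: c'_def\<close>)
        then show ?thesis using INF_lower[OF l(1), of "c' (y, n)"] enat by (simp add: m_def)
      qed simp
      show "m' \<le> m"
      proof (cases m)
        case (enat k)
        then obtain j where j: "j \<in> A" "c' (y, n) j = enat k"
          unfolding m_def INF_enat_eq_iff by blast
        show ?thesis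
        proof (rule ccontr)
          assume "\<not> m' \<le> m"
          then have k: "enat k < m'" using enat by simp
          have "x j \<le> enat k"
          proof (cases "j = i")
            case False
            then have "c (y, n) j = enat k" using j by (simp add: c'_def)
            moreover from this have "n \<le> k" using c[of j y n k] j by (simp add: A_def)
            ultimately have "planned N c k0 x j k"
              using planned_iff[of k j] j k by simp
            then have "\<not> enat k < hit (planned N c k0 x j)"
              using not_before_hit by blast
            moreover have "x j = hit (planned N c k0 x j)"
              using j False by (intro others) (auto simp: A_iff)
            ultimately show ?thesis by simp
          qed (use j in \<open>simp add: c'_def\<close>)
          then show False using k INF_lower[OF j(1), of x] by (simp add: m'_def)
        qed
      qed simp
    qed
    have play: "play N (turn N) c' (y, n) = play_from N (turn N) c' y m"
      unfolding m_def A_def by (rule play_eq)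
    show ?case
    proof (cases m)
      case infinity
      then have "x l = \<infinity>" if "l \<in> A" for l
        using \<open>m = m'\<close> that unfolding m'_def by (metis INF_enat_eq_infinity_iff)
      then have "y = x"
      proof -
        have "x l = \<infinity>" if "\<not> x l < enat n" for l
          using that x_out[of l] \<open>\<And>l. l \<in> A \<Longrightarrow> x l = \<infinity>\<close>[of l] by (cases "l \<in> {1..N}") (auto simp: A_iff)
        then show ?thesis unfolding y_def visible_def by (intro ext) metis
      qed
      then show ?thesis using play infinity unfolding y_def by (simp add: play_from_def)
    next
      case (enat k)
      then have k: "m' = enat k" using \<open>m = m'\<close> by simp
      then obtain l where l: "l \<in> A" "x l = enat k"
        unfolding m'_def INF_enat_eq_iff by blast
      have turn: "turn N k = l" using x_turn[OF l(2)] by simp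
      have "n \<le> k" using l by (simp add: A_iff)
      have y': "y(l := enat k) = visible (Suc k) x"
      proof
        fix j
        show "(y(l := enat k)) j = visible (Suc k) x j"
        proof (cases "j = l")
          case False
          then have "x j \<noteq> enat k" using x_turn[of j k] turn by auto
          then have "x j < enat (Suc k) \<longleftrightarrow> x j < enat k" by (cases "x j") auto
          moreover have "visible k x = y" by (rule visible_eq) (use \<open>n \<le> k\<close> k in auto)
          ultimately show ?thesis using False by (auto simp: visible_def)
        qed (use l in \<open>simp add: visible_def\<close>)
      qed
      have "start N k0 (visible (Suc k) x) = Suc k"
      proof -
        have "l \<in> {1..N}" using l by (simp add: A_iff)
        moreover have "{k'. \<exists>l\<in>{1..N}. visible (Suc k) x l = enat k'} \<subseteq> {..k}"
          by (auto simp: visible_def split: if_splits)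
        moreover have "visible (Suc k) x l = enat k" using l by (simp add: visible_def)
        ultimately have "Max {k'. \<exists>l\<in>{1..N}. visible (Suc k) x l = enat k'} = k"
          by (intro Max_eqI) (auto intro: finite_subset)
        moreover have "l \<notin> remaining N (visible (Suc k) x)"
          using \<open>visible (Suc k) x l = enat k\<close> by (simp add: remaining_def)
        then have "remaining N (visible (Suc k) x) \<noteq> {1..N}"
          using \<open>l \<in> {1..N}\<close> by blast
        ultimately show ?thesis by (simp add: start_def)
      qed
      moreover have "card (remaining N (visible (Suc k) x)) < card (remaining N (visible n x))"
        unfolding y'[symmetric] y_def[symmetric]
        by (rule card_remaining_upd_less) (use l in \<open>simp add: A_def\<close>)
      ultimately have "play N (turn N) c' (visible (Suc k) x, Suc k) = x"
        using less.prems \<open>n \<le> k\<close> by (intro less.hyps) auto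
      moreover have "play N (turn N) c' (y, n) = play N (turn N) c' (visible (Suc k) x, Suc k)"
        unfolding play enat play_from_def using l turn y' by (simp add: A_def)
      ultimately show ?thesis by (simp add: y_def)
    qed
  qed
  have visible: "visible k0 x = (\<lambda>_. \<infinity>)"
  proof
    fix l
    show "visible k0 x l = \<infinity>"
      using x_turn[of l] by (cases "x l") (auto simp: visible_def)
  qed
  have "start N k0 (\<lambda>_. \<infinity>) = k0"
    by (auto simp: start_def remaining_def)
  then show ?thesis
    using main[of k0] unfolding visible c'_def by simp
qed

definition first_turn :: "real \<Rightarrow> ennreal \<Rightarrow> nat" where
  "first_turn h \<theta> = (LEAST k. \<theta> \<le> grid_time h (enat k))"

lemma first_turn_le_iff:
  assumes "0 < h" "\<theta> < \<top>"
  shows "first_turn h \<theta> \<le> k \<longleftrightarrow> \<theta> \<le> grid_time h (enat k)"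
proof -
  obtain n :: nat where "enn2real \<theta> \<le> real n * h"
    using assms(1) by (metis reals_Archimedean3 less_imp_le)
  then have "ennreal (enn2real \<theta>) \<le> ennreal (real n * h)" by (rule ennreal_leI)
  then have "\<theta> \<le> grid_time h (enat n)" using assms(2) by (simp add: grid_time_def)
  then have *: "\<theta> \<le> grid_time h (enat (first_turn h \<theta>))" unfolding first_turn_def by (rule LeastI)
  show ?thesis
  proof
    assume "first_turn h \<theta> \<le> k"
    then have "grid_time h (enat (first_turn h \<theta>)) \<le> grid_time h (enat k)"
      using assms(1) by (simp add: grid_time_mono_iff)
    then show "\<theta> \<le> grid_time h (enat k)" using * by simp
  qed (auto simp: first_turn_def intro: Least_le)
qed

text \<open>The turn at which player \<open>j\<close> intends to stop after observing stops of the players in \<open>S\<close> at the times \<open>t\<close>. Stops are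
  rounded up to turns, and a stop whose rounded turn has not come yet is ignored: this makes the actual run follow
  a play of the discrete game.\<close>

definition grid_response ::
  "nat \<Rightarrow> real \<Rightarrow> ((nat \<Rightarrow> enat) \<times> nat \<Rightarrow> nat \<Rightarrow> enat) \<Rightarrow> ennreal \<Rightarrow> nat \<Rightarrow> nat set \<Rightarrow> (nat \<Rightarrow> ennreal) \<Rightarrow> enat" where
  "grid_response N h c \<theta> j S t = hit (\<lambda>k. \<theta> \<le> grid_time h (enat k) \<and> (\<forall>l\<in>S. t l < grid_time h (enat k)) \<and>
    planned N c (first_turn h \<theta>) (\<lambda>l. if l \<in> S then round_up N h l (t l) else \<infinity>) j k)"

text \<open>At time \<open>k h\<close> the players who have stopped include all those whose rounded stop comes before turn \<open>k\<close>, so the visible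
  history read off from the true stops is that of the rounded outcome \<open>x\<close>. By \<open>run_game_stages\<close>, the others hence stop
  exactly when the discrete plans tell them to after the history given by \<open>x\<close>, as required in \<open>play_eqI\<close>.\<close>

theorem run_game_grid:
  assumes h: "0 < h" and \<theta>: "\<theta> < \<top>" and later: "responds_later N \<rho> w"
    and c: "\<And>y n j k. j \<in> remaining N y \<Longrightarrow> c (y, n) j = enat k \<Longrightarrow> turn N k = j \<and> n \<le> k"
    and others: "\<And>j S t. j \<in> {1..N} \<Longrightarrow> j \<noteq> i \<Longrightarrow> \<rho> j S t w = grid_time h (grid_response N h c \<theta> j S t)"
    and R: "R = run_game N \<rho> w {} (\<lambda>_. undefined)"
    and x: "x = (\<lambda>l. if l \<in> {1..N} then round_up N h l (R l) else \<infinity>)"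
    and R_i: "i \<in> {1..N} \<Longrightarrow> \<theta> \<le> R i"
  shows "play N (turn N) (\<lambda>s j. if j = i then x i else c s j) (\<lambda>_. \<infinity>, first_turn h \<theta>) = x"
    and "\<And>j. j \<in> {1..N} \<Longrightarrow> j \<noteq> i \<Longrightarrow> R j = grid_time h (x j)"
proof -
  let ?k0 = "first_turn h \<theta>"
  have adm: "admissible_state N {} (\<lambda>_. undefined)" by (simp add: admissible_state_def)
  note stages = run_game_stages(3)[OF later adm, folded R]
  have seen: "visible k (\<lambda>l. if l \<in> {l\<in>{1..N}. R l < s} then round_up N h l (restrict R {l\<in>{1..N}. R l < s} l) else \<infinity>) = visible k x"
    if "grid_time h (enat k) \<le> s" for k s
  proof
    fix l
    have "\<not> round_up N h l (R l) < enat k" if "\<not> R l < s"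
      using round_up_ge[OF h, of k "R l" N l] \<open>grid_time h (enat k) \<le> s\<close> that by (simp add: not_less)
    then show "visible k (\<lambda>l. if l \<in> {l\<in>{1..N}. R l < s} then round_up N h l (restrict R {l\<in>{1..N}. R l < s} l) else \<infinity>) l = visible k x l"
      by (auto simp: visible_def x)
  qed
  have early: "\<not> planned N c ?k0 x j k"
    if j: "j \<in> {1..N}" "j \<noteq> i" and k: "grid_time h (enat k) < R j" for j k
  proof
    assume p: "planned N c ?k0 x j k"
    define s where "s = grid_time h (enat k)"
    define D where "D = {l\<in>{1..N}. R l < s}"
    have st: "s \<le> \<rho> j D (restrict R D) w \<and> (\<rho> j D (restrict R D) w = s \<longleftrightarrow> R j = s)"
      unfolding D_def using j k by (intro stages) (auto simp: s_def)
    have \<rho>: "\<rho> j D (restrict R D) w = grid_time h (grid_response N h c \<theta> j D (restrict R D))"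
      using j by (rule others)
    have "\<theta> \<le> s" using p h \<theta> by (simp add: planned_def first_turn_le_iff s_def)
    moreover have "planned N c ?k0 (\<lambda>l. if l \<in> D then round_up N h l (restrict R D l) else \<infinity>) j k"
      using p seen[of k s] unfolding planned_def D_def s_def by simp
    ultimately have "grid_response N h c \<theta> j D (restrict R D) \<le> enat k"
      unfolding grid_response_def
      by (intro leI notI, drule_tac not_before_hit) (auto simp: D_def s_def)
    then have "\<rho> j D (restrict R D) w \<le> s"
      unfolding \<rho> s_def using h by (simp add: grid_time_mono_iff)
    then have "R j = s" using st by (metis order_antisym)
    then show False using k by (simp add: s_def)
  qed
  have at: "\<exists>k. R j = grid_time h (enat k) \<and> planned N c ?k0 x j k"
    if j: "j \<in> {1..N}" "j \<noteq> i" and top: "R j < \<top>" for j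
  proof -
    define D where "D = {l\<in>{1..N}. R l < R j}"
    have "\<rho> j D (restrict R D) w = R j"
      unfolding D_def using stages[of "R j" j] j by simp
    then have R_eq: "R j = grid_time h (grid_response N h c \<theta> j D (restrict R D))"
      using others[OF j] by simp
    then obtain k where k: "grid_response N h c \<theta> j D (restrict R D) = enat k"
      using top by (cases "grid_response N h c \<theta> j D (restrict R D)") auto
    then have "planned N c ?k0 (\<lambda>l. if l \<in> D then round_up N h l (restrict R D l) else \<infinity>) j k"
      unfolding grid_response_def hit_eq_enat_iff by simp
    then have "planned N c ?k0 x j k"
      using seen[of k "R j"] R_eq k unfolding planned_def D_def by simp
    then show ?thesis using R_eq k by auto
  qed
  have x_hit: "x j = hit (planned N c ?k0 x j) \<and> R j = grid_time h (x j)" if j: "j \<in> {1..N}" "j \<noteq> i" for j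
  proof (cases "R j = \<top>")
    case True
    then have "hit (planned N c ?k0 x j) = \<infinity>"
      unfolding hit_eq_infinity_iff using early[OF j] by simp
    then show ?thesis using True j by (simp add: x)
  next
    case False
    then obtain k where k: "R j = grid_time h (enat k)" "planned N c ?k0 x j k"
      using at[OF j] by (auto simp: less_top)
    then have "x j = enat k"
      using j h by (simp add: x round_up_grid_time planned_def)
    moreover have "hit (planned N c ?k0 x j) = enat k"
      unfolding hit_eq_enat_iff using k early[OF j] h by (auto simp: grid_time_less_iff)
    ultimately show ?thesis using k by simp
  qed
  show "\<And>j. j \<in> {1..N} \<Longrightarrow> j \<noteq> i \<Longrightarrow> R j = grid_time h (x j)"
    using x_hit by blast
  show "play N (turn N) (\<lambda>s j. if j = i then x i else c s j) (\<lambda>_. \<infinity>, ?k0) = x"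
  proof (rule play_eqI)
    show "x l = \<infinity>" if "l \<notin> {1..N}" for l
      unfolding x using that by (simp only: if_False)
    show "x j = hit (planned N c ?k0 x j)" if "j \<in> {1..N}" "j \<noteq> i" for j
      using x_hit that by blast
    show "turn N k = l \<and> ?k0 \<le> k" if "x l = enat k" for l k
    proof -
      have l: "l \<in> {1..N}" using that by (auto simp: x split: if_splits)
      then have r: "round_up N h l (R l) = enat k" using that by (simp add: x)
      then have "turn N k = l" "R l \<le> grid_time h (enat k)"
        by (auto simp: round_up_def hit_eq_enat_iff)
      moreover have "?k0 \<le> k"
      proof (cases "l = i")
        case True
        then have "\<theta> \<le> grid_time h (enat k)"
          using R_i l calculation(2) by auto
        then show ?thesis using h \<theta> by (simp add: first_turn_le_iff)
      next
        case False
        then have "planned N c ?k0 x l k"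
          using x_hit[OF l] that hit_eq_enat_iff[of "planned N c ?k0 x l" k] by simp
        then show ?thesis by (simp add: planned_def)
      qed
      ultimately show ?thesis by simp
    qed
  qed (rule c)
qed

section \<open>Atoms on a countable space\<close>

text \<open>The states that no event in \<open>G\<close> distinguishes from \<open>w\<close>. On a countable space, atoms are measurable, and measurability
  of sets and functions amounts to respecting atoms.\<close>

definition atom :: "'a measure \<Rightarrow> 'a \<Rightarrow> 'a set" where
  "atom G w = {w'. \<forall>A\<in>sets G. w \<in> A \<longleftrightarrow> w' \<in> A}"

lemma atom_self: "w \<in> atom G w"
  by (simp add: atom_def)

lemma atom_eq: "w' \<in> atom G w \<Longrightarrow> atom G w' = atom G w"
  by (auto simp: atom_def)

lemma atom_sym: "w' \<in> atom G w \<Longrightarrow> w \<in> atom G w'"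
  by (auto simp: atom_def)

lemma atom_mono: "sets G \<subseteq> sets H \<Longrightarrow> atom H w \<subseteq> atom G w"
  by (auto simp: atom_def)

lemma atomD: "A \<in> sets G \<Longrightarrow> w' \<in> atom G w \<Longrightarrow> w \<in> A \<longleftrightarrow> w' \<in> A"
  by (simp add: atom_def)

lemma atom_subset: "A \<in> sets G \<Longrightarrow> w \<in> A \<Longrightarrow> atom G w \<subseteq> A"
  by (auto simp: atom_def)

lemma atom_space: "w \<in> space G \<Longrightarrow> w' \<in> atom G w \<Longrightarrow> w' \<in> space G"
  by (simp add: atom_def)

lemma sets_atom:
  assumes "countable (space G)" "w \<in> space G"
  shows "atom G w \<in> sets G"
proof -
  have "\<exists>A\<in>sets G. w \<in> A \<and> w' \<notin> A" if "w' \<in> space G - atom G w" for w'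
  proof -
    have "\<exists>A\<in>sets G. w \<in> A \<longleftrightarrow> w' \<notin> A"
      using that unfolding atom_def by blast
    then obtain A where A: "A \<in> sets G" "w \<in> A \<longleftrightarrow> w' \<notin> A" ..
    then have "space G - A \<in> sets G" by auto
    then show ?thesis using A that assms by (cases "w \<in> A") auto
  qed
  then obtain A where A: "\<And>w'. w' \<in> space G - atom G w \<Longrightarrow> A w' \<in> sets G \<and> w \<in> A w' \<and> w' \<notin> A w'"
    by metis
  have "atom G w = space G - (\<Union>w'\<in>space G - atom G w. space G - A w')"
    using A assms(2) by (auto dest: atom_space[OF assms(2)] simp: atom_def)
  also have "\<dots> \<in> sets G"
    using A assms(1) by (intro sets.Diff sets.top sets.countable_UN') auto
  finally show ?thesis .
qed

lemma sets_if_saturated: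
  assumes "countable (space G)" "A \<subseteq> space G" "\<And>w. w \<in> A \<Longrightarrow> atom G w \<subseteq> A"
  shows "A \<in> sets G"
proof -
  have "A = (\<Union>w\<in>A. atom G w)"
    using assms(3) atom_self by fastforce
  also have "\<dots> \<in> sets G"
    using assms countable_subset[OF assms(2,1)]
    by (intro sets.countable_UN') (auto intro: sets_atom)
  finally show ?thesis .
qed

lemma measurable_atom_const:
  fixes f :: "'a \<Rightarrow> 'b::t1_space"
  assumes "f \<in> borel_measurable G" "w \<in> space G" "w' \<in> atom G w"
  shows "f w' = f w"
proof -
  have "f -` {f w} \<inter> space G \<in> sets G"
    using assms(1) by (rule measurable_sets) simp
  then show ?thesis
    using atom_subset[of "f -` {f w} \<inter> space G" G w] assms by auto
qed

lemma measurable_if_atom_const: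
  assumes "countable (space G)" "f \<in> space G \<rightarrow> space H"
    and "\<And>w w'. w \<in> space G \<Longrightarrow> w' \<in> atom G w \<Longrightarrow> f w' = f w"
  shows "f \<in> measurable G H"
proof (rule measurableI)
  show "f -` A \<inter> space G \<in> sets G" for A
    using assms(3) atom_space by (intro sets_if_saturated[OF assms(1)]) fastforce+
qed (use assms(2) in auto)

text \<open>A conditional expectation is constant on the atom and has the same integral over it as the function. The function
  is only assumed to be bounded on the atom, so that the statement covers variables that are not integrable.\<close>

lemma (in prob_space) real_cond_exp_atom:
  assumes G: "subalgebra M G" and countable: "countable (space M)"
    and f [measurable]: "f \<in> borel_measurable M"
    and w: "w \<in> space M" and pos: "0 < measure M (atom G w)"
    and bound: "\<And>w'. w' \<in> atom G w \<Longrightarrow> \<bar>f w'\<bar> \<le> B"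
  shows "real_cond_exp M G f w = (\<integral>x. indicator (atom G w) x * f x \<partial>M) / measure M (atom G w)"
proof -
  let ?C = "atom G w"
  interpret finite_measure_subalgebra M G
    by unfold_locales (rule G)
  have space: "space G = space M" using G by (simp add: subalgebra_def)
  have CG [measurable]: "?C \<in> sets G"
    using countable w by (intro sets_atom) (simp_all add: space)
  then have C [measurable]: "?C \<in> sets M"
    using G by (auto simp: subalgebra_def)
  have int: "integrable M (\<lambda>x. indicator ?C x * f x)"
    using bound by (intro integrable_const_bound[of _ "\<bar>B\<bar>"] AE_I2)
      (auto simp: indicator_def intro: order_trans[OF _ abs_ge_self])
  have nn: "enn2real (nn_cond_exp M G (\<lambda>x. ennreal (g x)) w) =
      enn2real (\<integral>\<^sup>+x. ennreal (indicator ?C x * g x) \<partial>M) / measure M ?C"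
    if [measurable]: "g \<in> borel_measurable M" for g
  proof -
    let ?e = "nn_cond_exp M G (\<lambda>x. ennreal (g x))"
    have const: "?e x = ?e w" if "x \<in> ?C" for x
      using that w by (intro measurable_atom_const[OF borel_measurable_nn_cond_exp]) (simp_all add: space)
    have "?e w * emeasure M ?C = (\<integral>\<^sup>+x. ?e w * indicator ?C x \<partial>M)"
      by (rule nn_integral_cmult_indicator[symmetric]) simp
    also have "\<dots> = (\<integral>\<^sup>+x. indicator ?C x * ?e x \<partial>M)"
      using const by (intro nn_integral_cong) (auto simp: indicator_def)
    also have "\<dots> = (\<integral>\<^sup>+x. indicator ?C x * ennreal (g x) \<partial>M)"
      by (rule nn_cond_exp_intg) simp_all
    also have "\<dots> = (\<integral>\<^sup>+x. ennreal (indicator ?C x * g x) \<partial>M)"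
      by (intro nn_integral_cong) (auto simp: indicator_def)
    finally have "enn2real (?e w) * measure M ?C = enn2real (\<integral>\<^sup>+x. ennreal (indicator ?C x * g x) \<partial>M)"
      by (metis enn2real_mult measure_def)
    then show ?thesis using pos by (simp add: field_simps)
  qed
  have "(\<integral>x. indicator ?C x * f x \<partial>M) =
      enn2real (\<integral>\<^sup>+x. ennreal (indicator ?C x * f x) \<partial>M) - enn2real (\<integral>\<^sup>+x. ennreal (indicator ?C x * - f x) \<partial>M)"
    using real_lebesgue_integral_def[OF int] by simp
  then show ?thesis
    unfolding real_cond_exp_def using nn[OF f] nn[of "\<lambda>x. - f x"] by (simp add: diff_divide_distrib)
qed

context countable_filtered_prob_space
begin

lemma countable_space_F: "countable (space (F t))"
  unfolding space_F by (rule countable_space)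

lemma sets_F_subset: "sets (F t) \<subseteq> sets M"
  unfolding F_top[symmetric] by (rule sets_F_mono) simp

lemma atom_F_mono: "s \<le> t \<Longrightarrow> atom (F t) w \<subseteq> atom (F s) w"
  by (rule atom_mono[OF sets_F_mono])

lemma atom_F_space: "w \<in> space M \<Longrightarrow> w' \<in> atom (F t) w \<Longrightarrow> w' \<in> space M"
  using atom_space[of w "F t" w'] by (simp add: space_F)

text \<open>For stopping times, being adapted is a pathwise property: states that cannot be told apart at time \<open>t\<close> have the same
  value if one of the values is at most \<open>t\<close>.\<close>

lemma stopping_time_nonanticipating:
  assumes \<tau>: "stopping_time F \<tau>" and w: "w \<in> space M" "w' \<in> atom (F t) w"
    and le: "\<tau> w \<le> t \<or> \<tau> w' \<le> t"
  shows "\<tau> w' = \<tau> w"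
proof -
  have *: "\<tau> w' \<le> \<tau> w" if "w \<in> space M" "w' \<in> atom (F t) w" "\<tau> w \<le> t" for w w'
  proof -
    have "{x \<in> space (F (\<tau> w)). \<tau> x \<le> \<tau> w} \<in> sets (F (\<tau> w))"
      using stopping_timeD[OF \<tau>, of "\<tau> w"] by (simp add: pred_def)
    from atom_subset[OF this, of w] show ?thesis
      using that atom_F_mono[OF that(3), of w] by (auto simp: space_F)
  qed
  have w': "w' \<in> space M" "w \<in> atom (F t) w'"
    by (rule atom_F_space[OF w], rule atom_sym[OF w(2)])
  show ?thesis
  proof (cases "\<tau> w \<le> t")
    case True
    then show ?thesis using *[OF w True] *[OF w'] by (meson order_antisym order_trans)
  next
    case False
    then show ?thesis using le *[OF w'] by (meson order_trans)
  qed
qed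

lemma stopping_timeI_nonanticipating:
  assumes "\<And>w w' t. w \<in> space M \<Longrightarrow> w' \<in> atom (F t) w \<Longrightarrow> \<tau> w \<le> t \<Longrightarrow> \<tau> w' \<le> t"
  shows "stopping_time F \<tau>"
proof
  fix t
  have "{x \<in> space (F t). \<tau> x \<le> t} \<in> sets (F t)"
    using assms atom_F_space by (intro sets_if_saturated[OF countable_space_F]) (auto simp: space_F)
  then show "Measurable.pred (F t) (\<lambda>x. \<tau> x \<le> t)"
    by (simp add: pred_def)
qed

lemma subalgebra_pre_sigma:
  assumes "stopping_time F \<theta>"
  shows "subalgebra M (pre_sigma \<theta>)"
proof -
  have "A \<in> sets M" if "A \<in> sets (pre_sigma \<theta>)" for A
  proof -
    have "{w\<in>A. \<theta> w \<le> \<top>} \<in> sets (F \<top>)"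
      using sets_pre_sigmaD[OF assms that] .
    then show ?thesis by (simp add: F_top)
  qed
  then show ?thesis by (auto simp: subalgebra_def space_pre_sigma)
qed

lemma atom_pre_sigma:
  assumes \<theta>: "stopping_time F \<theta>" and w: "w \<in> space M"
  shows "atom (pre_sigma \<theta>) w = atom (F (\<theta> w)) w"
proof
  have \<theta>_const: "\<theta> w' = \<theta> w" if "w' \<in> atom (F (\<theta> w)) w" for w'
    using stopping_time_nonanticipating[OF \<theta> w that] by simp
  have "A \<in> sets (pre_sigma \<theta>)" if A: "A = atom (F (\<theta> w)) w" for A
  proof (rule sets_pre_sigmaI[OF \<theta>])
    fix t
    show "{w'\<in>A. \<theta> w' \<le> t} \<in> sets (F t)"
    proof (cases "\<theta> w \<le> t")
      case True
      then have "{w'\<in>A. \<theta> w' \<le> t} = A" using \<theta>_const A by auto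
      moreover have "A \<in> sets (F (\<theta> w))"
        unfolding A using w by (intro sets_atom countable_space_F) (simp add: space_F)
      ultimately show ?thesis using sets_F_mono[OF True] by auto
    next
      case False
      then have "{w'\<in>A. \<theta> w' \<le> t} = {}" using \<theta>_const A by auto
      then show ?thesis by (simp only: sets.empty_sets)
    qed
  qed
  then show "atom (pre_sigma \<theta>) w \<subseteq> atom (F (\<theta> w)) w"
    by (intro atom_subset atom_self) simp
  show "atom (F (\<theta> w)) w \<subseteq> atom (pre_sigma \<theta>) w"
  proof
    fix w' assume w': "w' \<in> atom (F (\<theta> w)) w"
    have "w \<in> A \<longleftrightarrow> w' \<in> A" if "A \<in> sets (pre_sigma \<theta>)" for A
    proof -
      have "{x\<in>A. \<theta> x \<le> \<theta> w} \<in> sets (F (\<theta> w))"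
        using sets_pre_sigmaD[OF \<theta> that] .
      then have "w \<in> {x\<in>A. \<theta> x \<le> \<theta> w} \<longleftrightarrow> w' \<in> {x\<in>A. \<theta> x \<le> \<theta> w}"
        using w' by (rule atomD)
      then show ?thesis using \<theta>_const[OF w'] by simp
    qed
    then show "w' \<in> atom (pre_sigma \<theta>) w" by (simp add: atom_def)
  qed
qed

text \<open>One point is chosen in each atom. Concentrating the probability of the atoms on these points makes every function
  measurable and does not change the integrals of measurable functions.\<close>

definition rep :: "'a \<Rightarrow> 'a" where
  "rep w = (SOME w'. w' \<in> atom M w)"

lemma rep_atom: "rep w \<in> atom M w"
  unfolding rep_def using atom_self by (rule someI)

lemma rep_eq: "w' \<in> atom M w \<Longrightarrow> rep w' = rep w"
  unfolding rep_def by (simp add: atom_eq)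

lemma rep_space: "w \<in> space M \<Longrightarrow> rep w \<in> space M"
  by (rule atom_space[OF _ rep_atom])

lemma measurable_rep [measurable]: "rep \<in> measurable M (count_space UNIV)"
proof (rule measurable_if_atom_const[OF countable_space])
  show "rep w' = rep w" if "w' \<in> atom M w" for w w'
    using that by (rule rep_eq)
qed simp

definition rep_pmf :: "'a pmf" where
  "rep_pmf = Abs_pmf (distr M (count_space UNIV) rep)"

lemma measure_rep_pmf: "measure_pmf rep_pmf = distr M (count_space UNIV) rep"
  unfolding rep_pmf_def
proof (rule Abs_pmf_inverse, intro CollectI conjI)
  show "prob_space (distr M (count_space UNIV) rep)"
    by (rule prob_space_distr) simp
  have "measure (distr M (count_space UNIV) rep) {rep w} \<noteq> 0" if "w \<in> space M" for w
  proof -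
    have "measure M (rep -` {rep w} \<inter> space M) > 0"
    proof (rule full_support)
      show "rep -` {rep w} \<inter> space M \<in> sets M"
        by (rule measurable_sets[OF measurable_rep]) simp
    qed (use that in auto)
    then show ?thesis by (simp add: measure_distr)
  qed
  then show "AE x in distr M (count_space UNIV) rep. measure (distr M (count_space UNIV) rep) {x} \<noteq> 0"
    by (subst AE_distr_iff) auto
qed simp

lemma integral_rep_pmf:
  fixes f :: "'a \<Rightarrow> real"
  assumes "\<And>w w'. w \<in> space M \<Longrightarrow> w' \<in> atom M w \<Longrightarrow> f w' = f w"
  shows "(\<integral>x. f x \<partial>rep_pmf) = (\<integral>x. f x \<partial>M)"
proof -
  have "(\<integral>x. f x \<partial>rep_pmf) = (\<integral>x. f (rep x) \<partial>M)"
    unfolding measure_rep_pmf by (rule integral_distr) simp_all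
  also have "\<dots> = (\<integral>x. f x \<partial>M)"
    using assms rep_atom by (intro Bochner_Integration.integral_cong) auto
  finally show ?thesis .
qed

end

section \<open>Grid strategies\<close>

lemma grid_time_hit:
  assumes "0 < h"
  shows "grid_time h (hit G) = (INF k. if G k then grid_time h (enat k) else \<top>)"
proof (rule antisym)
  show "grid_time h (hit G) \<le> (INF k. if G k then grid_time h (enat k) else \<top>)"
  proof (rule INF_greatest)
    fix k
    have "hit G \<le> enat k" if "G k"
      using not_before_hit[of k G] that by (auto simp: not_less[symmetric])
    then show "grid_time h (hit G) \<le> (if G k then grid_time h (enat k) else \<top>)"
      using assms by (simp add: grid_time_mono_iff)
  qed
  show "(INF k. if G k then grid_time h (enat k) else \<top>) \<le> grid_time h (hit G)"
  proof (cases "hit G")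
    case (enat k)
    then have "G k" by (simp add: hit_eq_enat_iff)
    then show ?thesis using INF_lower[of k UNIV "\<lambda>k. if G k then grid_time h (enat k) else \<top>"] enat by simp
  qed simp
qed

lemma measurable_round_up: "round_up N h l \<in> measurable borel (count_space UNIV)"
proof -
  have "round_up N h l -` {e} \<inter> space borel \<in> sets borel" for e
  proof (cases e)
    case (enat m)
    have "round_up N h l -` {e} \<inter> space borel =
        {s\<in>space borel. (turn N m = l \<and> s \<le> grid_time h (enat m)) \<and> (\<forall>m'<m. \<not> (turn N m' = l \<and> s \<le> grid_time h (enat m')))}"
      by (auto simp: enat round_up_def hit_eq_enat_iff)
    also have "\<dots> \<in> sets borel" by measurable
    finally show ?thesis .
  next
    case infinity
    have "round_up N h l -` {e} \<inter> space borel =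
        {s\<in>space borel. \<forall>m. \<not> (turn N m = l \<and> s \<le> grid_time h (enat m))}"
      by (auto simp: infinity round_up_def hit_eq_infinity_iff)
    also have "\<dots> \<in> sets borel" by measurable
    finally show ?thesis .
  qed
  then show ?thesis
    by (subst measurable_count_space_eq2_countable) auto
qed

context countable_filtered_prob_space
begin

text \<open>The information available at the turns. The intersection at level \<open>\<infinity>\<close> may be strictly larger than an atom of the
  sigma-algebra at time infinity, since the filtration may jump there.\<close>

definition level :: "real \<Rightarrow> enat \<Rightarrow> 'a \<Rightarrow> 'a set" where
  "level h k w = (case k of enat k \<Rightarrow> atom (F (grid_time h (enat k))) w
    | \<infinity> \<Rightarrow> \<Inter>k. atom (F (grid_time h (enat k))) w)"

lemma level_enat [simp]: "level h (enat k) w = atom (F (grid_time h (enat k))) w"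
  by (simp add: level_def)

lemma info_tree_level:
  assumes "0 < h"
  shows "info_tree (level h)"
proof
  show "w \<in> level h k w" for w k
    by (cases k) (auto simp: level_def atom_self)
  show "level h k w' = level h k w" if "w' \<in> level h k w" for w w' k
    using that by (cases k) (auto simp: level_def dest: atom_eq)
  show "level h l w \<subseteq> level h k w" if kl: "k \<le> l" for k l w
  proof (cases l)
    case (enat l')
    then obtain k' where "k = enat k'" using kl by (cases k) auto
    then show ?thesis using enat kl assms by (simp add: atom_F_mono grid_time_mono_iff)
  next
    case infinity
    then show ?thesis by (cases k) (auto simp: level_def)
  qed
  show "level h \<infinity> w = (\<Inter>k. level h (enat k) w)" for w
    by (simp add: level_def)
qed

lemma atom_subset_level: "atom M w \<subseteq> level h k w"
  using atom_mono[OF sets_F_subset] by (cases k) (force simp: level_def)+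

lemma strategies_stopping_time:
  assumes "\<rho> \<in> strategies M F N i" "S \<subseteq> {1..N} - {i}" "t \<in> S \<rightarrow>\<^sub>E UNIV"
  shows "stopping_time F (\<rho> S t)"
proof (cases "S = {}")
  case True
  then have "t = (\<lambda>_. undefined)" using assms(3) by simp
  then show ?thesis using assms(1) True by (simp add: strategies_def initial_time_def)
next
  case False
  then have "\<rho> S t \<in> stopping_times_after M F (Max (t ` S))"
    using assms unfolding strategies_def by blast
  then show ?thesis by (simp add: stopping_times_after_def)
qed

lemma strategies_respond_later:
  assumes "\<And>i. i \<in> {1..N} \<Longrightarrow> \<rho> i \<in> strategies M F N i" "w \<in> space M"
  shows "responds_later N \<rho> w"
  unfolding responds_later_def
proof (intro allI impI)
  fix S and j and t :: "nat \<Rightarrow> ennreal"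
  assume *: "S \<subseteq> {1..N}" "S \<noteq> {}" "j \<in> {1..N} - S" "t \<in> S \<rightarrow>\<^sub>E UNIV" "Max (t ` S) < \<top>"
  then have "\<rho> j \<in> strategies M F N j" "S \<subseteq> {1..N} - {j}"
    using assms(1) by auto
  then have "\<rho> j S t \<in> stopping_times_after M F (Max (t ` S))"
    using * unfolding strategies_def by blast
  then show "Max (t ` S) < \<rho> j S t w"
    using * assms(2) by (simp add: stopping_times_after_def)
qed

lemma actual_time_nonanticipating:
  assumes \<rho>: "\<And>i. i \<in> {1..N} \<Longrightarrow> \<rho> i \<in> strategies M F N i"
    and w: "w \<in> space M" "w' \<in> atom (F T) w" and l: "l \<in> {1..N}" "actual_time N \<rho> l w \<le> T"
  shows "actual_time N \<rho> l w' = actual_time N \<rho> l w"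
  unfolding actual_time_def
proof (rule run_game_nonanticipating)
  show "responds_later N \<rho> w" "responds_later N \<rho> w'"
    using strategies_respond_later[OF \<rho>] w atom_F_space by blast+
  show "\<rho> i S t w' = \<rho> i S t w"
    if "i \<in> {1..N} - S" "S \<subseteq> {1..N}" "t \<in> S \<rightarrow>\<^sub>E UNIV" "\<rho> i S t w \<le> T \<or> \<rho> i S t w' \<le> T" for i S t
    using that by (intro stopping_time_nonanticipating[OF strategies_stopping_time[OF \<rho>] w]) auto
qed (use l in \<open>auto simp: admissible_state_def actual_time_def\<close>)

lemma actual_time_atom_const:
  assumes "\<And>i. i \<in> {1..N} \<Longrightarrow> \<rho> i \<in> strategies M F N i"
    and "w \<in> space M" "w' \<in> atom M w" "l \<in> {1..N}"
  shows "actual_time N \<rho> l w' = actual_time N \<rho> l w"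
proof (rule actual_time_nonanticipating[OF assms(1,2)])
  show "w' \<in> atom (F \<top>) w" using assms(3) F_top by (simp add: atom_def)
qed (use assms in auto)

lemma actual_time_ge:
  assumes \<rho>: "\<And>i. i \<in> {1..N} \<Longrightarrow> \<rho> i \<in> strategies_from M F N \<theta> i" and w: "w \<in> space M" and l: "l \<in> {1..N}"
  shows "\<theta> w \<le> actual_time N \<rho> l w"
proof -
  have "responds_later N \<rho> w"
    using \<rho> w by (intro strategies_respond_later) (auto simp: strategies_from_def)
  then have "next_time N \<rho> w {} (\<lambda>_. undefined) \<le> actual_time N \<rho> l w"
    unfolding actual_time_def using l by (intro run_game_stages(2)) (auto simp: admissible_state_def)
  moreover have "\<theta> w \<le> next_time N \<rho> w {} (\<lambda>_. undefined)"
    unfolding next_time_def using l \<rho> w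
    by (subst Min_ge_iff) (auto simp: strategies_from_def initial_time_def restrict_def)
  ultimately show ?thesis by (rule order_trans[rotated])
qed

end

text \<open>Fixed plans for the discrete game, to be carried over to the game in continuous time.\<close>

locale grid_profile = countable_filtered_prob_space M F for M :: "'a measure" and F +
  fixes h :: real and N :: nat and \<theta> :: "'a \<Rightarrow> ennreal"
    and P :: "(nat \<Rightarrow> enat) \<times> nat \<Rightarrow> nat \<Rightarrow> 'a \<Rightarrow> enat"
  assumes h: "0 < h" and \<theta>: "stopping_time F \<theta>"
    and P: "\<And>y n j. j \<in> remaining N y \<Longrightarrow> P (y, n) j \<in> info_tree.plans (level h) {k. turn N k = j} n"
begin

sublocale info_tree rep_pmf "level h"
  by (rule info_tree_level[OF h])

definition grid_strategy :: "nat \<Rightarrow> 'a strategy" where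
  "grid_strategy j S t w = grid_time h (grid_response N h (\<lambda>s i. P s i w) (\<theta> w) j S t)"

lemma P_turn: "j \<in> remaining N y \<Longrightarrow> P (y, n) j w = enat k \<Longrightarrow> turn N k = j \<and> n \<le> k"
  using plansD(2,3)[OF P, of j y n w] by fastforce

lemma P_nonanticipating:
  assumes "j \<in> remaining N y" "w' \<in> atom (F (grid_time h (enat k))) w"
  shows "P (y, n) j w' = enat k \<longleftrightarrow> P (y, n) j w = enat k"
proof -
  have *: "P (y, n) j w' = enat k" if "w' \<in> atom (F (grid_time h (enat k))) w" "P (y, n) j w = enat k" for w w'
    using stop_ruleD[OF plansD(1)[OF P[OF assms(1)]], of w' "enat k" w n] that by simp
  show ?thesis using *[OF assms(2)] *[OF atom_sym[OF assms(2)]] by blast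
qed

lemma \<theta>_nonanticipating:
  assumes "w \<in> space M" "w' \<in> atom (F t) w" "\<theta> w \<le> t \<or> \<theta> w' \<le> t"
  shows "\<theta> w' = \<theta> w"
  using stopping_time_nonanticipating[OF \<theta> assms] .

text \<open>Which turns before \<open>k\<close> are chosen depends only on values of plans and of \<open>\<theta>\<close> up to that turn.\<close>

lemma grid_response_nonanticipating:
  assumes j: "j \<in> {1..N}" "j \<notin> S" and w: "w \<in> space M" "w' \<in> atom (F (grid_time h (enat k))) w"
    and k: "grid_response N h (\<lambda>s i. P s i w) (\<theta> w) j S t = enat k"
  shows "grid_response N h (\<lambda>s i. P s i w') (\<theta> w') j S t = enat k"
proof -
  define x where "x = (\<lambda>l. if l \<in> S then round_up N h l (t l) else \<infinity>)"
  define G where "G l w \<longleftrightarrow> \<theta> w \<le> grid_time h (enat l) \<and> (\<forall>i\<in>S. t i < grid_time h (enat l)) \<and>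
    planned N (\<lambda>s i. P s i w) (first_turn h (\<theta> w)) x j l" for l w
  have "G l w' \<longleftrightarrow> G l w" if "l \<le> k" for l
  proof -
    have "grid_time h (enat l) \<le> grid_time h (enat k)" using h that by (simp add: grid_time_mono_iff)
    then have w'l: "w' \<in> atom (F (grid_time h (enat l))) w"
      using w(2) atom_F_mono by blast
    have rem: "j \<in> remaining N (visible l x)" using j by (simp add: remaining_def visible_def x_def)
    show ?thesis
    proof (cases "\<theta> w \<le> grid_time h (enat l) \<or> \<theta> w' \<le> grid_time h (enat l)")
      case True
      then have "\<theta> w' = \<theta> w" by (rule \<theta>_nonanticipating[OF w(1) w'l])
      then show ?thesis
        unfolding G_def planned_def using P_nonanticipating[OF rem w'l] by simp
    qed (simp add: G_def)
  qed
  then show ?thesis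
    using k unfolding grid_response_def x_def[symmetric] G_def[symmetric] hit_eq_enat_iff
    by (metis less_imp_le_nat order_refl)
qed

lemma stopping_time_grid_strategy:
  assumes j: "j \<in> {1..N}" "j \<notin> S"
  shows "stopping_time F (grid_strategy j S t)"
proof (rule stopping_timeI_nonanticipating)
  fix w w' s assume w: "w \<in> space M" "w' \<in> atom (F s) w" "grid_strategy j S t w \<le> s"
  show "grid_strategy j S t w' \<le> s"
  proof (cases "grid_response N h (\<lambda>s i. P s i w) (\<theta> w) j S t")
    case (enat k)
    then have "grid_time h (enat k) \<le> s" using w(3) by (simp add: grid_strategy_def)
    then have "w' \<in> atom (F (grid_time h (enat k))) w" using w(2) atom_F_mono by blast
    from grid_response_nonanticipating[OF j w(1) this enat] show ?thesis
      using w(3) enat by (simp add: grid_strategy_def)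
  next
    case infinity
    then show ?thesis using w(3) by (simp add: grid_strategy_def top_unique)
  qed
qed

text \<open>Only the finitely many possible histories visible at turn \<open>k\<close> matter for the decision at turn \<open>k\<close>, and for each of them
  the event is a product of a condition on the times and one on the state.\<close>

lemma measurable_grid_strategy:
  assumes j: "j \<in> {1..N}" "j \<notin> \<alpha>" and \<alpha>: "finite \<alpha>"
  shows "(\<lambda>(t, w). grid_strategy j \<alpha> t w) \<in> borel_measurable ((\<Pi>\<^sub>M j\<in>\<alpha>. borel) \<Otimes>\<^sub>M M)"
proof -
  define K where "K k t w \<longleftrightarrow> \<theta> w \<le> grid_time h (enat k) \<and> (\<forall>l\<in>\<alpha>. t l < grid_time h (enat k)) \<and>
    planned N (\<lambda>s i. P s i w) (first_turn h (\<theta> w)) (\<lambda>l. if l \<in> \<alpha> then round_up N h l (t l) else \<infinity>) j k"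
    for k t w
  define seen where "seen k l s = (if round_up N h l s < enat k then round_up N h l s else \<infinity>)" for k l s
  define Y where "Y k = (\<lambda>f l. if l \<in> \<alpha> then f l else \<infinity>) ` (\<alpha> \<rightarrow>\<^sub>E insert \<infinity> (enat ` {..<k}))" for k
  define W where "W k y = {w\<in>space M. \<theta> w \<le> grid_time h (enat k) \<and> turn N k = j \<and> first_turn h (\<theta> w) \<le> k \<and>
    P (y, start N (first_turn h (\<theta> w)) y) j w = enat k}" for k y
  have Y: "finite (Y k)" for k
    unfolding Y_def using \<alpha> by (intro finite_imageI finite_PiE) auto
  have W: "W k y \<in> sets M" if "y \<in> Y k" for k y
  proof (rule sets_if_saturated[OF countable_space])
    have rem: "j \<in> remaining N y" using that j by (auto simp: Y_def remaining_def)
    fix w assume w: "w \<in> W k y"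
    show "atom M w \<subseteq> W k y"
    proof
      fix w' assume w': "w' \<in> atom M w"
      then have lev: "w' \<in> atom (F (grid_time h (enat k))) w"
        using atom_subset_level[of w h "enat k"] by auto
      have "\<theta> w' = \<theta> w"
        using w by (intro \<theta>_nonanticipating[OF _ lev]) (auto simp: W_def)
      then show "w' \<in> W k y"
        using w P_nonanticipating[OF rem lev] atom_space[OF _ w'] by (auto simp: W_def)
    qed
  qed (auto simp: W_def)
  \<comment> \<open>\<open>Y k\<close> contains the histories visible at turn \<open>k\<close>.\<close>
  have K_iff: "K k t w \<longleftrightarrow> (\<forall>l\<in>\<alpha>. t l < grid_time h (enat k)) \<and>
      (\<exists>y\<in>Y k. (\<forall>l\<in>\<alpha>. seen k l (t l) = y l) \<and> w \<in> W k y)" if "w \<in> space M" for k t w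
  proof -
    define y where "y = visible k (\<lambda>l. if l \<in> \<alpha> then round_up N h l (t l) else \<infinity>)"
    have y: "y = (\<lambda>l. if l \<in> \<alpha> then seen k l (t l) else \<infinity>)"
      by (auto simp: y_def visible_def seen_def)
    have "y \<in> Y k"
      unfolding Y_def
    proof (rule image_eqI)
      show "y = (\<lambda>l. if l \<in> \<alpha> then (restrict (\<lambda>l. seen k l (t l)) \<alpha>) l else \<infinity>)"
        by (auto simp: y)
      have "seen k l (t l) \<in> insert \<infinity> (enat ` {..<k})" for l
        by (cases "round_up N h l (t l)") (auto simp: seen_def)
      then show "restrict (\<lambda>l. seen k l (t l)) \<alpha> \<in> \<alpha> \<rightarrow>\<^sub>E insert \<infinity> (enat ` {..<k})"
        by auto
    qed
    moreover have "y' = y" if "y' \<in> Y k" "\<forall>l\<in>\<alpha>. seen k l (t l) = y' l" for y'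
      using that by (auto simp: Y_def y)
    moreover have "\<forall>l\<in>\<alpha>. seen k l (t l) = y l"
      by (simp add: y)
    ultimately have "(\<exists>y\<in>Y k. (\<forall>l\<in>\<alpha>. seen k l (t l) = y l) \<and> w \<in> W k y) \<longleftrightarrow> w \<in> W k y"
      by blast
    moreover have "K k t w \<longleftrightarrow> (\<forall>l\<in>\<alpha>. t l < grid_time h (enat k)) \<and> w \<in> W k y"
      using that unfolding K_def W_def planned_def y_def by auto
    ultimately show ?thesis by simp
  qed
  have [measurable]: "seen k l \<in> measurable borel (count_space UNIV)" for k l
    unfolding seen_def using measurable_compose[OF measurable_round_up, of "\<lambda>e. if e < enat k then e else \<infinity>"]
    by simp
  have "Measurable.pred ((\<Pi>\<^sub>M j\<in>\<alpha>. borel) \<Otimes>\<^sub>M M) (\<lambda>z. K k (fst z) (snd z))" for k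
  proof -
    have "Measurable.pred ((\<Pi>\<^sub>M j\<in>\<alpha>. borel) \<Otimes>\<^sub>M M) (\<lambda>z. (\<forall>l\<in>\<alpha>. fst z l < grid_time h (enat k)) \<and>
        (\<exists>y\<in>Y k. (\<forall>l\<in>\<alpha>. seen k l (fst z l) = y l) \<and> snd z \<in> W k y))"
    proof (intro pred_intros_logic pred_intros_finite Y \<alpha>)
      fix l assume l [measurable]: "l \<in> \<alpha>"
      show "Measurable.pred ((\<Pi>\<^sub>M j\<in>\<alpha>. borel) \<Otimes>\<^sub>M M) (\<lambda>z. fst z l < grid_time h (enat k))"
        by measurable
      fix y
      show "Measurable.pred ((\<Pi>\<^sub>M j\<in>\<alpha>. borel) \<Otimes>\<^sub>M M) (\<lambda>z. seen k l (fst z l) = y l)"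
        by measurable
    next
      fix y assume "y \<in> Y k"
      then have [measurable]: "W k y \<in> sets M" by (rule W)
      show "Measurable.pred ((\<Pi>\<^sub>M j\<in>\<alpha>. borel) \<Otimes>\<^sub>M M) (\<lambda>z. snd z \<in> W k y)"
        by measurable
    qed
    then show ?thesis
      by (rule measurable_cong[THEN iffD1, rotated]) (simp add: K_iff space_pair_measure mem_Times_iff)
  qed
  then have "(\<lambda>z. INF k. if K k (fst z) (snd z) then grid_time h (enat k) else \<top>) \<in>
      borel_measurable ((\<Pi>\<^sub>M j\<in>\<alpha>. borel) \<Otimes>\<^sub>M M)"
    by (intro borel_measurable_INF measurable_If measurable_const) auto
  moreover have "grid_strategy j \<alpha> t w = (INF k. if K k t w then grid_time h (enat k) else \<top>)" for t w
    unfolding grid_strategy_def grid_response_def grid_time_hit[OF h] K_def by simp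
  ultimately show ?thesis
    by (simp add: split_beta')
qed

lemma grid_strategy_in_strategies:
  assumes j: "j \<in> {1..N}"
  shows "grid_strategy j \<in> strategies_from M F N \<theta> j"
  unfolding strategies_from_def strategies_def
proof (intro CollectI conjI allI impI ballI)
  show "stopping_time F (initial_time (grid_strategy j))"
    unfolding initial_time_def by (rule stopping_time_grid_strategy[OF j]) simp
  show "\<theta> w \<le> initial_time (grid_strategy j) w" for w
  proof (cases "grid_response N h (\<lambda>s i. P s i w) (\<theta> w) j {} (\<lambda>_. undefined)")
    case (enat k)
    then have "\<theta> w \<le> grid_time h (enat k)"
      unfolding grid_response_def hit_eq_enat_iff by blast
    then show ?thesis using enat by (simp add: initial_time_def grid_strategy_def)
  qed (simp add: initial_time_def grid_strategy_def)
  fix \<alpha> assume \<alpha>: "\<alpha> \<subseteq> {1..N} - {j} \<and> \<alpha> \<noteq> {}"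
  then have fin: "finite \<alpha>" "\<alpha> \<noteq> {}" "j \<notin> \<alpha>" using finite_subset[of \<alpha> "{1..N} - {j}"] by auto
  show "(\<lambda>(t, w). grid_strategy j \<alpha> t w) \<in> borel_measurable ((\<Pi>\<^sub>M j\<in>\<alpha>. borel) \<Otimes>\<^sub>M M)"
    by (rule measurable_grid_strategy[OF j fin(3,1)])
  fix t :: "nat \<Rightarrow> ennreal"
  have "Max (t ` \<alpha>) < grid_strategy j \<alpha> t w" if "Max (t ` \<alpha>) < \<top>" for w
  proof (cases "grid_response N h (\<lambda>s i. P s i w) (\<theta> w) j \<alpha> t")
    case (enat k)
    then have "\<forall>l\<in>\<alpha>. t l < grid_time h (enat k)"
      by (simp add: grid_response_def hit_eq_enat_iff)
    then show ?thesis using fin enat by (simp add: grid_strategy_def)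
  next
    case infinity
    then show ?thesis using that by (simp add: grid_strategy_def)
  qed
  then show "grid_strategy j \<alpha> t \<in> stopping_times_after M F (Max (t ` \<alpha>))"
    using stopping_time_grid_strategy[OF j fin(3)] by (simp add: stopping_times_after_def)
qed

definition rounded_times :: "(nat \<Rightarrow> 'a strategy) \<Rightarrow> 'a \<Rightarrow> nat \<Rightarrow> enat" where
  "rounded_times \<rho> w l = (if l \<in> {1..N} then round_up N h l (actual_time N \<rho> l w) else \<infinity>)"

text \<open>Only player \<open>i\<close> may use a strategy other than the grid strategy. For an index \<open>i\<close> that is not a player, nobody
  deviates.\<close>

theorem actual_time_grid:
  assumes \<rho>: "\<And>i. i \<in> {1..N} \<Longrightarrow> \<rho> i \<in> strategies_from M F N \<theta> i"
    and others: "\<And>j. j \<in> {1..N} \<Longrightarrow> j \<noteq> i \<Longrightarrow> \<rho> j = grid_strategy j"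
    and w: "w \<in> space M" "\<theta> w < \<top>"
  shows "play N (turn N) (\<lambda>s j. if j = i then rounded_times \<rho> w i else P s j w)
      (\<lambda>_. \<infinity>, first_turn h (\<theta> w)) = rounded_times \<rho> w"
    and "\<And>j. j \<in> {1..N} \<Longrightarrow> j \<noteq> i \<Longrightarrow> actual_time N \<rho> j w = grid_time h (rounded_times \<rho> w j)"
proof -
  define R where "R = run_game N \<rho> w {} (\<lambda>_. undefined)"
  have R: "actual_time N \<rho> l w = R l" for l by (simp add: R_def actual_time_def)
  have x: "rounded_times \<rho> w = (\<lambda>l. if l \<in> {1..N} then round_up N h l (R l) else \<infinity>)"
    by (auto simp: rounded_times_def R)
  have later: "responds_later N \<rho> w"
    using \<rho> w by (intro strategies_respond_later) (auto simp: strategies_from_def)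
  have c: "j \<in> remaining N y \<Longrightarrow> P (y, n) j w = enat k \<Longrightarrow> turn N k = j \<and> n \<le> k" for y n j k
    by (rule P_turn)
  have oth: "j \<in> {1..N} \<Longrightarrow> j \<noteq> i \<Longrightarrow> \<rho> j S t w = grid_time h (grid_response N h (\<lambda>s i. P s i w) (\<theta> w) j S t)" for j S t
    using others by (simp add: grid_strategy_def)
  have ge: "i \<in> {1..N} \<Longrightarrow> \<theta> w \<le> R i"
    using actual_time_ge[OF \<rho> w(1), of i] R by simp
  show "play N (turn N) (\<lambda>s j. if j = i then rounded_times \<rho> w i else P s j w)
      (\<lambda>_. \<infinity>, first_turn h (\<theta> w)) = rounded_times \<rho> w"
    by (rule run_game_grid(1)[OF h w(2) later c oth R_def x ge])
  show "actual_time N \<rho> j w = grid_time h (rounded_times \<rho> w j)" if "j \<in> {1..N}" "j \<noteq> i" for j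
    unfolding R by (rule run_game_grid(2)[OF h w(2) later c oth R_def x ge that])
qed

text \<open>The actual stop of a player in any profile does not anticipate, and rounding up preserves this.\<close>

lemma rounded_times_plan:
  assumes \<rho>: "\<And>i. i \<in> {1..N} \<Longrightarrow> \<rho> i \<in> strategies M F N i" and i: "i \<in> {1..N}"
  shows "(\<lambda>w. if w \<in> space M then rounded_times \<rho> w i else \<infinity>) \<in> plans {k. turn N k = i} 0"
proof -
  let ?\<xi> = "\<lambda>w. if w \<in> space M then rounded_times \<rho> w i else \<infinity>"
  have enat: "?\<xi> w' = enat k" if k: "?\<xi> w = enat k" and w': "w' \<in> level h (enat k) w" for k w w'
  proof -
    have w: "w \<in> space M" using k by (auto split: if_splits)
    have r: "round_up N h i (actual_time N \<rho> i w) = enat k"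
      using k i w by (simp add: rounded_times_def)
    then have "actual_time N \<rho> i w \<le> grid_time h (enat k)"
      by (simp add: round_up_def hit_eq_enat_iff)
    then have "actual_time N \<rho> i w' = actual_time N \<rho> i w"
      using w' by (intro actual_time_nonanticipating[OF \<rho> w _ i]) auto
    moreover have "w' \<in> space M" using w' w atom_F_space by auto
    ultimately show ?thesis using r i by (simp add: rounded_times_def)
  qed
  have "stop_rule ?\<xi>"
    unfolding stop_rule_def
  proof (intro allI ballI)
    fix w w' assume w': "w' \<in> level h (?\<xi> w) w"
    show "?\<xi> w' = ?\<xi> w"
    proof (cases "?\<xi> w")
      case k: (enat k)
      then have "w' \<in> level h (enat k) w" using w' by simp
      from enat[OF k this] show ?thesis using k by simp
    next
      case inf: infinity
      show ?thesis
      proof (cases "?\<xi> w'")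
        case k: (enat k)
        have "w' \<in> level h (enat k) w" using w' inf cls_mono[of "enat k" \<infinity> w] by auto
        then have "w \<in> level h (enat k) w'" by (rule cls_sym)
        from enat[OF k this] show ?thesis using k by simp
      qed (use inf in simp)
    qed
  qed
  moreover have "?\<xi> w = \<infinity> \<or> (\<exists>k\<in>{k. turn N k = i}. 0 \<le> k \<and> ?\<xi> w = enat k)" for w
    using i by (cases "round_up N h i (actual_time N \<rho> i w)")
      (auto simp: rounded_times_def round_up_def hit_eq_enat_iff)
  ultimately show ?thesis
    unfolding plans_def by blast
qed

end

section \<open>Existence of an equilibrium\<close>

lemma modulus_vanishes:
  fixes \<eta> :: "real \<Rightarrow> real"
  assumes "(\<eta> \<longlongrightarrow> 0) (at_right 0)" "0 < \<epsilon>"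
  obtains d where "0 < d" "\<And>x. 0 < x \<Longrightarrow> x < d \<Longrightarrow> \<eta> x < \<epsilon>"
proof -
  have "eventually (\<lambda>x. \<eta> x < \<epsilon>) (at_right 0)"
    using assms by (intro order_tendstoD(2)) auto
  then show ?thesis
    using that unfolding eventually_at_right_field by auto
qed

lemma extend_top_le:
  assumes "mono_on {0..} \<eta>" "0 \<le> b" "x \<le> ennreal b"
  shows "extend_top \<eta> x \<le> \<eta> b"
proof -
  have "x \<noteq> \<top>" using assms(3) by (auto simp: top_unique)
  moreover have "enn2real x \<le> b"
    using enn2real_mono[OF assms(3)] assms(2) by simp
  ultimately show ?thesis
    using assms by (auto simp: extend_top_def intro: mono_onD[OF assms(1)])
qed

lemma extend_top_bound:
  assumes "\<And>x. 0 \<le> x \<Longrightarrow> \<eta> x \<le> B"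
  shows "extend_top \<eta> x \<le> B"
  using assms by (auto simp: extend_top_def intro!: cSUP_least)

context grid_profile
begin

text \<open>On the atom of \<open>\<F>\<^sub>\<theta>\<close> the stopping time \<open>\<theta>\<close> is constant, and if it is finite, the atom is a union of information classes
  at the first turn after it. In each class the discrete equilibrium bounds the gain of the rounded deviation by
  \<open>\<epsilon>1\<close>, and undoing the rounding changes the deviator's payoff by at most \<open>\<epsilon>2\<close>. The variable \<open>base\<close>, known at time zero,
  makes the payoffs bounded.\<close>

lemma deviation_gain:
  fixes U :: "nat \<Rightarrow> (nat \<Rightarrow> ennreal) \<Rightarrow> 'a \<Rightarrow> real" and u :: "(nat \<Rightarrow> enat) \<Rightarrow> 'a \<Rightarrow> real"
    and \<rho> :: "'a strategy" and \<rho>' :: "nat \<Rightarrow> 'a strategy"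
  assumes i: "i \<in> {1..N}"
    and \<rho>': "\<rho>' = grid_strategy" and \<rho>: "\<rho> \<in> strategies_from M F N \<theta> i"
    and u: "\<And>y w. w \<in> space M \<Longrightarrow> u y w = U i (\<lambda>j\<in>{1..N}. grid_time h (y j)) w - base w"
    and u_bound: "\<And>y w. \<bar>u y w\<bar> \<le> B"
    and base: "\<And>w w'. w \<in> space M \<Longrightarrow> w' \<in> atom (F 0) w \<Longrightarrow> base w' = base w"
    and U_bound: "\<And>t w. t \<in> {1..N} \<rightarrow>\<^sub>E UNIV \<Longrightarrow> w \<in> space M \<Longrightarrow> \<bar>U i t w - base w\<bar> \<le> B"
    and U_atom: "\<And>t w w'. t \<in> {1..N} \<rightarrow>\<^sub>E UNIV \<Longrightarrow> w \<in> space M \<Longrightarrow> w' \<in> atom M w \<Longrightarrow> U i t w' = U i t w"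
    and equilibrium: "\<And>n \<xi> w. \<xi> \<in> plans {k. turn N k = i} n \<Longrightarrow> w \<in> set_pmf rep_pmf \<Longrightarrow>
      avg n (\<lambda>w. u (play N (turn N) (deviate P i \<xi> w) (\<lambda>_. \<infinity>, n)) w) w
        \<le> avg n (\<lambda>w. u (play N (turn N) (\<lambda>s j. P s j w) (\<lambda>_. \<infinity>, n)) w) w + \<epsilon>1"
    and "0 \<le> \<epsilon>1" "0 \<le> \<epsilon>2"
    and close: "\<And>t t' w. t \<in> {1..N} \<rightarrow>\<^sub>E UNIV \<Longrightarrow> t' \<in> {1..N} \<rightarrow>\<^sub>E UNIV \<Longrightarrow> w \<in> space M \<Longrightarrow>
      (\<Sum>j\<in>{1..N}. time_dist (t j) (t' j)) \<le> ennreal (real N * h) \<Longrightarrow> U i t w \<le> U i t' w + \<epsilon>2"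
    and w0: "w0 \<in> space M"
  shows "cond_payoff M F N U \<theta> i (\<rho>'(i := \<rho>)) w0 \<le> cond_payoff M F N U \<theta> i \<rho>' w0 + (\<epsilon>1 + \<epsilon>2)"
proof -
  define \<sigma> where "\<sigma> = \<rho>'(i := \<rho>)"
  define pay where "pay \<tau> w = U i (\<lambda>j\<in>{1..N}. actual_time N \<tau> j w) w" for \<tau> w
  define C where "C = atom (pre_sigma \<theta>) w0"
  have C_eq: "C = atom (F (\<theta> w0)) w0"
    unfolding C_def by (rule atom_pre_sigma[OF \<theta> w0])
  have C_space: "w \<in> space M" if "w \<in> C" for w
    using that w0 atom_F_space unfolding C_eq by blast
  have C_sets [measurable]: "C \<in> sets M"
    using sets_atom[OF countable_space_F, of w0 "\<theta> w0"] w0 sets_F_subset unfolding C_eq by (auto simp: space_F)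
  have C_pos: "0 < measure M C"
    by (rule full_support[OF C_sets]) (use atom_self[of w0 "pre_sigma \<theta>"] in \<open>auto simp: C_def\<close>)
  have \<theta>_C: "\<theta> w = \<theta> w0" if "w \<in> C" for w
    using that unfolding C_eq by (intro \<theta>_nonanticipating[OF w0]) auto
  have from_\<rho>': "\<rho>' j \<in> strategies_from M F N \<theta> j" if "j \<in> {1..N}" for j
    unfolding \<rho>' using that by (rule grid_strategy_in_strategies)
  then have from_\<sigma>: "\<sigma> j \<in> strategies_from M F N \<theta> j" if "j \<in> {1..N}" for j
    using that \<rho> by (auto simp: \<sigma>_def)
  have strat: "\<tau> j \<in> strategies M F N j" if "\<tau> \<in> {\<sigma>, \<rho>'}" "j \<in> {1..N}" for \<tau> j
    using from_\<rho>'[OF that(2)] from_\<sigma>[OF that(2)] that(1) by (auto simp: strategies_from_def)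
  have times_PiE: "(\<lambda>j\<in>{1..N}. f j) \<in> {1..N} \<rightarrow>\<^sub>E UNIV" for f :: "nat \<Rightarrow> ennreal"
    by simp
  have pay_atom: "pay \<tau> w' = pay \<tau> w" if "\<tau> \<in> {\<sigma>, \<rho>'}" "w \<in> space M" "w' \<in> atom M w" for \<tau> w w'
  proof -
    have "(\<lambda>j\<in>{1..N}. actual_time N \<tau> j w') = (\<lambda>j\<in>{1..N}. actual_time N \<tau> j w)"
      using actual_time_atom_const[OF strat[OF that(1)] that(2,3)] by (intro restrict_ext) simp
    then show ?thesis unfolding pay_def using U_atom[OF times_PiE that(2,3)] by simp
  qed
  have pay_bound: "\<bar>pay \<tau> w - base w\<bar> \<le> B" if "w \<in> space M" for \<tau> w
    unfolding pay_def by (rule U_bound[OF times_PiE that])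
  have pay_meas: "pay \<tau> \<in> borel_measurable M" if "\<tau> \<in> {\<sigma>, \<rho>'}" for \<tau>
    by (rule measurable_if_atom_const[OF countable_space]) (use pay_atom[OF that] in auto)
  have base_C: "base w = base w0" if "w \<in> C" for w
    using that atom_F_mono[of 0 "\<theta> w0" w0] unfolding C_eq by (intro base[OF w0]) auto
  have pay_C: "\<bar>pay \<tau> w\<bar> \<le> \<bar>base w0\<bar> + B" if "w \<in> C" for \<tau> w
    using pay_bound[OF C_space[OF that], of \<tau>] base_C[OF that] by linarith
  have cond: "cond_payoff M F N U \<theta> i \<tau> w0 = (\<integral>x. indicator C x * pay \<tau> x \<partial>M) / measure M C"
    if "\<tau> \<in> {\<sigma>, \<rho>'}" for \<tau>
    unfolding cond_payoff_def pay_def[symmetric] C_def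
    by (rule real_cond_exp_atom[OF subalgebra_pre_sigma[OF \<theta>] countable_space pay_meas[OF that] w0])
      (use C_pos pay_C in \<open>auto simp: C_def\<close>)
  have int: "integrable M (\<lambda>x. indicator C x * pay \<tau> x)" if "\<tau> \<in> {\<sigma>, \<rho>'}" for \<tau>
  proof (rule integrable_const_bound[of _ "\<bar>base w0\<bar> + B"])
    have "0 \<le> B" using u_bound[of "\<lambda>_. 0" w0] by simp
    then show "AE x in M. norm (indicator C x * pay \<tau> x) \<le> \<bar>base w0\<bar> + B"
      using pay_C by (intro AE_I2) (auto simp: indicator_def)
  qed (use pay_meas[OF that] in simp)
  \<comment> \<open>The claim is that the integral of \<open>g\<close> over the atom is nonnegative.\<close>
  define g where "g w = (if w \<in> space M then pay \<rho>' w - pay \<sigma> w + (\<epsilon>1 + \<epsilon>2) else 0)" for w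
  have bdd_g: "bdd g"
  proof (rule bddI)
    fix w
    have "0 \<le> B" using u_bound[of "\<lambda>_. 0" w0] by simp
    then show "\<bar>g w\<bar> \<le> 2 * B + (\<epsilon>1 + \<epsilon>2)"
      using pay_bound[of w \<rho>'] pay_bound[of w \<sigma>] \<open>0 \<le> \<epsilon>1\<close> \<open>0 \<le> \<epsilon>2\<close>
      by (cases "w \<in> space M") (simp_all add: g_def)
  qed
  have "0 \<le> (\<integral>x. indicator C x * g x \<partial>rep_pmf)"
  proof (cases "\<theta> w0 = \<top>")
    case True
    have "g w = \<epsilon>1 + \<epsilon>2" if "w \<in> C" for w
    proof -
      have "actual_time N \<tau> j w = \<top>" if "\<tau> \<in> {\<sigma>, \<rho>'}" "j \<in> {1..N}" for \<tau> j
      proof -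
        have "\<theta> w \<le> actual_time N \<tau> j w"
          using that from_\<rho>' from_\<sigma> C_space[OF \<open>w \<in> C\<close>] by (intro actual_time_ge) auto
        then show ?thesis using \<theta>_C[OF \<open>w \<in> C\<close>] True by (simp add: top_unique)
      qed
      then have "(\<lambda>j\<in>{1..N}. actual_time N \<sigma> j w) = (\<lambda>j\<in>{1..N}. actual_time N \<rho>' j w)"
        by (intro restrict_ext) simp
      then show ?thesis using C_space[OF that] by (simp add: g_def pay_def)
    qed
    then show ?thesis
      using \<open>0 \<le> \<epsilon>1\<close> \<open>0 \<le> \<epsilon>2\<close> by (intro integral_nonneg_AE AE_I2) (auto simp: indicator_def)
  next
    case False
    then have top: "\<theta> w0 < \<top>" by (simp add: less_top)
    define k0 where "k0 = first_turn h (\<theta> w0)"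
    have k0: "\<theta> w0 \<le> grid_time h (enat k0)"
      using first_turn_le_iff[OF h top, of k0] by (simp add: k0_def)
    \<comment> \<open>The discrete plan that corresponds to the deviation. The cut at \<open>k0\<close> only affects states outside the atom.\<close>
    define \<xi>0 where "\<xi>0 w = (if w \<in> space M then rounded_times \<sigma> w i else \<infinity>)" for w
    define \<xi> where "\<xi> w = (if \<xi>0 w < enat k0 then \<infinity> else \<xi>0 w)" for w
    have "\<xi>0 \<in> plans {k. turn N k = i} 0"
      unfolding \<xi>0_def using strat i by (intro rounded_times_plan) auto
    then have \<xi>: "\<xi> \<in> plans {k. turn N k = i} k0"
      unfolding \<xi>_def by (rule plans_from)
    let ?dev = "\<lambda>w. play N (turn N) (deviate P i \<xi> w) (\<lambda>_. \<infinity>, k0)"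
    let ?out = "\<lambda>w. play N (turn N) (\<lambda>s j. P s j w) (\<lambda>_. \<infinity>, k0)"
    have out: "pay \<rho>' w = u (?out w) w + base w" if "w \<in> C" for w
    proof -
      have w: "w \<in> space M" "\<theta> w < \<top>" "first_turn h (\<theta> w) = k0"
        using that C_space \<theta>_C top by (auto simp: k0_def)
      \<comment> \<open>There is no player \<open>0\<close>, so this is play without deviation.\<close>
      have play: "play N (turn N) (\<lambda>s j. if j = 0 then rounded_times \<rho>' w 0 else P s j w)
          (\<lambda>_. \<infinity>, k0) = rounded_times \<rho>' w"
        using actual_time_grid(1)[of \<rho>' 0 w] from_\<rho>' w by (simp add: \<rho>')
      have "?out w = play N (turn N) (\<lambda>s j. if j = 0 then rounded_times \<rho>' w 0 else P s j w) (\<lambda>_. \<infinity>, k0)"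
        by (rule play_cong) (auto simp: remaining_def)
      moreover have "actual_time N \<rho>' j w = grid_time h (rounded_times \<rho>' w j)" if "j \<in> {1..N}" for j
        using actual_time_grid(2)[of \<rho>' 0 w j] from_\<rho>' w that by (simp add: \<rho>')
      then have "(\<lambda>j\<in>{1..N}. actual_time N \<rho>' j w) = (\<lambda>j\<in>{1..N}. grid_time h (rounded_times \<rho>' w j))"
        by (intro restrict_ext)
      ultimately show ?thesis
        using u[OF w(1)] play by (simp add: pay_def)
    qed
    have dev: "pay \<sigma> w \<le> u (?dev w) w + base w + \<epsilon>2" if "w \<in> C" for w
    proof -
      have w: "w \<in> space M" "\<theta> w < \<top>" "first_turn h (\<theta> w) = k0"
        using that C_space \<theta>_C top by (auto simp: k0_def)
      define x where "x = rounded_times \<sigma> w"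
      have others: "j \<in> {1..N} \<Longrightarrow> j \<noteq> i \<Longrightarrow> \<sigma> j = grid_strategy j" for j
        by (simp add: \<sigma>_def \<rho>')
      have x_i: "x i = round_up N h i (actual_time N \<sigma> i w)"
        using i by (simp add: x_def rounded_times_def)
      have "\<theta> w \<le> actual_time N \<sigma> i w"
        using from_\<sigma> w i by (intro actual_time_ge) auto
      then have "enat k0 \<le> x i"
      proof (cases "x i")
        case (enat k)
        then have "actual_time N \<sigma> i w \<le> grid_time h (enat k)"
          using x_i by (simp add: round_up_def hit_eq_enat_iff)
        then have "\<theta> w \<le> grid_time h (enat k)"
          using \<open>\<theta> w \<le> actual_time N \<sigma> i w\<close> by simp
        then show ?thesis using first_turn_le_iff[OF h w(2), of k] w(3) enat by simp
      qed simp
      then have "\<xi> w = x i"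
        using w(1) by (simp add: \<xi>_def \<xi>0_def x_def not_less[symmetric])
      then have "deviate P i \<xi> w = (\<lambda>s j. if j = i then x i else P s j w)"
        by (intro ext) (simp add: deviate_def)
      then have play: "?dev w = x"
        using actual_time_grid(1)[of \<sigma> i w, folded x_def] from_\<sigma> others w by simp
      have same: "actual_time N \<sigma> j w = grid_time h (x j)" if "j \<in> {1..N}" "j \<noteq> i" for j
        unfolding x_def using that from_\<sigma> others w by (intro actual_time_grid(2)) auto
      have near: "time_dist (actual_time N \<sigma> i w) (grid_time h (x i)) \<le> ennreal (real N * h)"
      proof (cases "actual_time N \<sigma> i w = \<top>")
        case True
        then show ?thesis by (simp add: x_i time_dist_def)
      next
        case False
        then obtain k where k: "x i = enat k" "actual_time N \<sigma> i w \<le> grid_time h (enat k)"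
          "grid_time h (enat k) \<le> actual_time N \<sigma> i w + ennreal (real N * h)"
          using round_up_approx[OF h i, of "actual_time N \<sigma> i w"] x_i by (metis less_top)
        then show ?thesis
          using False by (auto simp: time_dist_def max_absorb2 min_absorb1 ennreal_minus_le_iff)
      qed
      have "(\<Sum>j\<in>{1..N}. time_dist ((\<lambda>j\<in>{1..N}. actual_time N \<sigma> j w) j) ((\<lambda>j\<in>{1..N}. grid_time h (x j)) j))
          = (\<Sum>j\<in>{1..N}. if j = i then time_dist (actual_time N \<sigma> i w) (grid_time h (x i)) else 0)"
        using same by (intro sum.cong) (auto simp: time_dist_def)
      also have "\<dots> = time_dist (actual_time N \<sigma> i w) (grid_time h (x i))"
        using i by (simp add: sum.delta)
      finally have "pay \<sigma> w \<le> U i (\<lambda>j\<in>{1..N}. grid_time h (x j)) w + \<epsilon>2"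
        unfolding pay_def using near w(1) by (intro close times_PiE) simp_all
      then show ?thesis using u[OF w(1)] play by simp
    qed
    have bdd_u: "bdd (\<lambda>w. u (f w) w)" for f
      using u_bound by (rule bddI)
    show ?thesis
    proof (rule integral_cells_nonneg[OF bdd_g, where Q = "level h (enat k0)"])
      show "w \<in> level h (enat k0) w" for w by (rule cls_self)
      show "w' \<in> level h (enat k0) w \<Longrightarrow> level h (enat k0) w' = level h (enat k0) w" for w w'
        by (rule cls_eq)
      show sub: "level h (enat k0) w \<subseteq> C" if "w \<in> C" for w
      proof -
        have "level h (enat k0) w \<subseteq> atom (F (\<theta> w0)) w"
          using atom_F_mono[OF k0] by simp
        also have "\<dots> = C" using that atom_eq unfolding C_eq by metis
        finally show ?thesis .
      qed
      fix w assume w: "w \<in> set_pmf rep_pmf" "w \<in> C"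
      let ?I = "indicator (level h (enat k0) w) :: 'a \<Rightarrow> real"
      have "0 \<le> (\<integral>x. ?I x * (u (?out x) x + \<epsilon>1 - u (?dev x) x) \<partial>rep_pmf)"
        using equilibrium[OF \<xi> w(1)] unfolding avg_le_iff[OF bdd_u bdd_u w(1)] .
      also have "\<dots> \<le> (\<integral>x. ?I x * g x \<partial>rep_pmf)"
      proof (rule integral_mono)
        show "integrable (measure_pmf rep_pmf) (\<lambda>x. ?I x * (u (?out x) x + \<epsilon>1 - u (?dev x) x))"
          by (intro integrable_bdd bdd_indicator bdd_diff bdd_add bdd_u bdd_const)
        show "integrable (measure_pmf rep_pmf) (\<lambda>x. ?I x * g x)"
          by (intro integrable_bdd bdd_indicator bdd_g)
        fix x
        show "?I x * (u (?out x) x + \<epsilon>1 - u (?dev x) x) \<le> ?I x * g x"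
        proof (cases "x \<in> level h (enat k0) w")
          case True
          then have "x \<in> C" using sub[OF w(2)] by blast
          then show ?thesis using True dev[of x] out[of x] C_space[of x] by (simp add: g_def)
        qed simp
      qed
      finally show "0 \<le> (\<integral>x. ?I x * g x \<partial>rep_pmf)" .
    qed
  qed
  also have "\<dots> = (\<integral>x. indicator C x * g x \<partial>M)"
  proof (rule integral_rep_pmf)
    fix w w' assume w: "w \<in> space M" "w' \<in> atom M w"
    then have "w' \<in> space M" by (rule atom_space)
    moreover have "w' \<in> C \<longleftrightarrow> w \<in> C" using atomD[OF C_sets w(2)] by simp
    ultimately show "indicator C w' * g w' = indicator C w * g w"
      using pay_atom[OF _ w] w(1) by (simp add: g_def indicator_def)
  qed
  also have "\<dots> = (\<integral>x. indicator C x * pay \<rho>' x - indicator C x * pay \<sigma> x + indicator C x * (\<epsilon>1 + \<epsilon>2) \<partial>M)"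
    by (intro Bochner_Integration.integral_cong) (auto simp: g_def indicator_def)
  also have "\<dots> = (\<integral>x. indicator C x * pay \<rho>' x \<partial>M) - (\<integral>x. indicator C x * pay \<sigma> x \<partial>M) + measure M C * (\<epsilon>1 + \<epsilon>2)"
  proof -
    have "integrable M (\<lambda>x. indicator C x * (\<epsilon>1 + \<epsilon>2))"
      by (intro integrable_const_bound[of _ "\<epsilon>1 + \<epsilon>2"] AE_I2)
        (use \<open>0 \<le> \<epsilon>1\<close> \<open>0 \<le> \<epsilon>2\<close> in \<open>auto simp: indicator_def\<close>)
    moreover have "(\<integral>x. indicator C x * (\<epsilon>1 + \<epsilon>2) \<partial>M) = measure M C * (\<epsilon>1 + \<epsilon>2)"
      using C_sets sets.sets_into_space[OF C_sets] by (simp add: Int_absorb2)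
    ultimately show ?thesis
      using int[of \<rho>'] int[of \<sigma>]
      by (subst Bochner_Integration.integral_add, simp_all only: Bochner_Integration.integrable_diff
          Bochner_Integration.integral_diff insert_iff simp_thms)
  qed
  finally have "(\<integral>x. indicator C x * pay \<sigma> x \<partial>M) \<le> (\<integral>x. indicator C x * pay \<rho>' x \<partial>M) + measure M C * (\<epsilon>1 + \<epsilon>2)"
    by simp
  then have "(\<integral>x. indicator C x * pay \<sigma> x \<partial>M) / measure M C
      \<le> ((\<integral>x. indicator C x * pay \<rho>' x \<partial>M) + measure M C * (\<epsilon>1 + \<epsilon>2)) / measure M C"
    using C_pos by (simp add: divide_right_mono)
  then show ?thesis
    unfolding \<sigma>_def[symmetric] using cond[of \<sigma>] cond[of \<rho>'] C_pos by (simp add: add_divide_distrib)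
qed

end

theorem theorem2p6:
  fixes M :: "'a measure" and F :: "ennreal \<Rightarrow> 'a measure"
    and N :: nat and U :: "nat \<Rightarrow> (nat \<Rightarrow> ennreal) \<Rightarrow> 'a \<Rightarrow> real"
    and \<eta> :: "real \<Rightarrow> real" and \<theta> :: "'a \<Rightarrow> ennreal" and \<epsilon> :: real
  assumes "countable_filtered_prob_space M F"
    and "\<And>i t. i \<in> {1..N} \<Longrightarrow> t \<in> {1..N} \<rightarrow>\<^sub>E UNIV \<Longrightarrow>
           U i t \<in> borel_measurable (F (Max (t ` {1..N})))"
    and "\<And>x. x \<ge> 0 \<Longrightarrow> \<eta> x \<ge> 0"
    and "bounded (\<eta> ` {0..})"
    and "mono_on {0..} \<eta>"
    and "\<eta> 0 = 0"
    and "(\<eta> \<longlongrightarrow> 0) (at_right 0)"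
    and "\<And>i t t' \<omega>. i \<in> {1..N} \<Longrightarrow> t \<in> {1..N} \<rightarrow>\<^sub>E UNIV \<Longrightarrow> t' \<in> {1..N} \<rightarrow>\<^sub>E UNIV \<Longrightarrow>
           \<omega> \<in> space M \<Longrightarrow>
           \<bar>U i t \<omega> - U i t' \<omega>\<bar> \<le> extend_top \<eta> (\<Sum>j\<in>{1..N}. time_dist (t j) (t' j))"
    and "stopping_time F \<theta>"
    and "\<epsilon> > 0"
  shows "\<exists>\<rho>. eps_Nash_equilibrium M F N U \<theta> \<epsilon> \<rho>"
proof -
  interpret countable_filtered_prob_space M F by fact
  obtain d where d: "0 < d" "\<And>x. 0 < x \<Longrightarrow> x < d \<Longrightarrow> \<eta> x < \<epsilon> / 2"
    using modulus_vanishes[OF assms(7), of "\<epsilon> / 2"] assms(10) by auto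
  \<comment> \<open>A mesh for which rounding costs at most half of \<open>\<epsilon>\<close>.\<close>
  define h where "h = d / (2 * (real N + 1))"
  have h: "0 < h" "real N * h < d"
    using d(1) by (auto simp: h_def field_simps intro: add_nonneg_pos)
  have \<eta>_h: "\<eta> (real N * h) \<le> \<epsilon> / 2" if "1 \<le> N"
    using d(2)[of "real N * h"] h that by simp
  obtain B where B: "\<And>x. 0 \<le> x \<Longrightarrow> \<eta> x \<le> B"
    using assms(4) unfolding bounded_iff by (auto simp: abs_le_iff)
  have "0 \<le> B" using B[of 0] assms(6) by simp
  define base where "base i w = U i (\<lambda>j\<in>{1..N}. 0) w" for i w
  define u where "u i y w = (if i \<in> {1..N} \<and> w \<in> space M
    then U i (\<lambda>j\<in>{1..N}. grid_time h (y j)) w - base i w else 0)" for i y w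
  have U_bound: "\<bar>U i t w - base i w\<bar> \<le> B" if "i \<in> {1..N}" "t \<in> {1..N} \<rightarrow>\<^sub>E UNIV" "w \<in> space M" for i t w
  proof -
    have "\<bar>U i t w - base i w\<bar> \<le> extend_top \<eta> (\<Sum>j\<in>{1..N}. time_dist (t j) ((\<lambda>j\<in>{1..N}. 0) j))"
      unfolding base_def using that by (intro assms(8)) auto
    also have "\<dots> \<le> B"
      using B by (rule extend_top_bound)
    finally show ?thesis .
  qed
  have u_bound: "\<bar>u i y w\<bar> \<le> B" for i y w
    using U_bound[of i "\<lambda>j\<in>{1..N}. grid_time h (y j)" w] \<open>0 \<le> B\<close> by (simp add: u_def)
  \<comment> \<open>Every one of up to \<open>N\<close> stages loses \<open>2 \<epsilon>'\<close>.\<close>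
  define \<epsilon>' where "\<epsilon>' = \<epsilon> / (4 * (real N + 1))"
  have \<epsilon>': "0 < \<epsilon>'" "real N * (2 * \<epsilon>') \<le> \<epsilon> / 2"
    using assms(10) by (auto simp: \<epsilon>'_def field_simps)
  interpret info_tree rep_pmf "level h"
    by (rule info_tree_level[OF h(1)])
  obtain P where P: "\<And>y n j. j \<in> remaining N y \<Longrightarrow> P (y, n) j \<in> plans {k. turn N k = j} n"
    and equilibrium: "\<And>y n i \<xi> w. i \<in> remaining N y \<Longrightarrow> \<xi> \<in> plans {k. turn N k = i} n \<Longrightarrow> w \<in> set_pmf rep_pmf \<Longrightarrow>
      avg n (\<lambda>w. u i (play N (turn N) (deviate P i \<xi> w) (y, n)) w) w
      \<le> avg n (\<lambda>w. u i (play N (turn N) (\<lambda>s j. P s j w) (y, n)) w) w + real (card (remaining N y)) * (2 * \<epsilon>')"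
    using discrete_equilibrium[where u = u and pl = "turn N" and N = N, OF u_bound \<epsilon>'(1)] by blast
  interpret grid_profile M F h N \<theta> P
    by unfold_locales (use h(1) assms(9) P in auto)
  have "cond_payoff M F N U \<theta> i (grid_strategy(i := \<rho> i)) w \<le> cond_payoff M F N U \<theta> i grid_strategy w + \<epsilon>"
    if \<rho>: "\<rho> \<in> (\<Pi> i\<in>{1..N}. strategies_from M F N \<theta> i)" and i: "i \<in> {1..N}" and w: "w \<in> space M" for \<rho> i w
  proof -
    have N: "1 \<le> N" using i by simp
    have zero: "Max ((\<lambda>j\<in>{1..N}. 0) ` {1..N}) = (0 :: ennreal)"
      using N by (intro Max_eqI) auto
    have all: "remaining N (\<lambda>_. \<infinity>) = {1..N}" by (auto simp: remaining_def)
    have "cond_payoff M F N U \<theta> i (grid_strategy(i := \<rho> i)) w \<le>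
        cond_payoff M F N U \<theta> i grid_strategy w + (real N * (2 * \<epsilon>') + \<epsilon> / 2)"
    proof (rule deviation_gain[where u = "u i" and base = "base i" and B = B])
      show "i \<in> {1..N}" by (rule i)
      show "\<rho> i \<in> strategies_from M F N \<theta> i" using \<rho> i by auto
      show "u i y w = U i (\<lambda>j\<in>{1..N}. grid_time h (y j)) w - base i w" if "w \<in> space M" for y w
        using that i by (simp add: u_def)
      show "\<bar>u i y w\<bar> \<le> B" for y w by (rule u_bound)
      show "base i w' = base i w" if "w \<in> space M" "w' \<in> atom (F 0) w" for w w'
        using measurable_atom_const[OF assms(2)[OF i, of "\<lambda>j\<in>{1..N}. 0"], of w w'] that
        unfolding zero base_def by (simp add: space_F)
      show "\<bar>U i t w - base i w\<bar> \<le> B" if "t \<in> {1..N} \<rightarrow>\<^sub>E UNIV" "w \<in> space M" for t w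
        using U_bound[OF i that] .
      show "U i t w' = U i t w" if "t \<in> {1..N} \<rightarrow>\<^sub>E UNIV" "w \<in> space M" "w' \<in> atom M w" for t w w'
        using measurable_atom_const[OF assms(2)[OF i that(1)], of w w'] that(2,3) atom_mono[OF sets_F_subset]
        by (auto simp: space_F)
      show "avg n (\<lambda>w. u i (play N (turn N) (deviate P i \<xi> w) (\<lambda>_. \<infinity>, n)) w) w
          \<le> avg n (\<lambda>w. u i (play N (turn N) (\<lambda>s j. P s j w) (\<lambda>_. \<infinity>, n)) w) w + real N * (2 * \<epsilon>')"
        if "\<xi> \<in> plans {k. turn N k = i} n" "w \<in> set_pmf rep_pmf" for n \<xi> w
        using equilibrium[of i "\<lambda>_. \<infinity>" \<xi> n w] that i unfolding all by simp
      show "0 \<le> real N * (2 * \<epsilon>')" "0 \<le> \<epsilon> / 2" using \<epsilon>'(1) assms(10) by auto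
      show "U i t w \<le> U i t' w + \<epsilon> / 2" if "t \<in> {1..N} \<rightarrow>\<^sub>E UNIV" "t' \<in> {1..N} \<rightarrow>\<^sub>E UNIV" "w \<in> space M"
        "(\<Sum>j\<in>{1..N}. time_dist (t j) (t' j)) \<le> ennreal (real N * h)" for t t' w
      proof -
        have "extend_top \<eta> (\<Sum>j\<in>{1..N}. time_dist (t j) (t' j)) \<le> \<eta> (real N * h)"
          using h(1) that(4) by (intro extend_top_le[OF assms(5)]) auto
        then show ?thesis using assms(8)[OF i that(1-3)] \<eta>_h[OF N] by linarith
      qed
      show "w \<in> space M" by (rule w)
    qed simp
    then show ?thesis using \<epsilon>'(2) by linarith
  qed
  then show ?thesis
    using grid_strategy_in_strategies unfolding eps_Nash_equilibrium_def
    by (intro exI[of _ grid_strategy]) auto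
qed

end
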